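(* Let $\bar H_\Lambda(\sigma;\beta)=\sum_{p\ge 1}(\sqrt c)^{-p}\beta_p H^{(p)}_\Lambda(\sigma)$ be the complete Hamiltonian described in the context, built from a thermodynamically stable Gaussian spin glass, with quenched state $\langle\cdot\rangle_{\Lambda,\beta}$, and for replicas $\sigma^{(1)},\sigma^{(2)},\dots$ write $c_{j,k}=c_\Lambda(\sigma^{(j)},\sigma^{(k)})$. The model satisfies the following properties. (i) (Stochastic stability in the strong sense.) For every power $p\in\mathbb N$ ($p\ge1$) and for almost every $\beta_p$, $$\lim_{\Lambda\nearrow\mathbb Z^d}\Big\langle \sum_{\substack{j,k=1\\ j\ne k}}^n f\,c_{j,k}^p-2n f\sum_{k=1}^n c_{k,n+1}^p+n(n+1)f\,c_{n+1,n+2}^p\Big\rangle_{\Lambda,\beta}=0 ,\qquad(\mathrm{S})$$ where $n\ge1$ and $f$ is a continuous function of the variables $c_{j,k}$, $1\le j<k\le n$. (ii) (Ghirlanda-Guerra identities in distribution.) For every $n\ge2$, every continuous function $f$ of $(c_{j,k})_{1\le j<k\le n}$, every power $p\in\mathbb N$ ($p\ge1$) and almost every $\beta_p$, $$\lim_{\Lambda\nearrow\mathbb Z^d}\Big[\langle f\,c_{n+1,n+2}^p\rangle_{\Lambda,\beta}-\frac1{n+1}\sum_{k=1}^n\langle f\,c_{k,n+1}^p\rangle_{\Lambda,\beta}-\frac1{n+1}\langle f\rangle_{\Lambda,\beta}\langle c_{1,2}^p\rangle_{\Lambda,\beta}\Big]=0 .\qquad(\mathrm{GG})$$ Moreover,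 let $$\bar p(\beta)=\lim_{\Lambda\nearrow\mathbb Z^d}\frac1{|\Lambda|}\mathbb E\Big[\log\sum_\sigma \exp(-\bar H_\Lambda(\sigma;\beta))\Big]$$ be the thermodynamic limit of the pressure, whose existence is ensured by thermodynamic stability. For every $p\in\mathbb N$ ($p\ge1$), if $\bar p(\beta)$ is differentiable in the $\beta_p$ direction at the point $\beta_p=a$, then: (iii) the model is pointwise stochastically stable in the strong sense: (S) holds at the point $\beta_p=a$, for $n$ and $f$ as in (i); (iv) the model fulfills the Ghirlanda-Guerra identities in distribution pointwise: (GG) holds at the point $\beta_p=a$, for every $n\ge2$ and $f$ as in (ii).
   Context: Fix $d\ge1$. For each finite $\Lambda\subset\mathbb Z^d$, spin configurations are $\sigma\in\{-1,1\}^\Lambda$, and $\sigma_X=\prod_{x\in X}\sigma_x$ for $X\subseteq\Lambda$. Let $$H_\Lambda(\sigma)=-\sum_{X\subseteq\Lambda}J_{\Lambda,X}\sigma_X,$$ where the $J_{\Lambda,X}$ are independent centered Gaussian random variables with variances $\Delta^2_{\Lambda,X}$ ($\Delta_{\Lambda,X}\ge0$). Its normalized covariance is $$c_\Lambda(\sigma,\tau)=\frac1{|\Lambda|}\mathbb E[H_\Lambda(\sigma)H_\Lambda(\tau)]=\frac1{|\Lambda|}\sum_{X\subseteq\Lambda}\Delta_{\Lambda,X}^2\sigma_X\tau_X .$$ Thermodynamic stability is assumed: there is a constant $0<c<\infty$ with $\sup_\Lambda \frac1{|\Lambda|}\sum_{X\subseteq\Lambda}\Delta^2_{\Lambda,X}\le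 c$. Complete Hamiltonian: $\bar H_\Lambda(\sigma;\beta)=\sum_{p\ge1}(\sqrt c)^{-p}\beta_pH^{(p)}_\Lambda(\sigma)$, where $H^{(1)}_\Lambda=H_\Lambda$, the families $(H^{(p)}_\Lambda(\sigma))_\sigma$, $p\ge1$, are independent centered Gaussian families with $\frac1{|\Lambda|}\mathbb E[H^{(p)}_\Lambda(\sigma)H^{(p)}_\Lambda(\tau)]=[c_\Lambda(\sigma,\tau)]^p$, and $\beta=(\beta_p)_{p\ge1}$ satisfies $\beta_p>0$ for all $p$ and $\sum_p\beta_p^2<\infty$. Statements about "almost every $\beta_p$", or about differentiability in the $\beta_p$ direction, are made with the other parameters $(\beta_k)_{k\ne p}$ fixed. Random Gibbs measure: $\mathcal G_{\Lambda,\beta}(\sigma)=\exp(-\bar H_\Lambda(\sigma;\beta))/\sum_{\tau}\exp(-\bar H_\Lambda(\tau;\beta))$. For a function $f$ of $n$ replicas, $\Omega_{\Lambda,\beta}(f)=\sum_{\sigma^{(1)},\dots,\sigma^{(n)}}f(\sigma^{(1)},\dots,\sigma^{(n)})\prod_{i=1}^n\mathcal G_{\Lambda,\beta}(\sigma^{(i)})$, and the quenched state is $\langle f\rangle_{\Lambda,\beta}=\mathbb E\,\Omega_{\Lambda,\beta}(f)$. $\Lambda\nearrow\mathbb Z^d$ denotes the thermodynamic limit.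
   Formalization: Existence of the limiting pressure along the chosen volumes, for all admissible β, is assumed in all parts, since thermodynamic stability alone does not ensure it (variances depending on the parity of |Λ| make the pressure oscillate). *)

theory Defs
  imports "HOL-Probability.Probability"
begin

type_synonym 'd site = "int ^ 'd"
type_synonym 'd config = "int ^ 'd \<Rightarrow> real"

definition configs :: "'d::finite site set \<Rightarrow> 'd config set" where
  "configs L = (L \<rightarrow>\<^sub>E {-1, 1})"

definition spin_prod :: "'d::finite config \<Rightarrow> 'd site set \<Rightarrow> real" where
  "spin_prod \<sigma> X = (\<Prod>x\<in>X. \<sigma> x)"

text \<open>The argument \<open>\<Delta>\<close> gives standard deviations \<open>\<Delta> L X\<close>, not variances. They may depend on
  the volume \<open>L\<close>.\<close>

definition covariance ::
  "('d::finite site set \<Rightarrow> 'd site set \<Rightarrow> real) \<Rightarrow> 'd site set \<Rightarrow> 'd config \<Rightarrow> 'd config \<Rightarrow> real" where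
  "covariance \<Delta> L \<sigma> \<tau> =
     (\<Sum>X\<in>Pow L. (\<Delta> L X)\<^sup>2 * spin_prod \<sigma> X * spin_prod \<tau> X) / real (card L)"

text \<open>A centered Gaussian variable of variance \<open>v\<close>; variance zero is allowed, and then the
  variable vanishes almost surely and has no density.\<close>

definition centered_gaussian :: "'w measure \<Rightarrow> real \<Rightarrow> ('w \<Rightarrow> real) \<Rightarrow> bool" where
  "centered_gaussian M v X \<longleftrightarrow>
     0 \<le> v \<and> X \<in> borel_measurable M \<and>
     (if v = 0 then AE \<omega> in M. X \<omega> = 0
      else distributed M lborel X (normal_density 0 (sqrt v)))"

text \<open>A finite family is jointly centered Gaussian if all its linear combinations are centered
  Gaussian.\<close>

definition centered_gaussian_family :: "'w measure \<Rightarrow> 'i set \<Rightarrow> ('i \<Rightarrow> 'w \<Rightarrow> real) \<Rightarrow> bool" where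
  "centered_gaussian_family M I X \<longleftrightarrow>
     (\<forall>a :: 'i \<Rightarrow> real. \<exists>v. centered_gaussian M v (\<lambda>\<omega>. \<Sum>i\<in>I. a i * X i \<omega>))"

text \<open>\<open>H L p \<sigma>\<close> is the random variable \<open>H\<^sup>(\<^sup>p\<^sup>)\<^sub>L(\<sigma>)\<close>, for \<open>p \<ge> 1\<close> only. The independence over \<open>p\<close>
  is that of the random vectors \<open>(H L p \<sigma>)\<close> indexed by \<open>\<sigma>\<close>. No relation between different volumes is
  imposed.\<close>

locale complete_spin_glass = prob_space M
  for M :: "'w measure" +
  fixes \<Delta> :: "'d::finite site set \<Rightarrow> 'd site set \<Rightarrow> real"
    and c :: real
    and J :: "'d site set \<Rightarrow> 'd site set \<Rightarrow> 'w \<Rightarrow> real"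
    and H :: "'d site set \<Rightarrow> nat \<Rightarrow> 'd config \<Rightarrow> 'w \<Rightarrow> real"
  assumes Delta_nonneg: "\<And>L X. finite L \<Longrightarrow> L \<noteq> {} \<Longrightarrow> X \<subseteq> L \<Longrightarrow> 0 \<le> \<Delta> L X"
    and J_gaussian:
      "\<And>L X. finite L \<Longrightarrow> L \<noteq> {} \<Longrightarrow> X \<subseteq> L \<Longrightarrow> centered_gaussian M ((\<Delta> L X)\<^sup>2) (J L X)"
    and J_indep: "\<And>L. finite L \<Longrightarrow> L \<noteq> {} \<Longrightarrow> indep_vars (\<lambda>_. borel) (J L) (Pow L)"
    and c_pos: "0 < c"
    and thermodynamic_stability:
      "\<And>L. finite L \<Longrightarrow> L \<noteq> {} \<Longrightarrow> (\<Sum>X\<in>Pow L. (\<Delta> L X)\<^sup>2) / real (card L) \<le> c"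
    and H_1:
      "\<And>L \<sigma> \<omega>. finite L \<Longrightarrow> L \<noteq> {} \<Longrightarrow> \<sigma> \<in> configs L \<Longrightarrow> \<omega> \<in> space M \<Longrightarrow>
         H L 1 \<sigma> \<omega> = - (\<Sum>X\<in>Pow L. J L X \<omega> * spin_prod \<sigma> X)"
    and H_gaussian:
      "\<And>L p. finite L \<Longrightarrow> L \<noteq> {} \<Longrightarrow> 1 \<le> p \<Longrightarrow> centered_gaussian_family M (configs L) (H L p)"
    and H_covariance:
      "\<And>L p \<sigma> \<tau>. finite L \<Longrightarrow> L \<noteq> {} \<Longrightarrow> 1 \<le> p \<Longrightarrow> \<sigma> \<in> configs L \<Longrightarrow> \<tau> \<in> configs L \<Longrightarrow>
         expectation (\<lambda>\<omega>. H L p \<sigma> \<omega> * H L p \<tau> \<omega>) / real (card L) = covariance \<Delta> L \<sigma> \<tau> ^ p"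
    and H_indep:
      "\<And>L. finite L \<Longrightarrow> L \<noteq> {} \<Longrightarrow>
         indep_vars (\<lambda>_. PiM (configs L) (\<lambda>_. borel))
           (\<lambda>p \<omega>. \<lambda>\<sigma>\<in>configs L. H L p \<sigma> \<omega>) {1..}"

text \<open>Parameter sequences \<open>(\<beta>\<^sub>p)\<close> with \<open>p \<ge> 1\<close>; the value \<open>\<beta> 0\<close> is irrelevant throughout.\<close>

definition admissible :: "(nat \<Rightarrow> real) \<Rightarrow> bool" where
  "admissible \<beta> \<longleftrightarrow> (\<forall>p\<ge>1. 0 < \<beta> p) \<and> summable (\<lambda>p. (\<beta> (Suc p))\<^sup>2)"

text \<open>The series over \<open>p \<ge> 1\<close> is an ordered sum: for square-summable \<open>\<beta>\<close> it converges almost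
  surely, but in general not absolutely.\<close>

definition complete_hamiltonian ::
  "real \<Rightarrow> ('d::finite site set \<Rightarrow> nat \<Rightarrow> 'd config \<Rightarrow> 'w \<Rightarrow> real) \<Rightarrow> 'd site set \<Rightarrow> (nat \<Rightarrow> real) \<Rightarrow>
   'd config \<Rightarrow> 'w \<Rightarrow> real" where
  "complete_hamiltonian c H L \<beta> \<sigma> \<omega> =
     (\<Sum>p. \<beta> (Suc p) / sqrt c ^ Suc p * H L (Suc p) \<sigma> \<omega>)"

definition partition_function ::
  "real \<Rightarrow> ('d::finite site set \<Rightarrow> nat \<Rightarrow> 'd config \<Rightarrow> 'w \<Rightarrow> real) \<Rightarrow> 'd site set \<Rightarrow> (nat \<Rightarrow> real) \<Rightarrow>
   'w \<Rightarrow> real" where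
  "partition_function c H L \<beta> \<omega> =
     (\<Sum>\<sigma>\<in>configs L. exp (- complete_hamiltonian c H L \<beta> \<sigma> \<omega>))"

definition gibbs ::
  "real \<Rightarrow> ('d::finite site set \<Rightarrow> nat \<Rightarrow> 'd config \<Rightarrow> 'w \<Rightarrow> real) \<Rightarrow> 'd site set \<Rightarrow> (nat \<Rightarrow> real) \<Rightarrow>
   'd config \<Rightarrow> 'w \<Rightarrow> real" where
  "gibbs c H L \<beta> \<sigma> \<omega> =
     exp (- complete_hamiltonian c H L \<beta> \<sigma> \<omega>) / partition_function c H L \<beta> \<omega>"

text \<open>Replica states: \<open>n\<close> is the number of replicas, and \<open>F\<close> is evaluated at \<open>s\<close>, where \<open>s j\<close>
  (\<open>1 \<le> j \<le> n\<close>) is the \<open>j\<close>-th replica.\<close>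

definition random_gibbs_state ::
  "real \<Rightarrow> ('d::finite site set \<Rightarrow> nat \<Rightarrow> 'd config \<Rightarrow> 'w \<Rightarrow> real) \<Rightarrow> 'd site set \<Rightarrow> (nat \<Rightarrow> real) \<Rightarrow>
   nat \<Rightarrow> ((nat \<Rightarrow> 'd config) \<Rightarrow> real) \<Rightarrow> 'w \<Rightarrow> real" where
  "random_gibbs_state c H L \<beta> n F \<omega> =
     (\<Sum>s\<in>{1..n} \<rightarrow>\<^sub>E configs L. F s * (\<Prod>i\<in>{1..n}. gibbs c H L \<beta> (s i) \<omega>))"

definition quenched ::
  "'w measure \<Rightarrow> real \<Rightarrow> ('d::finite site set \<Rightarrow> nat \<Rightarrow> 'd config \<Rightarrow> 'w \<Rightarrow> real) \<Rightarrow> 'd site set \<Rightarrow>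
   (nat \<Rightarrow> real) \<Rightarrow> nat \<Rightarrow> ((nat \<Rightarrow> 'd config) \<Rightarrow> real) \<Rightarrow> real" where
  "quenched M c H L \<beta> n F = (\<integral>\<omega>. random_gibbs_state c H L \<beta> n F \<omega> \<partial>M)"

definition pressure ::
  "'w measure \<Rightarrow> real \<Rightarrow> ('d::finite site set \<Rightarrow> nat \<Rightarrow> 'd config \<Rightarrow> 'w \<Rightarrow> real) \<Rightarrow> 'd site set \<Rightarrow>
   (nat \<Rightarrow> real) \<Rightarrow> real" where
  "pressure M c H L \<beta> = (\<integral>\<omega>. ln (partition_function c H L \<beta> \<omega>) \<partial>M) / real (card L)"

text \<open>The limit \<open>\<Lambda> \<nearrow> \<int>\<^sup>d\<close> is taken along an increasing exhausting sequence of finite volumes.\<close>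

definition exhausting :: "(nat \<Rightarrow> 'd::finite site set) \<Rightarrow> bool" where
  "exhausting \<Lambda> \<longleftrightarrow> (\<forall>N. finite (\<Lambda> N)) \<and> incseq \<Lambda> \<and> (\<Union>N. \<Lambda> N) = UNIV"

definition limit_pressure ::
  "'w measure \<Rightarrow> real \<Rightarrow> ('d::finite site set \<Rightarrow> nat \<Rightarrow> 'd config \<Rightarrow> 'w \<Rightarrow> real) \<Rightarrow>
   (nat \<Rightarrow> 'd site set) \<Rightarrow> (nat \<Rightarrow> real) \<Rightarrow> real" where
  "limit_pressure M c H \<Lambda> \<beta> = lim (\<lambda>N. pressure M c H (\<Lambda> N) \<beta>)"

definition replica_pairs :: "nat \<Rightarrow> (nat \<times> nat) set" where
  "replica_pairs n = {(j, k). 1 \<le> j \<and> j < k \<and> k \<le> n}"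

definition overlap_array ::
  "('d::finite site set \<Rightarrow> 'd site set \<Rightarrow> real) \<Rightarrow> 'd site set \<Rightarrow> nat \<Rightarrow> (nat \<Rightarrow> 'd config) \<Rightarrow>
   (nat \<times> nat \<Rightarrow> real)" where
  "overlap_array \<Delta> L n s = (\<lambda>(j, k)\<in>replica_pairs n. covariance \<Delta> L (s j) (s k))"

text \<open>Continuous functions of the variables \<open>c\<^sub>j\<^sub>k\<close>, \<open>1 \<le> j < k \<le> n\<close>. By thermodynamic stability these
  take values in \<open>[-c, c]\<close>, so continuity on the cube with this side is required and no more.\<close>

definition overlap_function :: "real \<Rightarrow> nat \<Rightarrow> ((nat \<times> nat \<Rightarrow> real) \<Rightarrow> real) \<Rightarrow> bool" where
  "overlap_function c n f \<longleftrightarrow>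
     continuous_map (product_topology (\<lambda>_. top_of_set {-c..c}) (replica_pairs n)) euclideanreal f"

definition stochastic_stability_average ::
  "'w measure \<Rightarrow> real \<Rightarrow> ('d::finite site set \<Rightarrow> 'd site set \<Rightarrow> real) \<Rightarrow>
   ('d site set \<Rightarrow> nat \<Rightarrow> 'd config \<Rightarrow> 'w \<Rightarrow> real) \<Rightarrow> 'd site set \<Rightarrow> (nat \<Rightarrow> real) \<Rightarrow>
   nat \<Rightarrow> nat \<Rightarrow> ((nat \<times> nat \<Rightarrow> real) \<Rightarrow> real) \<Rightarrow> real" where
  "stochastic_stability_average M c \<Delta> H L \<beta> p n f =
     quenched M c H L \<beta> (n + 2) (\<lambda>s.
       (\<Sum>j\<in>{1..n}. \<Sum>k\<in>{1..n} - {j}. f (overlap_array \<Delta> L n s) * covariance \<Delta> L (s j) (s k) ^ p)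
       - 2 * real n * f (overlap_array \<Delta> L n s) *
           (\<Sum>k\<in>{1..n}. covariance \<Delta> L (s k) (s (n + 1)) ^ p)
       + real n * (real n + 1) * f (overlap_array \<Delta> L n s) *
           covariance \<Delta> L (s (n + 1)) (s (n + 2)) ^ p)"

definition ghirlanda_guerra_difference ::
  "'w measure \<Rightarrow> real \<Rightarrow> ('d::finite site set \<Rightarrow> 'd site set \<Rightarrow> real) \<Rightarrow>
   ('d site set \<Rightarrow> nat \<Rightarrow> 'd config \<Rightarrow> 'w \<Rightarrow> real) \<Rightarrow> 'd site set \<Rightarrow> (nat \<Rightarrow> real) \<Rightarrow>
   nat \<Rightarrow> nat \<Rightarrow> ((nat \<times> nat \<Rightarrow> real) \<Rightarrow> real) \<Rightarrow> real" where
  "ghirlanda_guerra_difference M c \<Delta> H L \<beta> p n f =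
     quenched M c H L \<beta> (n + 2)
       (\<lambda>s. f (overlap_array \<Delta> L n s) * covariance \<Delta> L (s (n + 1)) (s (n + 2)) ^ p)
     - 1 / (real n + 1) *
         (\<Sum>k\<in>{1..n}. quenched M c H L \<beta> (n + 1)
            (\<lambda>s. f (overlap_array \<Delta> L n s) * covariance \<Delta> L (s k) (s (n + 1)) ^ p))
     - 1 / (real n + 1) *
         quenched M c H L \<beta> n (\<lambda>s. f (overlap_array \<Delta> L n s)) *
         quenched M c H L \<beta> 2 (\<lambda>s. covariance \<Delta> L (s 1) (s 2) ^ p)"

end

(* At fixed volume write the complete Hamiltonian as R + x X, where X is the p-th field divided by
   sqrt c ^ p and x = beta_p.  Gaussian integration by parts turns the Gibbs average of f X over m
   replicas, minus the product of the averages of f and X, into card L times the combination of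
   overlap moments appearing in the Ghirlanda-Guerra identities; (S) is a linear combination of two
   of these identities.  So everything reduces to showing that X, under the Gibbs measure and the
   disorder, deviates from its quenched mean by o(card L) in L^1.

   For the thermal part put psi = ln Z, which is convex in x, and u = Omega |X(s1) - X(s2)|.
   Pointwise in the disorder |u'| <= 4 psi'' and u^2 <= 2 psi'', whence u(a) is bounded by
   increments of psi' near a, that is, by second differences of psi.  For the disorder part, psi' lies
   between difference quotients of psi, and psi concentrates at scale sqrt (card L).  In the limit
   both parts are controlled by second differences of the limiting pressure, which are small at a
   point of differentiability, and at almost every point because the limit is convex. *)

theory Submission
  imports Defs
begin

section \<open>Uniqueness of characteristic functions of random vectors\<close>

text \<open>A Gaussian family is given only through the laws of its linear combinations, some of
  which may be degenerate, and the complete Hamiltonian is an infinite series that need not converge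
  absolutely. With no joint density at hand, joint laws are handled through characteristic
  functions: integration by parts starts from the factorisation of a characteristic function, and a
  maximal inequality supplies the almost sure convergence that makes the series a Gaussian vector.
  Differentiability of the limiting pressure is given at the single point a, so smallness of the
  thermal fluctuation on average over nearby parameters is not enough. Convexity only produces some
  t near a where psi'' is controlled; the bound on u' is what carries the estimate from t back to a.
  The price is a factor 1/h, with h the step of the difference quotients. It is harmless since h is
  fixed before the volume grows: the trade-off parameter epsilon is a small multiple of card L, so
  that the term with 1/(epsilon h) stays bounded, and concentration contributes sqrt (card L) / h.
  Besides epsilon only a multiple of card L times the second difference survives.\<close>

lemma (in prob_space) expectation_iexp:
  assumes [measurable]: "X \<in> borel_measurable M"
  shows "(CLINT \<omega>|M. iexp (X \<omega>)) = Complex (\<integral>\<omega>. cos (X \<omega>) \<partial>M) (\<integral>\<omega>. sin (X \<omega>) \<partial>M)"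
proof (rule complex_eqI)
  have i: "integrable M (\<lambda>\<omega>. iexp (X \<omega>))" by (rule integrable_iexp) auto
  show "Re (CLINT \<omega>|M. iexp (X \<omega>)) = Re (Complex (\<integral>\<omega>. cos (X \<omega>) \<partial>M) (\<integral>\<omega>. sin (X \<omega>) \<partial>M))"
    by (subst integral_Re[OF i, symmetric]) (simp add: Re_exp)
  show "Im (CLINT \<omega>|M. iexp (X \<omega>)) = Im (Complex (\<integral>\<omega>. cos (X \<omega>) \<partial>M) (\<integral>\<omega>. sin (X \<omega>) \<partial>M))"
    by (subst integral_Im[OF i, symmetric]) (simp add: Im_exp)
qed

text \<open>Levy uniqueness concerns probability measures, while the weights here are signed. As
  they are bounded by 1, \<open>e + f * g1\<close> is a probability density for suitable
  \<open>e\<close> and \<open>f\<close>, and its characteristic function is a combination of the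
  assumed integrals. In the next lemma the weights are products of indicators and a cosine.\<close>

lemma weighted_char_unique:
  fixes M1 :: "'a measure" and M2 :: "'b measure"
  assumes "prob_space M1" "prob_space M2"
    and [measurable]: "U1 \<in> borel_measurable M1" "g1 \<in> borel_measurable M1"
      "U2 \<in> borel_measurable M2" "g2 \<in> borel_measurable M2"
    and g: "\<And>\<omega>. \<bar>g1 \<omega>\<bar> \<le> (1::real)" "\<And>\<omega>. \<bar>g2 \<omega>\<bar> \<le> 1"
    and c: "\<And>t. (\<integral>\<omega>. cos (t * U1 \<omega>) \<partial>M1) = (\<integral>\<omega>. cos (t * U2 \<omega>) \<partial>M2)"
    and s: "\<And>t. (\<integral>\<omega>. sin (t * U1 \<omega>) \<partial>M1) = (\<integral>\<omega>. sin (t * U2 \<omega>) \<partial>M2)"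
    and gc: "\<And>t. (\<integral>\<omega>. g1 \<omega> * cos (t * U1 \<omega>) \<partial>M1) = (\<integral>\<omega>. g2 \<omega> * cos (t * U2 \<omega>) \<partial>M2)"
    and gs: "\<And>t. (\<integral>\<omega>. g1 \<omega> * sin (t * U1 \<omega>) \<partial>M1) = (\<integral>\<omega>. g2 \<omega> * sin (t * U2 \<omega>) \<partial>M2)"
    and B[measurable]: "B \<in> sets borel"
  shows "(\<integral>\<omega>. g1 \<omega> * indicator B (U1 \<omega>) \<partial>M1) = (\<integral>\<omega>. g2 \<omega> * indicator B (U2 \<omega>) \<partial>M2)"
proof -
  interpret M1: prob_space M1 by fact
  interpret M2: prob_space M2 by fact
  \<comment> \<open>\<open>m - 2\<close> is the common mean of the two weights; the shift by 2 gives
    \<open>m \<ge> 1\<close>, so that division by \<open>m\<close> is possible.\<close>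
  define m where "m = 2 + (\<integral>\<omega>. g1 \<omega> \<partial>M1)"
  have ig1: "integrable M1 (\<lambda>\<omega>. g1 \<omega> * h \<omega>)"
    if [measurable]: "h \<in> borel_measurable M1" and "\<And>\<omega>. \<bar>h \<omega>\<bar> \<le> 1" for h
    by (rule M1.integrable_const_bound[where B=1]) (use that g in \<open>auto simp: abs_mult intro!: mult_le_one\<close>)
  have ig2: "integrable M2 (\<lambda>\<omega>. g2 \<omega> * h \<omega>)"
    if [measurable]: "h \<in> borel_measurable M2" and "\<And>\<omega>. \<bar>h \<omega>\<bar> \<le> 1" for h
    by (rule M2.integrable_const_bound[where B=1]) (use that g in \<open>auto simp: abs_mult intro!: mult_le_one\<close>)
  have i1: "integrable M1 h"
    if [measurable]: "h \<in> borel_measurable M1" and "\<And>\<omega>. \<bar>h \<omega>\<bar> \<le> (1::real)" for h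
    by (rule M1.integrable_const_bound[where B=1]) (use that in auto)
  have i2: "integrable M2 h"
    if [measurable]: "h \<in> borel_measurable M2" and "\<And>\<omega>. \<bar>h \<omega>\<bar> \<le> (1::real)" for h
    by (rule M2.integrable_const_bound[where B=1]) (use that in auto)
  have m2: "m = 2 + (\<integral>\<omega>. g2 \<omega> \<partial>M2)"
    using gc[of 0] by (simp add: m_def)
  have "(\<integral>\<omega>. g1 \<omega> \<partial>M1) \<ge> (\<integral>\<omega>. -1 \<partial>M1)"
    by (rule integral_mono) (use ig1[of "\<lambda>_. 1"] g(1) in \<open>auto simp: abs_le_iff minus_le_iff\<close>)
  then have m: "m \<ge> 1" by (simp add: m_def M1.prob_space)
  \<comment> \<open>The first condition makes the densities nonnegative, the second gives them total
    mass 1.\<close>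
  have *: "(\<integral>\<omega>. (e + f * g1 \<omega>) * indicator B (U1 \<omega>) \<partial>M1) = (\<integral>\<omega>. (e + f * g2 \<omega>) * indicator B (U2 \<omega>) \<partial>M2)"
    if ef: "e \<ge> \<bar>f\<bar>" "e + f * (m - 2) = 1" for e f :: real
  proof -
    have nn1: "0 \<le> e + f * g1 \<omega>" for \<omega>
    proof -
      have "\<bar>f * g1 \<omega>\<bar> \<le> \<bar>f\<bar> * 1" unfolding abs_mult by (rule mult_left_mono) (use g in auto)
      with ef show ?thesis by linarith
    qed
    have nn2: "0 \<le> e + f * g2 \<omega>" for \<omega>
    proof -
      have "\<bar>f * g2 \<omega>\<bar> \<le> \<bar>f\<bar> * 1" unfolding abs_mult by (rule mult_left_mono) (use g in auto)
      with ef show ?thesis by linarith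
    qed
    define D1 where "D1 = density M1 (\<lambda>\<omega>. ennreal (e + f * g1 \<omega>))"
    define D2 where "D2 = density M2 (\<lambda>\<omega>. ennreal (e + f * g2 \<omega>))"
    have [measurable_cong, simp]: "sets D1 = sets M1" "sets D2 = sets M2" by (auto simp: D1_def D2_def)
    have I1: "(\<integral>\<omega>. h \<omega> \<partial>D1) = (\<integral>\<omega>. (e + f * g1 \<omega>) * h \<omega> \<partial>M1)"
      if [measurable]: "h \<in> borel_measurable M1" for h :: "_ \<Rightarrow> real"
      unfolding D1_def by (subst integral_density) (auto simp: nn1)
    have I2: "(\<integral>\<omega>. h \<omega> \<partial>D2) = (\<integral>\<omega>. (e + f * g2 \<omega>) * h \<omega> \<partial>M2)"
      if [measurable]: "h \<in> borel_measurable M2" for h :: "_ \<Rightarrow> real"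
      unfolding D2_def by (subst integral_density) (auto simp: nn2)
    have "prob_space D1"
    proof (rule prob_spaceI)
      have "emeasure D1 (space D1) = (\<integral>\<^sup>+\<omega>. ennreal (e + f * g1 \<omega>) \<partial>M1)"
        by (simp add: D1_def emeasure_density cong: nn_integral_cong)
      also have "\<dots> = ennreal (\<integral>\<omega>. e + f * g1 \<omega> \<partial>M1)"
        by (rule nn_integral_eq_integral) (use ig1[of "\<lambda>_. 1"] nn1 in auto)
      also have "(\<integral>\<omega>. e + f * g1 \<omega> \<partial>M1) = 1"
        using ig1[of "\<lambda>_. 1"] ef by (simp add: m_def M1.prob_space)
      finally show "emeasure D1 (space D1) = 1" by simp
    qed
    then interpret D1: prob_space D1 .
    have "prob_space D2"
    proof (rule prob_spaceI)
      have "emeasure D2 (space D2) = (\<integral>\<^sup>+\<omega>. ennreal (e + f * g2 \<omega>) \<partial>M2)"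
        by (simp add: D2_def emeasure_density cong: nn_integral_cong)
      also have "\<dots> = ennreal (\<integral>\<omega>. e + f * g2 \<omega> \<partial>M2)"
        by (rule nn_integral_eq_integral) (use ig2[of "\<lambda>_. 1"] nn2 in auto)
      also have "(\<integral>\<omega>. e + f * g2 \<omega> \<partial>M2) = 1"
        using ig2[of "\<lambda>_. 1"] ef by (simp add: m2 M2.prob_space)
      finally show "emeasure D2 (space D2) = 1" by simp
    qed
    then interpret D2: prob_space D2 .
    have eqc: "(\<integral>\<omega>. cos (t * U1 \<omega>) \<partial>D1) = (\<integral>\<omega>. cos (t * U2 \<omega>) \<partial>D2)" for t
    proof -
      have "(\<integral>\<omega>. cos (t * U1 \<omega>) \<partial>D1) = e * (\<integral>\<omega>. cos (t * U1 \<omega>) \<partial>M1) + f * (\<integral>\<omega>. g1 \<omega> * cos (t * U1 \<omega>) \<partial>M1)"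
        by (simp add: I1 distrib_right ig1 i1 mult.assoc)
      moreover have "(\<integral>\<omega>. cos (t * U2 \<omega>) \<partial>D2) = e * (\<integral>\<omega>. cos (t * U2 \<omega>) \<partial>M2) + f * (\<integral>\<omega>. g2 \<omega> * cos (t * U2 \<omega>) \<partial>M2)"
        by (simp add: I2 distrib_right ig2 i2 mult.assoc)
      ultimately show ?thesis by (simp only: c gc)
    qed
    have eqs: "(\<integral>\<omega>. sin (t * U1 \<omega>) \<partial>D1) = (\<integral>\<omega>. sin (t * U2 \<omega>) \<partial>D2)" for t
    proof -
      have "(\<integral>\<omega>. sin (t * U1 \<omega>) \<partial>D1) = e * (\<integral>\<omega>. sin (t * U1 \<omega>) \<partial>M1) + f * (\<integral>\<omega>. g1 \<omega> * sin (t * U1 \<omega>) \<partial>M1)"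
        by (simp add: I1 distrib_right ig1 i1 mult.assoc)
      moreover have "(\<integral>\<omega>. sin (t * U2 \<omega>) \<partial>D2) = e * (\<integral>\<omega>. sin (t * U2 \<omega>) \<partial>M2) + f * (\<integral>\<omega>. g2 \<omega> * sin (t * U2 \<omega>) \<partial>M2)"
        by (simp add: I2 distrib_right ig2 i2 mult.assoc)
      ultimately show ?thesis by (simp only: s gs)
    qed
    have "distr D1 borel U1 = distr D2 borel U2"
    proof (rule Levy_uniqueness)
      show "char (distr D1 borel U1) = char (distr D2 borel U2)"
      proof
        fix t
        have 1: "char (distr D1 borel U1) t = (CLINT \<omega>|D1. iexp (t * U1 \<omega>))"
          by (simp add: char_def integral_distr)
        have 2: "char (distr D2 borel U2) t = (CLINT \<omega>|D2. iexp (t * U2 \<omega>))"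
          by (simp add: char_def integral_distr)
        show "char (distr D1 borel U1) t = char (distr D2 borel U2) t"
          unfolding 1 2
          using eqc[of t] eqs[of t] D1.expectation_iexp[of "\<lambda>\<omega>. t * U1 \<omega>"]
            D2.expectation_iexp[of "\<lambda>\<omega>. t * U2 \<omega>"] by simp
      qed
    qed (auto intro!: D1.real_distribution_distr D2.real_distribution_distr)
    then have "(\<integral>x. indicator B x \<partial>distr D1 borel U1) = (\<integral>x. indicator B x \<partial>distr D2 borel U2 :: real)" by simp
    then have "(\<integral>\<omega>. indicator B (U1 \<omega>) \<partial>D1) = (\<integral>\<omega>. indicator B (U2 \<omega>) \<partial>D2 :: real)"
      by (subst (asm) integral_distr, simp, simp, subst (asm) integral_distr, simp, simp)
    then show ?thesis by (simp add: I1 I2)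
  qed
  \<comment> \<open>The unweighted case \<open>e = 1\<close>, \<open>f = 0\<close>. Subtracting it
    from the case \<open>e = 2/m\<close>, \<open>f = 1/m\<close> below isolates the weighted
    integral.\<close>
  have 0: "(\<integral>\<omega>. indicator B (U1 \<omega>) \<partial>M1) = (\<integral>\<omega>. indicator B (U2 \<omega>) \<partial>M2 :: real)"
  proof -
    have "1 \<ge> \<bar>0::real\<bar>" "1 + 0 * (m - 2) = 1" by auto
    from *[OF this] show ?thesis by (simp only: mult_zero_left add_0_right mult_1)
  qed
  have "2 / m + 1 / m * (m - 2) = 1" using m by (simp add: field_simps)
  from *[of "1/m" "2/m", OF _ this] m
  have "(\<integral>\<omega>. (2/m + 1/m * g1 \<omega>) * indicator B (U1 \<omega>) \<partial>M1) = (\<integral>\<omega>. (2/m + 1/m * g2 \<omega>) * indicator B (U2 \<omega>) \<partial>M2)"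
    by (simp add: divide_right_mono)
  also have "(\<integral>\<omega>. (2/m + 1/m * g1 \<omega>) * indicator B (U1 \<omega>) \<partial>M1) = 
     2/m * (\<integral>\<omega>. indicator B (U1 \<omega>) \<partial>M1) + 1/m * (\<integral>\<omega>. g1 \<omega> * indicator B (U1 \<omega>) \<partial>M1)"
    unfolding distrib_right mult.assoc
    by (subst Bochner_Integration.integral_add, intro integrable_mult_right i1, simp, simp add: indicator_def,
        intro integrable_mult_right ig1, auto simp: indicator_def)
  also have "(\<integral>\<omega>. (2/m + 1/m * g2 \<omega>) * indicator B (U2 \<omega>) \<partial>M2) = 
     2/m * (\<integral>\<omega>. indicator B (U2 \<omega>) \<partial>M2) + 1/m * (\<integral>\<omega>. g2 \<omega> * indicator B (U2 \<omega>) \<partial>M2)"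
    unfolding distrib_right mult.assoc
    by (subst Bochner_Integration.integral_add, intro integrable_mult_right i2, simp, simp add: indicator_def,
        intro integrable_mult_right ig2, auto simp: indicator_def)
  finally show ?thesis using 0 m by simp
qed


text \<open>Characters are exchanged for indicators one coordinate at a time, so that only
  one-dimensional uniqueness is called upon; boxes of Borel sets then determine a measure on the
  finite product.\<close>

lemma char_unique_vector:
  fixes M1 :: "'a measure" and M2 :: "'b measure" and X1 :: "'i \<Rightarrow> 'a \<Rightarrow> real"
  assumes I: "finite I" and M1: "prob_space M1" and M2: "prob_space M2"
    and [measurable]: "\<And>i. i \<in> I \<Longrightarrow> X1 i \<in> borel_measurable M1"
      "\<And>i. i \<in> I \<Longrightarrow> X2 i \<in> borel_measurable M2"
    and char: "\<And>a. (CLINT \<omega>|M1. iexp (\<Sum>i\<in>I. a i * X1 i \<omega>)) = (CLINT \<omega>|M2. iexp (\<Sum>i\<in>I. a i * X2 i \<omega>))"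
  shows "distr M1 (PiM I (\<lambda>_. borel)) (\<lambda>\<omega>. \<lambda>i\<in>I. X1 i \<omega>) = distr M2 (PiM I (\<lambda>_. borel)) (\<lambda>\<omega>. \<lambda>i\<in>I. X2 i \<omega>)"
proof -
  interpret M1: prob_space M1 by fact
  interpret M2: prob_space M2 by fact
  \<comment> \<open>\<open>K\<close> is the set of coordinates already exchanged. The phase \<alpha>
    keeps the induction real-valued: a sine is a cosine shifted by \<open>pi/2\<close>.\<close>
  have claim: "(\<integral>\<omega>. (\<Prod>k\<in>K. indicator (B k) (X1 k \<omega>)) * cos ((\<Sum>i\<in>I-K. a i * X1 i \<omega>) + \<alpha>) \<partial>M1) =
     (\<integral>\<omega>. (\<Prod>k\<in>K. indicator (B k) (X2 k \<omega>)) * cos ((\<Sum>i\<in>I-K. a i * X2 i \<omega>) + \<alpha>) \<partial>M2)"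
    if "finite K" "K \<subseteq> I" "\<And>k. k \<in> K \<Longrightarrow> B k \<in> sets borel" for K B a \<alpha>
    using that
  proof (induction K arbitrary: a \<alpha> rule: finite_induct)
    case empty
    have i: "integrable M1 (\<lambda>\<omega>. cos (\<Sum>i\<in>I. a i * X1 i \<omega>))" "integrable M1 (\<lambda>\<omega>. sin (\<Sum>i\<in>I. a i * X1 i \<omega>))"
      "integrable M2 (\<lambda>\<omega>. cos (\<Sum>i\<in>I. a i * X2 i \<omega>))" "integrable M2 (\<lambda>\<omega>. sin (\<Sum>i\<in>I. a i * X2 i \<omega>))"
      by (auto intro!: M1.integrable_const_bound[where B=1] M2.integrable_const_bound[where B=1])
    from char[of a] have "(\<integral>\<omega>. cos (\<Sum>i\<in>I. a i * X1 i \<omega>) \<partial>M1) = (\<integral>\<omega>. cos (\<Sum>i\<in>I. a i * X2 i \<omega>) \<partial>M2)"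
      "(\<integral>\<omega>. sin (\<Sum>i\<in>I. a i * X1 i \<omega>) \<partial>M1) = (\<integral>\<omega>. sin (\<Sum>i\<in>I. a i * X2 i \<omega>) \<partial>M2)"
      using M1.expectation_iexp[of "\<lambda>\<omega>. \<Sum>i\<in>I. a i * X1 i \<omega>"] M2.expectation_iexp[of "\<lambda>\<omega>. \<Sum>i\<in>I. a i * X2 i \<omega>"]
      by simp_all
    then show ?case by (simp add: cos_add i)
  next
    case (insert k K)
    have [measurable]: "B j \<in> sets borel" if "j \<in> insert k K" for j using insert.prems that by auto
    have k: "k \<in> I" and K: "K \<subseteq> I" using insert.prems by auto
    have sub: "i \<in> I" if "i \<in> I - K'" for i K' using that by auto
    have [measurable]: "X1 i \<in> borel_measurable M1" "X2 i \<in> borel_measurable M2" if "i \<in> K" for i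
      using K that by auto
    have [measurable]: "X1 k \<in> borel_measurable M1" "X2 k \<in> borel_measurable M2" using k by auto
    \<comment> \<open>The coefficient at \<open>k\<close> is left free as \<open>t\<close>, so the
      induction hypothesis provides the characteristic function of coordinate \<open>k\<close> under
      the weight formed by the others.\<close>
    have split: "(\<Sum>i\<in>I-K. (a(k:=t)) i * x i) = t * x k + (\<Sum>i\<in>I - insert k K. a i * x i)" for t and x :: "'i \<Rightarrow> real"
    proof -
      have "(\<Sum>i\<in>I-K. (a(k:=t)) i * x i) = t * x k + (\<Sum>i\<in>I-K-{k}. (a(k:=t)) i * x i)"
        using k insert.hyps I by (subst sum.remove[of _ k]) auto
      also have "(\<Sum>i\<in>I-K-{k}. (a(k:=t)) i * x i) = (\<Sum>i\<in>I - insert k K. a i * x i)"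
        by (rule sum.cong) auto
      finally show ?thesis .
    qed
    define P1 where "P1 \<omega> = (\<Prod>k\<in>K. indicator (B k) (X1 k \<omega>) :: real)" for \<omega>
    define P2 where "P2 \<omega> = (\<Prod>k\<in>K. indicator (B k) (X2 k \<omega>) :: real)" for \<omega>
    define T1 where "T1 \<omega> = (\<Sum>i\<in>I - insert k K. a i * X1 i \<omega>)" for \<omega>
    define T2 where "T2 \<omega> = (\<Sum>i\<in>I - insert k K. a i * X2 i \<omega>)" for \<omega>
    have P: "\<bar>P1 \<omega>\<bar> \<le> 1" "\<bar>P2 \<omega>'\<bar> \<le> 1" for \<omega> \<omega>'
      unfolding P1_def P2_def by (auto simp: abs_prod indicator_def intro!: prod_le_1)
    have [measurable]: "P1 \<in> borel_measurable M1" "T1 \<in> borel_measurable M1"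
      "P2 \<in> borel_measurable M2" "T2 \<in> borel_measurable M2"
      unfolding P1_def P2_def T1_def T2_def by measurable
    have IH: "(\<integral>\<omega>. P1 \<omega> * cos (t * X1 k \<omega> + T1 \<omega> + \<alpha>) \<partial>M1) = (\<integral>\<omega>. P2 \<omega> * cos (t * X2 k \<omega> + T2 \<omega> + \<alpha>) \<partial>M2)" for t \<alpha>
      using insert.IH[of "a(k:=t)" \<alpha>] insert.prems unfolding split P1_def P2_def T1_def T2_def by auto
    have i1: "integrable M1 (\<lambda>\<omega>. P1 \<omega> * h \<omega>)" if [measurable]: "h \<in> borel_measurable M1" and "\<And>\<omega>. \<bar>h \<omega>\<bar> \<le> 1" for h
      by (rule M1.integrable_const_bound[where B=1]) (use that P in \<open>auto simp: abs_mult intro!: mult_le_one\<close>)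
    have i2: "integrable M2 (\<lambda>\<omega>. P2 \<omega> * h \<omega>)" if [measurable]: "h \<in> borel_measurable M2" and "\<And>\<omega>. \<bar>h \<omega>\<bar> \<le> 1" for h
      by (rule M2.integrable_const_bound[where B=1]) (use that P in \<open>auto simp: abs_mult intro!: mult_le_one\<close>)
    have char1: "(CLINT \<omega>|M1. iexp (t * X1 k \<omega>)) = (CLINT \<omega>|M2. iexp (t * X2 k \<omega>))" for t
    proof -
      have "(\<Sum>i\<in>I. ((\<lambda>_. 0)(k := t)) i * x i) = t * x k" for x :: "'i \<Rightarrow> real"
        using k I by (subst sum.remove[of _ k]) auto
      then show ?thesis using char[of "(\<lambda>_. 0)(k := t)"] by simp
    qed
    have "(\<integral>\<omega>. (P1 \<omega> * cos (T1 \<omega> + \<alpha>)) * indicator (B k) (X1 k \<omega>) \<partial>M1) =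
      (\<integral>\<omega>. (P2 \<omega> * cos (T2 \<omega> + \<alpha>)) * indicator (B k) (X2 k \<omega>) \<partial>M2)"
    proof (rule weighted_char_unique[OF M1 M2])
      show "\<bar>P1 \<omega> * cos (T1 \<omega> + \<alpha>)\<bar> \<le> 1" for \<omega>
        using P(1)[of \<omega>] by (auto simp: abs_mult intro!: mult_le_one)
      show "\<bar>P2 \<omega> * cos (T2 \<omega> + \<alpha>)\<bar> \<le> 1" for \<omega>
        using P(2)[of \<omega>] by (auto simp: abs_mult intro!: mult_le_one)
      fix t
      show "(\<integral>\<omega>. cos (t * X1 k \<omega>) \<partial>M1) = (\<integral>\<omega>. cos (t * X2 k \<omega>) \<partial>M2)"
           "(\<integral>\<omega>. sin (t * X1 k \<omega>) \<partial>M1) = (\<integral>\<omega>. sin (t * X2 k \<omega>) \<partial>M2)"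
        using char1[of t] M1.expectation_iexp[of "\<lambda>\<omega>. t * X1 k \<omega>"] M2.expectation_iexp[of "\<lambda>\<omega>. t * X2 k \<omega>"] by simp_all
      \<comment> \<open>Product-to-sum formulas: the remaining cosine times a cosine or sine in
        coordinate \<open>k\<close> gives two instances of the induction hypothesis, with
        coefficients \<open>t\<close> and \<open>-t\<close>.\<close>
      have e1: "p * cos (c + \<alpha>) * cos (t * x) = 1/2 * (p * cos (t * x + c + \<alpha>) + p * cos ((-t) * x + c + \<alpha>))" for p c x :: real
      proof -
        have E: "cos (t * x + c + \<alpha>) = cos (t * x) * cos (c + \<alpha>) - sin (t * x) * sin (c + \<alpha>)"
          "cos ((-t) * x + c + \<alpha>) = cos (c + \<alpha>) * cos (t * x) + sin (c + \<alpha>) * sin (t * x)"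
          using cos_add[of "t * x" "c + \<alpha>"] cos_diff[of "c + \<alpha>" "t * x"] by (simp_all add: algebra_simps)
        show ?thesis unfolding E by (simp add: algebra_simps)
      qed
      have e2: "p * cos (c + \<alpha>) * sin (t * x) = 1/2 * (p * cos (t * x + c + (\<alpha> - pi/2)) - p * cos ((-t) * x + c + (\<alpha> - pi/2)))" for p c x :: real
      proof -
        have "cos (z + (\<alpha> - pi/2)) = sin (z + \<alpha>)" for z
          using cos_minus[of "z + (\<alpha> - pi/2)"] by (simp add: sin_cos_eq algebra_simps)
        from this[of "t * x + c"] this[of "(-t) * x + c"]
        have E: "cos (t * x + c + (\<alpha> - pi/2)) = sin (t * x) * cos (c + \<alpha>) + cos (t * x) * sin (c + \<alpha>)"
          "cos ((-t) * x + c + (\<alpha> - pi/2)) = sin (c + \<alpha>) * cos (t * x) - cos (c + \<alpha>) * sin (t * x)"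
          using sin_add[of "t * x" "c + \<alpha>"] sin_diff[of "c + \<alpha>" "t * x"] by (simp_all add: algebra_simps)
        show ?thesis unfolding E by (simp add: algebra_simps)
      qed
      show "(\<integral>\<omega>. P1 \<omega> * cos (T1 \<omega> + \<alpha>) * cos (t * X1 k \<omega>) \<partial>M1) = (\<integral>\<omega>. P2 \<omega> * cos (T2 \<omega> + \<alpha>) * cos (t * X2 k \<omega>) \<partial>M2)"
        unfolding e1 using IH[of t \<alpha>] IH[of "-t" \<alpha>] by (simp add: i1 i2)
      show "(\<integral>\<omega>. P1 \<omega> * cos (T1 \<omega> + \<alpha>) * sin (t * X1 k \<omega>) \<partial>M1) = (\<integral>\<omega>. P2 \<omega> * cos (T2 \<omega> + \<alpha>) * sin (t * X2 k \<omega>) \<partial>M2)"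
        unfolding e2 using IH[of t "\<alpha> - pi/2"] IH[of "-t" "\<alpha> - pi/2"] by (simp add: i1 i2)
    qed measurable
    then show ?case
      using insert.hyps by (simp add: P1_def P2_def T1_def T2_def mult_ac)
  qed
  have meas1 [measurable]: "(\<lambda>\<omega>. \<lambda>i\<in>I. X1 i \<omega>) \<in> measurable M1 (PiM I (\<lambda>_. borel))"
    by (rule measurable_restrict) auto
  have meas2 [measurable]: "(\<lambda>\<omega>. \<lambda>i\<in>I. X2 i \<omega>) \<in> measurable M2 (PiM I (\<lambda>_. borel))"
    by (rule measurable_restrict) auto
  interpret D: prob_space "distr M1 (PiM I (\<lambda>_. borel)) (\<lambda>\<omega>. \<lambda>i\<in>I. X1 i \<omega>)"
    by (rule M1.prob_space_distr) measurable
  show ?thesis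
  proof (rule measure_eqI_PiM_finite[OF I])
    fix A :: "'i \<Rightarrow> real set" assume A: "\<And>i. i \<in> I \<Longrightarrow> A i \<in> sets borel"
    have [measurable]: "Pi\<^sub>E I A \<in> sets (PiM I (\<lambda>_. borel))" using A I by (intro sets_PiM_I_finite) auto
    have *: "indicator ((\<lambda>\<omega>. \<lambda>i\<in>I. x i \<omega>) -` Pi\<^sub>E I A) \<omega> = (\<Prod>i\<in>I. indicator (A i) (x i \<omega>) :: real)" for x :: "'i \<Rightarrow> 'c \<Rightarrow> real" and \<omega>
      using I by (auto simp: indicator_def PiE_iff prod.neutral)
    have "measure M1 ((\<lambda>\<omega>. \<lambda>i\<in>I. X1 i \<omega>) -` Pi\<^sub>E I A \<inter> space M1) = (\<integral>\<omega>. (\<Prod>i\<in>I. indicator (A i) (X1 i \<omega>)) \<partial>M1)"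
      unfolding *[symmetric] by (subst Bochner_Integration.integral_indicator) simp
    also have "\<dots> = (\<integral>\<omega>. (\<Prod>i\<in>I. indicator (A i) (X2 i \<omega>)) \<partial>M2)"
      using claim[of I A "\<lambda>_. 0" 0, OF I subset_refl A] by simp
    also have "\<dots> = measure M2 ((\<lambda>\<omega>. \<lambda>i\<in>I. X2 i \<omega>) -` Pi\<^sub>E I A \<inter> space M2)"
      unfolding *[symmetric] by (subst Bochner_Integration.integral_indicator) simp
    finally show "emeasure (distr M1 (PiM I (\<lambda>_. borel)) (\<lambda>\<omega>. \<lambda>i\<in>I. X1 i \<omega>)) (Pi\<^sub>E I A) =
      emeasure (distr M2 (PiM I (\<lambda>_. borel)) (\<lambda>\<omega>. \<lambda>i\<in>I. X2 i \<omega>)) (Pi\<^sub>E I A)"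
      by (simp add: emeasure_distr M1.emeasure_eq_measure M2.emeasure_eq_measure)
  next
    show "range (\<lambda>_::nat. Pi\<^sub>E I (\<lambda>_. UNIV::real set)) \<subseteq> prod_algebra I (\<lambda>_. borel)"
      using I by (auto intro!: prod_algebraI_finite)
    show "(\<Union>i::nat. Pi\<^sub>E I (\<lambda>_. UNIV)) = space (PiM I (\<lambda>_. borel))" by (simp add: space_PiM)
  qed (simp_all add: D.emeasure_finite)
qed

section \<open>Gaussian integration by parts\<close>

text \<open>The bound \<open>w\<close> holds at all parameters, so by the mean value inequality it
  dominates every difference quotient, and dominated convergence applies.\<close>

lemma has_real_derivative_integral_dominated:
  fixes f f' :: "real \<Rightarrow> 'a \<Rightarrow> real"
  assumes int: "\<And>t. integrable M (f t)"
    and der: "\<And>t \<omega>. \<omega> \<in> space M \<Longrightarrow> ((\<lambda>t. f t \<omega>) has_real_derivative f' t \<omega>) (at t)"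
    and bnd: "\<And>t \<omega>. \<omega> \<in> space M \<Longrightarrow> \<bar>f' t \<omega>\<bar> \<le> w \<omega>"
    and w: "integrable M w"
    and meas: "f' t \<in> borel_measurable M"
  shows "((\<lambda>t. \<integral>\<omega>. f t \<omega> \<partial>M) has_real_derivative (\<integral>\<omega>. f' t \<omega> \<partial>M)) (at t)"
  unfolding has_field_derivative_iff tendsto_at_iff_sequentially
proof (intro allI impI)
  fix X :: "nat \<Rightarrow> real"
  assume X: "\<forall>i. X i \<in> UNIV - {t}" "X \<longlonglongrightarrow> t"
  have "(\<lambda>i. \<integral>\<omega>. (f (X i) \<omega> - f t \<omega>) / (X i - t) \<partial>M) \<longlonglongrightarrow> (\<integral>\<omega>. f' t \<omega> \<partial>M)"
  proof (rule integral_dominated_convergence[where w=w])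
    show "AE \<omega> in M. (\<lambda>i. (f (X i) \<omega> - f t \<omega>) / (X i - t)) \<longlonglongrightarrow> f' t \<omega>"
    proof (rule AE_I2)
      fix \<omega> assume "\<omega> \<in> space M"
      from der[OF this, of t, unfolded has_field_derivative_iff tendsto_at_iff_sequentially, rule_format, of X] X
      show "(\<lambda>i. (f (X i) \<omega> - f t \<omega>) / (X i - t)) \<longlonglongrightarrow> f' t \<omega>" by (simp add: comp_def)
    qed
    show "AE \<omega> in M. norm ((f (X i) \<omega> - f t \<omega>) / (X i - t)) \<le> w \<omega>" for i
    proof (rule AE_I2)
      fix \<omega> assume \<omega>: "\<omega> \<in> space M"
      have "norm (f (X i) \<omega> - f t \<omega>) \<le> w \<omega> * norm (X i - t)"
        by (rule field_differentiable_bound[of UNIV "\<lambda>t. f t \<omega>" "\<lambda>t. f' t \<omega>"]) (use der bnd \<omega> in auto)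
      moreover have "norm (X i - t) > 0" using X by auto
      ultimately show "norm ((f (X i) \<omega> - f t \<omega>) / (X i - t)) \<le> w \<omega>"
        by (simp add: norm_divide divide_le_eq)
    qed
  qed (use int w meas in \<open>auto intro!: borel_measurable_divide borel_measurable_diff\<close>)
  then show "((\<lambda>y. ((\<integral>\<omega>. f y \<omega> \<partial>M) - (\<integral>\<omega>. f t \<omega> \<partial>M)) / (y - t)) \<circ> X) \<longlonglongrightarrow> (\<integral>\<omega>. f' t \<omega> \<partial>M)"
    by (simp add: comp_def int)
qed

lemma (in pair_sigma_finite) integral_mult_fst_snd:
  fixes f :: "'a \<Rightarrow> 'c::{real_normed_field, banach, second_countable_topology}"
  assumes f: "integrable M1 f" and g: "integrable M2 g"
  shows "integrable (M1 \<Otimes>\<^sub>M M2) (\<lambda>p. f (fst p) * g (snd p))"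
    and "(\<integral>p. f (fst p) * g (snd p) \<partial>(M1 \<Otimes>\<^sub>M M2)) = (\<integral>x. f x \<partial>M1) * (\<integral>y. g y \<partial>M2)"
proof -
  have [measurable]: "f \<in> borel_measurable M1" "g \<in> borel_measurable M2" using f g by auto
  show i: "integrable (M1 \<Otimes>\<^sub>M M2) (\<lambda>p. f (fst p) * g (snd p))"
    by (rule Fubini_integrable) (use f g in \<open>auto simp: norm_mult\<close>)
  show "(\<integral>p. f (fst p) * g (snd p) \<partial>(M1 \<Otimes>\<^sub>M M2)) = (\<integral>x. f x \<partial>M1) * (\<integral>y. g y \<partial>M2)"
    using integral_fst'[OF i] f g by simp
qed

text \<open>The boundary terms vanish because \<open>exp u \<ge> 1 + u\<close> turns the Gaussian factor into \<open>1 / (1 + x\<^sup>2 / 2)\<close>.\<close>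

lemma std_normal_integration_by_parts:
  fixes g g' :: "real \<Rightarrow> real"
  assumes der: "\<And>x. (g has_real_derivative g' x) (at x)"
    and cont: "continuous_on UNIV g'"
    and g: "\<And>x. \<bar>g x\<bar> \<le> A + B * \<bar>x\<bar>" and g': "\<And>x. \<bar>g' x\<bar> \<le> A + B * \<bar>x\<bar>"
  shows "(\<integral>x. x * g x \<partial>std_normal_distribution) = (\<integral>x. g' x \<partial>std_normal_distribution)"
proof -
  define \<phi> where "\<phi> = std_normal_density"
  have \<phi>[measurable]: "\<phi> \<in> borel_measurable borel" and \<phi>0: "0 \<le> \<phi> x" for x by (auto simp: \<phi>_def)
  have contg: "continuous_on UNIV g" using der by (meson DERIV_continuous_on has_field_derivative_at_within)
  have [measurable]: "g \<in> borel_measurable borel" "g' \<in> borel_measurable borel"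
    using cont contg by (auto intro: borel_measurable_continuous_onI)
  have m: "integrable lborel (\<lambda>x. \<phi> x * \<bar>x\<bar> ^ k)" for k
    unfolding \<phi>_def by (rule integrable_std_normal_moment_abs)
  have i1: "integrable lborel (\<lambda>x. \<phi> x * g' x)"
  proof (rule Bochner_Integration.integrable_bound)
    show "integrable lborel (\<lambda>x. A * (\<phi> x * \<bar>x\<bar> ^ 0) + B * (\<phi> x * \<bar>x\<bar> ^ 1))"
      by (intro Bochner_Integration.integrable_add integrable_mult_right m)
    show "AE x in lborel. norm (\<phi> x * g' x) \<le> norm (A * (\<phi> x * \<bar>x\<bar> ^ 0) + B * (\<phi> x * \<bar>x\<bar> ^ 1))"
    proof (rule AE_I2)
      fix x have "\<phi> x * \<bar>g' x\<bar> \<le> \<phi> x * (A + B * \<bar>x\<bar>)" using g' \<phi>0 by (rule mult_left_mono)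
      then show "norm (\<phi> x * g' x) \<le> norm (A * (\<phi> x * \<bar>x\<bar> ^ 0) + B * (\<phi> x * \<bar>x\<bar> ^ 1))"
        using \<phi>0[of x] by (simp add: abs_mult algebra_simps)
    qed
  qed simp
  have i2: "integrable lborel (\<lambda>x. \<phi> x * (x * g x))"
  proof (rule Bochner_Integration.integrable_bound)
    show "integrable lborel (\<lambda>x. A * (\<phi> x * \<bar>x\<bar> ^ 1) + B * (\<phi> x * \<bar>x\<bar> ^ 2))"
      by (intro Bochner_Integration.integrable_add integrable_mult_right m)
    show "AE x in lborel. norm (\<phi> x * (x * g x)) \<le> norm (A * (\<phi> x * \<bar>x\<bar> ^ 1) + B * (\<phi> x * \<bar>x\<bar> ^ 2))"
    proof (rule AE_I2)
      fix x have "(\<phi> x * \<bar>x\<bar>) * \<bar>g x\<bar> \<le> (\<phi> x * \<bar>x\<bar>) * (A + B * \<bar>x\<bar>)"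
        by (rule mult_left_mono) (use g \<phi>0 in auto)
      also have "\<dots> = A * (\<phi> x * \<bar>x\<bar> ^ 1) + B * (\<phi> x * \<bar>x\<bar> ^ 2)" by (simp add: algebra_simps power2_eq_square)
      finally show "norm (\<phi> x * (x * g x)) \<le> norm (A * (\<phi> x * \<bar>x\<bar> ^ 1) + B * (\<phi> x * \<bar>x\<bar> ^ 2))"
        using \<phi>0[of x] by (simp add: abs_mult algebra_simps)
    qed
  qed simp
  have d\<phi>: "(\<phi> has_real_derivative - x * \<phi> x) (at x)" for x
    unfolding \<phi>_def std_normal_density_def
    by (auto intro!: derivative_eq_intros simp: field_simps)
  define F where "F x = \<phi> x * g x" for x
  have dF: "(F has_vector_derivative (\<phi> x * g' x - \<phi> x * (x * g x))) (at x)" for x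
    unfolding F_def has_real_derivative_iff_has_vector_derivative[symmetric]
    by (auto intro!: derivative_eq_intros d\<phi> der simp: algebra_simps)
  have contd: "isCont (\<lambda>x. \<phi> x * g' x - \<phi> x * (x * g x)) x" for x
    using cont contg d\<phi> by (intro continuous_intros) (auto intro: DERIV_isCont simp: continuous_on_eq_continuous_at)
  have bF: "\<bar>F x\<bar> \<le> 2 * \<bar>A\<bar> * \<bar>inverse x\<bar>\<^sup>2 + 2 * \<bar>B\<bar> * \<bar>inverse x\<bar>" if "x \<noteq> 0" for x
  proof -
    have "exp (x\<^sup>2/2) \<ge> x\<^sup>2/2" using exp_ge_add_one_self[of "x\<^sup>2/2"] by linarith
    then have "exp (- x\<^sup>2/2) \<le> 2 * inverse (x\<^sup>2)"
      using that by (simp add: exp_minus field_simps)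
    moreover have "1 / sqrt (2 * pi) \<le> 1"
      using pi_ge_two by (simp add: divide_le_eq real_le_rsqrt)
    ultimately have "\<phi> x \<le> 1 * (2 * inverse (x\<^sup>2))"
      unfolding \<phi>_def std_normal_density_def by (intro mult_mono) auto
    moreover have "A + B * \<bar>x\<bar> \<le> \<bar>A\<bar> + \<bar>B\<bar> * \<bar>x\<bar>" by (intro add_mono mult_right_mono) auto
    ultimately have "\<phi> x * \<bar>g x\<bar> \<le> (2 * inverse (x\<^sup>2)) * (\<bar>A\<bar> + \<bar>B\<bar> * \<bar>x\<bar>)"
      using g[of x] by (intro mult_mono) auto
    also have "\<dots> = 2 * \<bar>A\<bar> * \<bar>inverse x\<bar>\<^sup>2 + 2 * \<bar>B\<bar> * \<bar>inverse x\<bar>"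
      using that by (simp add: field_simps power2_eq_square abs_mult_self_eq)
    finally show ?thesis using \<phi>0[of x] by (simp add: F_def abs_mult)
  qed
  have inv: "(inverse \<longlongrightarrow> (0::real)) at_top" "(inverse \<longlongrightarrow> (0::real)) at_bot"
    by (rule tendsto_inverse_0_at_top, rule filterlim_ident)
       (metis at_bot_le_at_infinity tendsto_inverse_0 tendsto_mono)
  have lim: "(F \<longlongrightarrow> 0) G" if G: "(inverse \<longlongrightarrow> (0::real)) G" "eventually (\<lambda>x. x \<noteq> 0) G" for G
  proof (rule Lim_null_comparison)
    show "eventually (\<lambda>x. norm (F x) \<le> 2 * \<bar>A\<bar> * \<bar>inverse x\<bar>\<^sup>2 + 2 * \<bar>B\<bar> * \<bar>inverse x\<bar>) G"
      using G(2) by eventually_elim (use bF in auto)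
    have "((\<lambda>x. 2 * \<bar>A\<bar> * \<bar>inverse x\<bar>\<^sup>2 + 2 * \<bar>B\<bar> * \<bar>inverse x\<bar>) \<longlongrightarrow> 2 * \<bar>A\<bar> * \<bar>0\<bar>\<^sup>2 + 2 * \<bar>B\<bar> * \<bar>0\<bar>) G"
      by (intro tendsto_intros G)
    then show "((\<lambda>x. 2 * \<bar>A\<bar> * \<bar>inverse x\<bar>\<^sup>2 + 2 * \<bar>B\<bar> * \<bar>inverse x\<bar>) \<longlongrightarrow> 0) G" by simp
  qed
  have "(LBINT x=-\<infinity>..\<infinity>. \<phi> x * g' x - \<phi> x * (x * g x)) = 0 - 0"
  proof (rule interval_integral_FTC_integrable[where F=F])
    show "set_integrable lborel (einterval (- \<infinity>) \<infinity>) (\<lambda>x. \<phi> x * g' x - \<phi> x * (x * g x))"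
      using i1 i2 by (simp add: set_integrable_def einterval_eq_UNIV)
    show "((F \<circ> real_of_ereal) \<longlongrightarrow> 0) (at_right (- \<infinity>))"
      unfolding ereal_tendsto_simps by (rule lim[OF inv(2)]) (rule eventually_at_bot_not_equal)
    show "((F \<circ> real_of_ereal) \<longlongrightarrow> 0) (at_left \<infinity>)"
      unfolding ereal_tendsto_simps by (rule lim[OF inv(1)]) (rule eventually_at_top_not_equal)
  qed (use dF contd in auto)
  then have "(\<integral>x. \<phi> x * g' x - \<phi> x * (x * g x) \<partial>lborel) = 0"
    by (simp add: interval_lebesgue_integral_def set_lebesgue_integral_def einterval_eq_UNIV)
  then have "(\<integral>x. \<phi> x * g' x \<partial>lborel) = (\<integral>x. \<phi> x * (x * g x) \<partial>lborel)" using i1 i2 by simp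
  then show ?thesis by (subst (1 2) integral_density) (auto simp: \<phi>_def)
qed

text \<open>Representing the law by \<open>sqrt v * z\<close> with \<open>z\<close> standard normal
  includes \<open>v = 0\<close>, where there is no density. Moments are then read off from those of
  \<open>z\<close>.\<close>

lemma (in prob_space) char_gaussian_distr:
  fixes Y :: "'a \<Rightarrow> real"
  assumes [measurable]: "Y \<in> borel_measurable M" and v: "v \<ge> 0"
    and char: "\<And>t. (CLINT \<omega>|M. iexp (t * Y \<omega>)) = exp (- (v * t\<^sup>2) / 2)"
  shows "distr M borel Y = distr std_normal_distribution borel (\<lambda>z. sqrt v * z)"
proof (rule Levy_uniqueness)
  interpret S: prob_space std_normal_distribution by (rule prob_space_normal_density) simp
  show "real_distribution (distr M borel Y)" by (rule real_distribution_distr) simp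
  show "real_distribution (distr std_normal_distribution borel (\<lambda>z. sqrt v * z))"
    by (rule S.real_distribution_distr) simp
  show "char (distr M borel Y) = char (distr std_normal_distribution borel (\<lambda>z. sqrt v * z))"
  proof
    fix t
    have "char (distr M borel Y) t = exp (- (v * t\<^sup>2) / 2)"
      using char[of t] by (simp add: char_def integral_distr)
    moreover have "char (distr std_normal_distribution borel (\<lambda>z. sqrt v * z)) t = char std_normal_distribution (t * sqrt v)"
      unfolding char_def by (subst integral_distr) (auto simp: mult_ac)
    moreover have "char std_normal_distribution (t * sqrt v) = exp (- (v * t\<^sup>2) / 2)"
      using v unfolding char_std_normal_distribution by (simp add: power_mult_distrib exp_of_real mult.commute flip: exp_of_real)
    ultimately show "char (distr M borel Y) t = char (distr std_normal_distribution borel (\<lambda>z. sqrt v * z)) t"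
      by simp
  qed
qed

lemma (in prob_space) char_gaussian_moments:
  fixes Y :: "'a \<Rightarrow> real"
  assumes [measurable]: "Y \<in> borel_measurable M" and v: "v \<ge> 0"
    and char: "\<And>t. (CLINT \<omega>|M. iexp (t * Y \<omega>)) = exp (- (v * t\<^sup>2) / 2)"
  shows "integrable M Y" "integrable M (\<lambda>\<omega>. (Y \<omega>)\<^sup>2)" "expectation Y = 0" "expectation (\<lambda>\<omega>. (Y \<omega>)\<^sup>2) = v"
proof -
  note d = char_gaussian_distr[OF assms]
  have tr: "integrable M (\<lambda>\<omega>. h (Y \<omega>)) \<longleftrightarrow> integrable std_normal_distribution (\<lambda>z. h (sqrt v * z))"
    "(\<integral>\<omega>. h (Y \<omega>) \<partial>M) = (\<integral>z. h (sqrt v * z) \<partial>std_normal_distribution)"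
    if [measurable]: "h \<in> borel_measurable borel" for h :: "real \<Rightarrow> real"
  proof -
    have "integrable M (\<lambda>\<omega>. h (Y \<omega>)) \<longleftrightarrow> integrable (distr M borel Y) h"
      by (rule integrable_distr_eq[symmetric]) auto
    also have "\<dots> \<longleftrightarrow> integrable std_normal_distribution (\<lambda>z. h (sqrt v * z))"
      unfolding d by (rule integrable_distr_eq) auto
    finally show "integrable M (\<lambda>\<omega>. h (Y \<omega>)) \<longleftrightarrow> integrable std_normal_distribution (\<lambda>z. h (sqrt v * z))" .
    have "(\<integral>\<omega>. h (Y \<omega>) \<partial>M) = (\<integral>y. h y \<partial>distr M borel Y)"
      by (rule integral_distr[symmetric]) auto
    also have "\<dots> = (\<integral>z. h (sqrt v * z) \<partial>std_normal_distribution)"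
      unfolding d by (rule integral_distr) auto
    finally show "(\<integral>\<omega>. h (Y \<omega>) \<partial>M) = (\<integral>z. h (sqrt v * z) \<partial>std_normal_distribution)" .
  qed
  show "integrable M Y" "expectation Y = 0"
    using tr[of "\<lambda>x. x"] integrable_std_normal_distribution_moment[of 1] integral_std_normal_distribution_moment_odd[of 1]
    by auto
  show "integrable M (\<lambda>\<omega>. (Y \<omega>)\<^sup>2)" "expectation (\<lambda>\<omega>. (Y \<omega>)\<^sup>2) = v"
    using tr[of "\<lambda>x. x\<^sup>2"] std_normal_distribution_even_moments[of 1] v
    by (auto simp: power_mult_distrib)
qed

text \<open>Here \<open>v\<close> is the variance of \<open>\<xi>\<close> and \<open>v * b i\<close> its covariance with \<open>X i\<close>; the hypothesis on
  characteristic functions makes \<open>\<xi>\<close> independent of the vector \<open>X i - b i * \<xi>\<close>, which reduces the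
  claim to the one-dimensional integration by parts.\<close>

lemma (in prob_space) gaussian_integration_by_parts:
  fixes X :: "'i \<Rightarrow> 'a \<Rightarrow> real" and \<xi> :: "'a \<Rightarrow> real"
  assumes I: "finite I" and v: "v \<ge> 0" and AB: "A \<ge> 0" "B \<ge> 0"
    and X[measurable]: "\<And>i. i \<in> I \<Longrightarrow> X i \<in> borel_measurable M" and \<xi>[measurable]: "\<xi> \<in> borel_measurable M"
    and X2: "\<And>i. i \<in> I \<Longrightarrow> integrable M (\<lambda>\<omega>. (X i \<omega>)\<^sup>2)" and \<xi>2: "integrable M (\<lambda>\<omega>. (\<xi> \<omega>)\<^sup>2)"
    and char: "\<And>t a. (CLINT \<omega>|M. iexp (t * \<xi> \<omega> + (\<Sum>i\<in>I. a i * X i \<omega>))) =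
       complex_of_real (exp (- v * (t\<^sup>2 + 2 * t * (\<Sum>i\<in>I. a i * b i)) / 2)) * (CLINT \<omega>|M. iexp (\<Sum>i\<in>I. a i * X i \<omega>))"
    and G[measurable]: "G \<in> borel_measurable (PiM I (\<lambda>_. borel))"
    and G'[measurable]: "\<And>j. j \<in> I \<Longrightarrow> G' j \<in> borel_measurable (PiM I (\<lambda>_. borel))"
    and der: "\<And>y d s. ((\<lambda>s. G (\<lambda>i\<in>I. y i + s * d i)) has_real_derivative
       (\<Sum>j\<in>I. d j * G' j (\<lambda>i\<in>I. y i + s * d i))) (at s)"
    and cont: "\<And>j y d. j \<in> I \<Longrightarrow> continuous_on UNIV (\<lambda>s. G' j (\<lambda>i\<in>I. y i + s * d i))"
    and Gb: "\<And>x. \<bar>G x\<bar> \<le> A + B * (\<Sum>i\<in>I. \<bar>x i\<bar>)"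
    and G'b: "\<And>j x. j \<in> I \<Longrightarrow> \<bar>G' j x\<bar> \<le> A + B * (\<Sum>i\<in>I. \<bar>x i\<bar>)"
  shows "expectation (\<lambda>\<omega>. \<xi> \<omega> * G (\<lambda>i\<in>I. X i \<omega>)) = v * (\<Sum>j\<in>I. b j * expectation (\<lambda>\<omega>. G' j (\<lambda>i\<in>I. X i \<omega>)))"
proof -
  define r where "r = sqrt v"
  have rr: "r * r = v" using v by (simp add: r_def)
  define Y where "Y i \<omega> = X i \<omega> - b i * \<xi> \<omega>" for i \<omega>
  have Y[measurable]: "i \<in> I \<Longrightarrow> Y i \<in> borel_measurable M" for i unfolding Y_def by measurable
  interpret S: prob_space std_normal_distribution by (rule prob_space_normal_density) simp
  let ?S = "std_normal_distribution"
  interpret P: pair_prob_space ?S M ..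
  let ?P = "?S \<Otimes>\<^sub>M M"
  \<comment> \<open>The vector \<open>Y\<close> with \<xi> adjoined as coordinate
    \<open>None\<close>. In \<open>W2\<close> the variable \<xi> is replaced by
    \<open>sqrt v\<close> times a standard normal variable living on a separate factor.\<close>
  define J where "J = insert None (Some ` I)"
  have J: "finite J" using I by (simp add: J_def)
  have sumJ: "(\<Sum>k\<in>J. h k) = h None + (\<Sum>i\<in>I. h (Some i))" for h :: "'i option \<Rightarrow> real"
    using I unfolding J_def by (subst sum.insert) (auto simp: sum.reindex)
  define W1 where "W1 k \<omega> = (case k of None \<Rightarrow> \<xi> \<omega> | Some i \<Rightarrow> Y i \<omega>)" for k \<omega>
  define W2 where "W2 k p = (case k of None \<Rightarrow> r * fst p | Some i \<Rightarrow> Y i (snd p))" for k and p :: "real \<times> 'a"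
  have W1[measurable]: "k \<in> J \<Longrightarrow> W1 k \<in> borel_measurable M" for k
    by (auto simp: J_def W1_def[abs_def])
  have W2[measurable]: "k \<in> J \<Longrightarrow> W2 k \<in> borel_measurable ?P" for k
    by (auto simp: J_def W2_def[abs_def])
  \<comment> \<open>Shifting \<open>t\<close> by the sum of \<open>a i * b i\<close> in
    \<open>char\<close> completes the square: the mixed term disappears, leaving a function of
    \<open>t\<close> times a function of \<open>a\<close>.\<close>
  have charY: "(CLINT \<omega>|M. iexp (t * \<xi> \<omega> + (\<Sum>i\<in>I. a i * Y i \<omega>))) =
      complex_of_real (exp (- v * (t\<^sup>2 - (\<Sum>i\<in>I. a i * b i)\<^sup>2) / 2)) * (CLINT \<omega>|M. iexp (\<Sum>i\<in>I. a i * X i \<omega>))" for t a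
  proof -
    let ?s = "\<Sum>i\<in>I. a i * b i"
    have "(t * \<xi> \<omega> + (\<Sum>i\<in>I. a i * Y i \<omega>)) = (t - ?s) * \<xi> \<omega> + (\<Sum>i\<in>I. a i * X i \<omega>)" for \<omega>
      by (simp add: Y_def algebra_simps sum_subtractf sum_distrib_left)
    moreover have "(t - ?s)\<^sup>2 + 2 * (t - ?s) * ?s = t\<^sup>2 - ?s\<^sup>2"
      by (simp add: power2_eq_square algebra_simps)
    ultimately show ?thesis using char[of "t - ?s" a] by (simp only:)
  qed
  have "distr M (PiM J (\<lambda>_. borel)) (\<lambda>\<omega>. \<lambda>k\<in>J. W1 k \<omega>) = distr ?P (PiM J (\<lambda>_. borel)) (\<lambda>\<omega>. \<lambda>k\<in>J. W2 k \<omega>)"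
  proof (rule char_unique_vector[OF J])
    show "prob_space M" "prob_space ?P" by unfold_locales
    fix a :: "'i option \<Rightarrow> real"
    define t where "t = a None"
    define a' where "a' i = a (Some i)" for i
    let ?s = "\<Sum>i\<in>I. a' i * b i"
    have 1: "(CLINT \<omega>|M. iexp (\<Sum>k\<in>J. a k * W1 k \<omega>)) = complex_of_real (exp (- v * (t\<^sup>2 - ?s\<^sup>2) / 2)) * (CLINT \<omega>|M. iexp (\<Sum>i\<in>I. a' i * X i \<omega>))"
      using charY[of t a'] by (simp only: sumJ W1_def option.case t_def a'_def)
    have "(CLINT p|?P. iexp (\<Sum>k\<in>J. a k * W2 k p)) = (CLINT p|?P. iexp (t * r * fst p) * iexp (\<Sum>i\<in>I. a' i * Y i (snd p)))"
      by (simp add: sumJ W2_def t_def a'_def mult_ac distrib_left flip: exp_add)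
    also have "\<dots> = (CLINT z|?S. iexp (t * r * z)) * (CLINT \<omega>|M. iexp (\<Sum>i\<in>I. a' i * Y i \<omega>))"
      by (rule P.integral_mult_fst_snd) (auto intro!: S.integrable_iexp integrable_iexp)
    also have "(CLINT z|?S. iexp (t * r * z)) = complex_of_real (exp (- v * t\<^sup>2 / 2))"
      using fun_cong[OF char_std_normal_distribution, of "t * r"] v
      by (simp add: char_def r_def power_mult_distrib mult.commute flip: exp_of_real)
    also have "(CLINT \<omega>|M. iexp (\<Sum>i\<in>I. a' i * Y i \<omega>)) = complex_of_real (exp (v * ?s\<^sup>2 / 2)) * (CLINT \<omega>|M. iexp (\<Sum>i\<in>I. a' i * X i \<omega>))"
      using charY[of 0 a'] by (simp only: mult_zero_left add_0_left diff_0 zero_power2 mult_minus_left mult_minus_right minus_minus)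
    finally have "(CLINT p|?P. iexp (\<Sum>k\<in>J. a k * W2 k p)) = complex_of_real (exp (- v * t\<^sup>2 / 2) * exp (v * ?s\<^sup>2 / 2)) * (CLINT \<omega>|M. iexp (\<Sum>i\<in>I. a' i * X i \<omega>))"
      by (simp only: of_real_mult mult.assoc)
    moreover have "exp (- v * t\<^sup>2 / 2) * exp (v * ?s\<^sup>2 / 2) = exp (- v * (t\<^sup>2 - ?s\<^sup>2) / 2)"
      unfolding exp_add[symmetric] by (rule arg_cong[where f=exp]) (simp add: field_simps)
    ultimately show "(CLINT \<omega>|M. iexp (\<Sum>k\<in>J. a k * W1 k \<omega>)) = (CLINT p|?P. iexp (\<Sum>k\<in>J. a k * W2 k p))"
      using 1 by (simp only:)
  qed measurable
  note dist = this
  have m1: "(\<lambda>\<omega>. \<lambda>k\<in>J. W1 k \<omega>) \<in> measurable M (PiM J (\<lambda>_. borel))" by (rule measurable_restrict) auto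
  have m2: "(\<lambda>\<omega>. \<lambda>k\<in>J. W2 k \<omega>) \<in> measurable ?P (PiM J (\<lambda>_. borel))" by (rule measurable_restrict) auto
  have tr: "integrable M (\<lambda>\<omega>. \<Phi> (\<lambda>k\<in>J. W1 k \<omega>)) \<longleftrightarrow> integrable ?P (\<lambda>p. \<Phi> (\<lambda>k\<in>J. W2 k p))"
    "(\<integral>\<omega>. \<Phi> (\<lambda>k\<in>J. W1 k \<omega>) \<partial>M) = (\<integral>p. \<Phi> (\<lambda>k\<in>J. W2 k p) \<partial>?P)"
    if \<Phi>: "\<Phi> \<in> borel_measurable (PiM J (\<lambda>_. borel))" for \<Phi> :: "('i option \<Rightarrow> real) \<Rightarrow> real"
    using integrable_distr_eq[OF m1 \<Phi>] integrable_distr_eq[OF m2 \<Phi>] integral_distr[OF m1 \<Phi>] integral_distr[OF m2 \<Phi>]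
    unfolding dist by auto
  \<comment> \<open>\<open>V\<close> undoes the subtraction and recovers \<open>X\<close> from \<xi>
    and \<open>Y\<close>.\<close>
  define V where "V h = (\<lambda>i\<in>I. h (Some i) + h None * b i)" for h :: "'i option \<Rightarrow> real"
  have V[measurable]: "V \<in> measurable (PiM J (\<lambda>_. borel)) (PiM I (\<lambda>_. borel))"
    unfolding V_def by (rule measurable_restrict) (auto simp: J_def intro!: measurable_component_singleton borel_measurable_add borel_measurable_times)
  have N[measurable]: "(\<lambda>h. h None) \<in> borel_measurable (PiM J (\<lambda>_. borel))"
    by (rule measurable_component_singleton) (auto simp: J_def)
  have V1: "V (\<lambda>k\<in>J. W1 k \<omega>) = (\<lambda>i\<in>I. X i \<omega>)" for \<omega>
    by (auto simp: V_def J_def W1_def Y_def restrict_def)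
  have V2: "V (\<lambda>k\<in>J. W2 k p) = (\<lambda>i\<in>I. Y i (snd p) + fst p * (r * b i))" for p
    by (auto simp: V_def J_def W2_def restrict_def)
  have N1: "(\<lambda>k\<in>J. W1 k \<omega>) None = \<xi> \<omega>" "(\<lambda>k\<in>J. W2 k p) None = r * fst p" for \<omega> p
    by (auto simp: J_def W1_def W2_def)
  have iX: "integrable M (\<lambda>\<omega>. \<bar>X i \<omega>\<bar>)" if "i \<in> I" for i
    by (rule integrable_abs[OF square_integrable_imp_integrable[OF X[OF that] X2[OF that]]])
  have i\<xi>: "integrable M (\<lambda>\<omega>. \<bar>\<xi> \<omega>\<bar>)"
    by (rule integrable_abs[OF square_integrable_imp_integrable[OF \<xi> \<xi>2]])
  have i\<xi>X: "integrable M (\<lambda>\<omega>. \<bar>\<xi> \<omega>\<bar> * \<bar>X i \<omega>\<bar>)" if "i \<in> I" for i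
  proof (rule Bochner_Integration.integrable_bound)
    show "integrable M (\<lambda>\<omega>. (\<xi> \<omega>)\<^sup>2 + (X i \<omega>)\<^sup>2)" using X2[OF that] \<xi>2 by simp
    show "AE \<omega> in M. norm (\<bar>\<xi> \<omega>\<bar> * \<bar>X i \<omega>\<bar>) \<le> norm ((\<xi> \<omega>)\<^sup>2 + (X i \<omega>)\<^sup>2)"
    proof (rule AE_I2)
      fix \<omega>
      have "2 * \<bar>\<xi> \<omega>\<bar> * \<bar>X i \<omega>\<bar> \<le> (\<xi> \<omega>)\<^sup>2 + (X i \<omega>)\<^sup>2"
        using sum_squares_bound[of "\<bar>\<xi> \<omega>\<bar>" "\<bar>X i \<omega>\<bar>"] by simp
      moreover have "0 \<le> \<bar>\<xi> \<omega>\<bar> * \<bar>X i \<omega>\<bar>" by simp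
      ultimately have "\<bar>\<xi> \<omega>\<bar> * \<bar>X i \<omega>\<bar> \<le> (\<xi> \<omega>)\<^sup>2 + (X i \<omega>)\<^sup>2" by linarith
      then show "norm (\<bar>\<xi> \<omega>\<bar> * \<bar>X i \<omega>\<bar>) \<le> norm ((\<xi> \<omega>)\<^sup>2 + (X i \<omega>)\<^sup>2)" by simp
    qed
  qed (use that in measurable)
  have Xr[measurable]: "(\<lambda>\<omega>. \<lambda>i\<in>I. X i \<omega>) \<in> measurable M (PiM I (\<lambda>_. borel))" by (rule measurable_restrict) auto
  have sX: "(\<Sum>i\<in>I. \<bar>(\<lambda>i\<in>I. x i) i\<bar>) = (\<Sum>i\<in>I. \<bar>x i\<bar>)" for x :: "'i \<Rightarrow> real" by simp
  have iG: "integrable M (\<lambda>\<omega>. \<xi> \<omega> * G (\<lambda>i\<in>I. X i \<omega>))"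
  proof (rule Bochner_Integration.integrable_bound)
    show "integrable M (\<lambda>\<omega>. A * \<bar>\<xi> \<omega>\<bar> + B * (\<Sum>i\<in>I. \<bar>\<xi> \<omega>\<bar> * \<bar>X i \<omega>\<bar>))"
      using i\<xi> i\<xi>X by auto
    show "AE \<omega> in M. norm (\<xi> \<omega> * G (\<lambda>i\<in>I. X i \<omega>)) \<le> norm (A * \<bar>\<xi> \<omega>\<bar> + B * (\<Sum>i\<in>I. \<bar>\<xi> \<omega>\<bar> * \<bar>X i \<omega>\<bar>))"
    proof (rule AE_I2)
      fix \<omega>
      have "\<bar>\<xi> \<omega>\<bar> * \<bar>G (\<lambda>i\<in>I. X i \<omega>)\<bar> \<le> \<bar>\<xi> \<omega>\<bar> * (A + B * (\<Sum>i\<in>I. \<bar>X i \<omega>\<bar>))"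
        using Gb[of "\<lambda>i\<in>I. X i \<omega>"] unfolding sX by (intro mult_left_mono) auto
      also have "\<dots> = A * \<bar>\<xi> \<omega>\<bar> + B * (\<Sum>i\<in>I. \<bar>\<xi> \<omega>\<bar> * \<bar>X i \<omega>\<bar>)"
        by (simp add: algebra_simps sum_distrib_left)
      finally show "norm (\<xi> \<omega> * G (\<lambda>i\<in>I. X i \<omega>)) \<le> norm (A * \<bar>\<xi> \<omega>\<bar> + B * (\<Sum>i\<in>I. \<bar>\<xi> \<omega>\<bar> * \<bar>X i \<omega>\<bar>))"
        by (simp add: abs_mult)
    qed
  qed measurable
  have iG': "integrable M (\<lambda>\<omega>. G' j (\<lambda>i\<in>I. X i \<omega>))" if j: "j \<in> I" for j
  proof (rule Bochner_Integration.integrable_bound)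
    show "integrable M (\<lambda>\<omega>. A + B * (\<Sum>i\<in>I. \<bar>X i \<omega>\<bar>))" using iX by auto
    show "AE \<omega> in M. norm (G' j (\<lambda>i\<in>I. X i \<omega>)) \<le> norm (A + B * (\<Sum>i\<in>I. \<bar>X i \<omega>\<bar>))"
    proof (rule AE_I2)
      fix \<omega>
      from G'b[OF j, of "\<lambda>i\<in>I. X i \<omega>"]
      show "norm (G' j (\<lambda>i\<in>I. X i \<omega>)) \<le> norm (A + B * (\<Sum>i\<in>I. \<bar>X i \<omega>\<bar>))" unfolding sX by simp
    qed
  qed (use j in measurable)
  have t1: "integrable ?P (\<lambda>p. r * fst p * G (\<lambda>i\<in>I. Y i (snd p) + fst p * (r * b i)))"
     "expectation (\<lambda>\<omega>. \<xi> \<omega> * G (\<lambda>i\<in>I. X i \<omega>)) = (\<integral>p. r * fst p * G (\<lambda>i\<in>I. Y i (snd p) + fst p * (r * b i)) \<partial>?P)"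
    using tr[of "\<lambda>h. h None * G (V h)"] iG unfolding V1 V2 N1 by auto
  have t2: "integrable ?P (\<lambda>p. G' j (\<lambda>i\<in>I. Y i (snd p) + fst p * (r * b i)))"
     "expectation (\<lambda>\<omega>. G' j (\<lambda>i\<in>I. X i \<omega>)) = (\<integral>p. G' j (\<lambda>i\<in>I. Y i (snd p) + fst p * (r * b i)) \<partial>?P)" if j: "j \<in> I" for j
    using tr[of "\<lambda>h. G' j (V h)"] iG'[OF j] j unfolding V1 V2 by auto
  \<comment> \<open>For fixed \<open>y\<close> the function is restricted to a line in direction
    \<open>r * b\<close>. One factor \<open>r = sqrt v\<close> comes from \<xi>, the other from the
    chain rule; together they give \<open>v\<close>.\<close>
  have inner: "(\<integral>z. z * G (\<lambda>i\<in>I. y i + z * (r * b i)) \<partial>?S) = (\<integral>z. (\<Sum>j\<in>I. r * b j * G' j (\<lambda>i\<in>I. y i + z * (r * b i))) \<partial>?S)" for y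
  proof -
    define s where "s = (\<Sum>i\<in>I. \<bar>y i\<bar>)"
    define u where "u = (\<Sum>i\<in>I. \<bar>r * b i\<bar>)"
    have su: "0 \<le> s" "0 \<le> u" by (auto simp: s_def u_def intro: sum_nonneg)
    \<comment> \<open>One constant dominating all coefficients in the growth bounds of the
      restricted function and of its derivative.\<close>
    define K where "K = (A + B * s) + (B * u) + u * (A + B * s) + u * (B * u)"
    have K: "A + B * s \<le> K" "B * u \<le> K" "u * (A + B * s) \<le> K" "u * (B * u) \<le> K"
      using su AB by (auto simp: K_def)
    have S: "(\<Sum>i\<in>I. \<bar>(\<lambda>i\<in>I. y i + z * (r * b i)) i\<bar>) \<le> s + u * \<bar>z\<bar>" for z
    proof -
      have "(\<Sum>i\<in>I. \<bar>(\<lambda>i\<in>I. y i + z * (r * b i)) i\<bar>) \<le> (\<Sum>i\<in>I. \<bar>y i\<bar> + \<bar>r * b i\<bar> * \<bar>z\<bar>)"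
      proof (rule sum_mono)
        fix i assume "i \<in> I"
        then show "\<bar>(\<lambda>i\<in>I. y i + z * (r * b i)) i\<bar> \<le> \<bar>y i\<bar> + \<bar>r * b i\<bar> * \<bar>z\<bar>"
          using abs_triangle_ineq[of "y i" "z * (r * b i)"] by (simp add: abs_mult mult_ac)
      qed
      also have "\<dots> = s + u * \<bar>z\<bar>" by (simp add: s_def u_def sum.distrib sum_distrib_right)
      finally show ?thesis .
    qed
    have lin: "A + B * (\<Sum>i\<in>I. \<bar>(\<lambda>i\<in>I. y i + z * (r * b i)) i\<bar>) \<le> (A + B * s) + B * u * \<bar>z\<bar>" for z
      using mult_left_mono[OF S[of z] AB(2)] by (simp add: algebra_simps)
    show ?thesis
    proof (rule std_normal_integration_by_parts[where A=K and B=K])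
      fix z
      show "((\<lambda>z. G (\<lambda>i\<in>I. y i + z * (r * b i))) has_real_derivative (\<Sum>j\<in>I. r * b j * G' j (\<lambda>i\<in>I. y i + z * (r * b i)))) (at z)"
        by (rule der)
      have "\<bar>G (\<lambda>i\<in>I. y i + z * (r * b i))\<bar> \<le> (A + B * s) + B * u * \<bar>z\<bar>"
        using Gb lin order_trans by blast
      also have "\<dots> \<le> K + K * \<bar>z\<bar>" using K by (intro add_mono mult_right_mono) auto
      finally show "\<bar>G (\<lambda>i\<in>I. y i + z * (r * b i))\<bar> \<le> K + K * \<bar>z\<bar>" .
      have "\<bar>\<Sum>j\<in>I. r * b j * G' j (\<lambda>i\<in>I. y i + z * (r * b i))\<bar> \<le> (\<Sum>j\<in>I. \<bar>r * b j * G' j (\<lambda>i\<in>I. y i + z * (r * b i))\<bar>)"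
        by (rule sum_abs)
      also have "\<dots> \<le> (\<Sum>j\<in>I. \<bar>r * b j\<bar> * ((A + B * s) + B * u * \<bar>z\<bar>))"
        unfolding abs_mult[of "r * b _"]
        by (intro sum_mono mult_left_mono order_trans[OF G'b lin]) auto
      also have "\<dots> = u * (A + B * s) + u * (B * u) * \<bar>z\<bar>"
        by (simp add: u_def algebra_simps sum.distrib sum_distrib_left)
      also have "\<dots> \<le> K + K * \<bar>z\<bar>" using K by (intro add_mono mult_right_mono) auto
      finally show "\<bar>\<Sum>j\<in>I. r * b j * G' j (\<lambda>i\<in>I. y i + z * (r * b i))\<bar> \<le> K + K * \<bar>z\<bar>" .
    qed (intro continuous_intros cont, auto)
  qed
  have "(\<integral>p. r * fst p * G (\<lambda>i\<in>I. Y i (snd p) + fst p * (r * b i)) \<partial>?P) =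
     (\<integral>\<omega>. (\<integral>z. r * z * G (\<lambda>i\<in>I. Y i \<omega> + z * (r * b i)) \<partial>?S) \<partial>M)"
    using P.integral_snd[of "\<lambda>z \<omega>. r * z * G (\<lambda>i\<in>I. Y i \<omega> + z * (r * b i))"] t1(1)
    by (simp add: case_prod_beta')
  also have "\<dots> = (\<integral>\<omega>. (\<integral>z. r * (\<Sum>j\<in>I. r * b j * G' j (\<lambda>i\<in>I. Y i \<omega> + z * (r * b i))) \<partial>?S) \<partial>M)"
    using inner by (simp add: mult.assoc)
  also have "\<dots> = (\<integral>p. r * (\<Sum>j\<in>I. r * b j * G' j (\<lambda>i\<in>I. Y i (snd p) + fst p * (r * b i))) \<partial>?P)"
    using P.integral_snd[of "\<lambda>z \<omega>. r * (\<Sum>j\<in>I. r * b j * G' j (\<lambda>i\<in>I. Y i \<omega> + z * (r * b i)))"] t2(1)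
    by (simp add: case_prod_beta')
  also have "\<dots> = v * (\<Sum>j\<in>I. b j * expectation (\<lambda>\<omega>. G' j (\<lambda>i\<in>I. X i \<omega>)))"
    using t2 by (simp add: rr[symmetric] sum_distrib_left mult_ac)
  finally show ?thesis using t1(2) by simp
qed

section \<open>Concentration of the log partition function\<close>

definition gibbs_weight :: "'i set \<Rightarrow> ('i \<Rightarrow> real) \<Rightarrow> 'i \<Rightarrow> real" where
  "gibbs_weight I x i = exp (- x i) / (\<Sum>j\<in>I. exp (- x j))"

definition log_partition :: "'i set \<Rightarrow> ('i \<Rightarrow> real) \<Rightarrow> real" where
  "log_partition I x = ln (\<Sum>j\<in>I. exp (- x j))"

context
  fixes I :: "'i set"
  assumes I: "finite I" "I \<noteq> {}"
begin

lemma partition_pos: "0 < (\<Sum>j\<in>I. exp (- x j :: real))"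
  using I by (intro sum_pos) auto

lemma gibbs_weight_nonneg: "0 \<le> gibbs_weight I x i"
  using partition_pos[of x] by (simp add: gibbs_weight_def)

lemma sum_gibbs_weight: "(\<Sum>i\<in>I. gibbs_weight I x i) = 1"
  using partition_pos[of x] by (simp add: gibbs_weight_def flip: sum_divide_distrib)

lemma gibbs_weight_le_1: "i \<in> I \<Longrightarrow> gibbs_weight I x i \<le> 1"
  using member_le_sum[of i I "gibbs_weight I x"] I gibbs_weight_nonneg sum_gibbs_weight by auto

lemma log_partition_has_derivative:
  assumes "\<And>i. i \<in> I \<Longrightarrow> ((\<lambda>s. y s i) has_real_derivative d i) (at s)"
  shows "((\<lambda>s. log_partition I (y s)) has_real_derivative - (\<Sum>i\<in>I. gibbs_weight I (y s) i * d i)) (at s)"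
proof -
  have "((\<lambda>s. \<Sum>i\<in>I. exp (- y s i)) has_real_derivative (\<Sum>i\<in>I. - d i * exp (- y s i))) (at s)"
    by (rule DERIV_sum) (use assms in \<open>auto intro!: derivative_eq_intros\<close>)
  from DERIV_chain2[OF DERIV_ln_divide this, OF partition_pos]
  show ?thesis
    by (simp add: log_partition_def gibbs_weight_def sum_divide_distrib sum_negf[symmetric] mult_ac)
qed

text \<open>A weight is the exponential of \<open>- x j - log_partition I x\<close>, so its
  derivative comes from that of the log partition function.\<close>

lemma gibbs_weight_has_derivative:
  assumes d: "\<And>i. i \<in> I \<Longrightarrow> ((\<lambda>s. y s i) has_real_derivative d i) (at s)" and j: "j \<in> I"
  shows "((\<lambda>s. gibbs_weight I (y s) j) has_real_derivative
    gibbs_weight I (y s) j * ((\<Sum>i\<in>I. gibbs_weight I (y s) i * d i) - d j)) (at s)"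
proof -
  have e: "gibbs_weight I x j = exp (- x j - log_partition I x)" for x
    using partition_pos[of x] by (simp add: gibbs_weight_def log_partition_def exp_diff)
  have "((\<lambda>s. exp (- y s j - log_partition I (y s))) has_real_derivative
      exp (- y s j - log_partition I (y s)) * (- d j - - (\<Sum>i\<in>I. gibbs_weight I (y s) i * d i))) (at s)"
    by (intro DERIV_fun_exp DERIV_diff DERIV_minus d[OF j] log_partition_has_derivative[OF d])
  then show ?thesis by (simp only: e[symmetric]) (simp add: algebra_simps)
qed

lemma continuous_on_gibbs_weight:
  assumes "\<And>i. i \<in> I \<Longrightarrow> continuous_on S (\<lambda>s. y s i)" "j \<in> I"
  shows "continuous_on S (\<lambda>s. gibbs_weight I (y s) j)"
  unfolding gibbs_weight_def using partition_pos less_imp_neq[OF partition_pos, symmetric]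
  by (intro continuous_intros assms) auto

lemma continuous_on_log_partition:
  assumes "\<And>i. i \<in> I \<Longrightarrow> continuous_on S (\<lambda>s. y s i)"
  shows "continuous_on S (\<lambda>s. log_partition I (y s))"
  unfolding log_partition_def using partition_pos less_imp_neq[OF partition_pos, symmetric]
  by (intro continuous_intros assms) auto

lemma measurable_gibbs_weight:
  assumes [measurable]: "\<And>i. i \<in> I \<Longrightarrow> (\<lambda>\<omega>. y \<omega> i) \<in> borel_measurable M" and j: "j \<in> I"
  shows "(\<lambda>\<omega>. gibbs_weight I (y \<omega>) j) \<in> borel_measurable M"
  unfolding gibbs_weight_def using j by measurable

lemma measurable_log_partition:
  assumes [measurable]: "\<And>i. i \<in> I \<Longrightarrow> (\<lambda>\<omega>. y \<omega> i) \<in> borel_measurable M"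
  shows "(\<lambda>\<omega>. log_partition I (y \<omega>)) \<in> borel_measurable M"
  unfolding log_partition_def by measurable

text \<open>The partition sum lies between any single term and \<open>card I\<close> times the
  exponential of the sum of the \<open>\<bar>x i\<bar>\<close>. The linear growth obtained is what
  \<open>gaussian_integration_by_parts\<close> admits.\<close>

lemma abs_log_partition_le: "\<bar>log_partition I x\<bar> \<le> ln (card I) + (\<Sum>i\<in>I. \<bar>x i\<bar>)"
proof -
  have c: "card I \<ge> 1" using I by (simp add: Suc_leI card_gt_0_iff)
  obtain j where j: "j \<in> I" using I by auto
  have le: "\<bar>x i\<bar> \<le> (\<Sum>i\<in>I. \<bar>x i\<bar>)" if "i \<in> I" for i
    using member_le_sum[of i I "\<lambda>i. \<bar>x i\<bar>"] I that by auto
  have "(\<Sum>i\<in>I. exp (- x i)) \<le> (\<Sum>i\<in>I. exp (\<Sum>i\<in>I. \<bar>x i\<bar>))"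
    by (rule sum_mono) (use le abs_le_iff order_trans in fastforce)
  then have "ln (\<Sum>i\<in>I. exp (- x i)) \<le> ln (card I * exp (\<Sum>i\<in>I. \<bar>x i\<bar>))"
    using partition_pos c by (subst ln_le_cancel_iff) auto
  also have "\<dots> = ln (card I) + (\<Sum>i\<in>I. \<bar>x i\<bar>)" using c by (simp add: ln_mult)
  finally have 1: "log_partition I x \<le> ln (card I) + (\<Sum>i\<in>I. \<bar>x i\<bar>)" by (simp add: log_partition_def)
  have "- (\<Sum>i\<in>I. \<bar>x i\<bar>) \<le> - x j" using le[OF j] by auto
  also have "\<dots> = ln (exp (- x j))" by simp
  also have "\<dots> \<le> log_partition I x"
    unfolding log_partition_def
    by (subst ln_le_cancel_iff) (use partition_pos j I in \<open>auto intro: member_le_sum[of j I "\<lambda>i. exp (- x i)"]\<close>)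
  finally have 2: "- (\<Sum>i\<in>I. \<bar>x i\<bar>) \<le> log_partition I x" .
  have "0 \<le> ln (card I)" using c by simp
  with 1 2 show ?thesis by linarith
qed

lemma log_partition_cong: "(\<And>i. i \<in> I \<Longrightarrow> x i = y i) \<Longrightarrow> log_partition I x = log_partition I y"
  by (simp add: log_partition_def)

lemma gibbs_weight_cong: "(\<And>i. i \<in> I \<Longrightarrow> x i = y i) \<Longrightarrow> j \<in> I \<Longrightarrow> gibbs_weight I x j = gibbs_weight I y j"
  by (simp add: gibbs_weight_def)

end

lemma square_integrable_add_abs:
  fixes U V :: "'a \<Rightarrow> real"
  assumes [measurable]: "U \<in> borel_measurable M" "V \<in> borel_measurable M"
    and "integrable M (\<lambda>\<omega>. (U \<omega>)\<^sup>2)" "integrable M (\<lambda>\<omega>. (V \<omega>)\<^sup>2)"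
  shows "integrable M (\<lambda>\<omega>. (U \<omega> + \<bar>V \<omega>\<bar>)\<^sup>2)"
proof (rule Bochner_Integration.integrable_bound)
  show "integrable M (\<lambda>\<omega>. 2 * (U \<omega>)\<^sup>2 + 2 * (V \<omega>)\<^sup>2)" using assms by simp
  show "AE \<omega> in M. norm ((U \<omega> + \<bar>V \<omega>\<bar>)\<^sup>2) \<le> norm (2 * (U \<omega>)\<^sup>2 + 2 * (V \<omega>)\<^sup>2)"
  proof (rule AE_I2)
    fix \<omega>
    have "(U \<omega> + \<bar>V \<omega>\<bar>)\<^sup>2 \<le> 2 * (U \<omega>)\<^sup>2 + 2 * (V \<omega>)\<^sup>2"
      using sum_squares_bound[of "U \<omega>" "\<bar>V \<omega>\<bar>"] by (simp add: power2_sum)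
    then show "norm ((U \<omega> + \<bar>V \<omega>\<bar>)\<^sup>2) \<le> norm (2 * (U \<omega>)\<^sup>2 + 2 * (V \<omega>)\<^sup>2)" by simp
  qed
qed measurable

lemma (in finite_measure) square_integrable_sum_abs:
  fixes Z :: "'i \<Rightarrow> 'a \<Rightarrow> real"
  assumes "finite K" and Z: "\<And>k. k \<in> K \<Longrightarrow> Z k \<in> borel_measurable M" "\<And>k. k \<in> K \<Longrightarrow> integrable M (\<lambda>\<omega>. (Z k \<omega>)\<^sup>2)"
  shows "integrable M (\<lambda>\<omega>. (c + (\<Sum>k\<in>K. \<bar>Z k \<omega>\<bar>))\<^sup>2)"
  using assms
proof (induction K rule: finite_induct)
  case (insert k K)
  have [measurable]: "Z i \<in> borel_measurable M" if "i \<in> K" for i using insert.prems that by auto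
  have "integrable M (\<lambda>\<omega>. ((c + (\<Sum>k\<in>K. \<bar>Z k \<omega>\<bar>)) + \<bar>Z k \<omega>\<bar>)\<^sup>2)"
    by (rule square_integrable_add_abs) (use insert in auto)
  then show ?case using insert.hyps by (simp add: add_ac)
qed simp

text \<open>For a covariance matrix \<open>C\<close> this expands the variance of a linear
  combination after adding \<open>e\<close> times coordinate \<open>j\<close>; the middle term is
  the covariance that integration by parts asks for.\<close>

lemma quadratic_form_shift:
  fixes C :: "'i \<Rightarrow> 'i \<Rightarrow> real"
  assumes I: "finite I" and sym: "\<And>i k. i \<in> I \<Longrightarrow> k \<in> I \<Longrightarrow> C i k = C k i" and j: "j \<in> I"
  shows "(\<Sum>i\<in>I. ((if i = j then e else 0) + u i) * (\<Sum>k\<in>I. C i k * ((if k = j then e else 0) + u k))) =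
    e\<^sup>2 * C j j + 2 * e * (\<Sum>i\<in>I. C j i * u i) + (\<Sum>i\<in>I. u i * (\<Sum>k\<in>I. C i k * u k))"
proof -
  have 1: "(\<Sum>k\<in>I. C i k * ((if k = j then e else 0) + u k)) = C i j * e + (\<Sum>k\<in>I. C i k * u k)" for i
    using I j by (simp add: distrib_left sum.distrib if_distrib[of "\<lambda>x. _ * x"] cong: if_cong)
  have "(\<Sum>i\<in>I. ((if i = j then e else 0) + u i) * (\<Sum>k\<in>I. C i k * ((if k = j then e else 0) + u k))) =
     (\<Sum>i\<in>I. (if i = j then e else 0) * (C i j * e + (\<Sum>k\<in>I. C i k * u k))) +
     (\<Sum>i\<in>I. u i * (C i j * e + (\<Sum>k\<in>I. C i k * u k)))"
    unfolding 1 by (simp add: distrib_right sum.distrib)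
  also have "(\<Sum>i\<in>I. (if i = j then e else 0) * (C i j * e + (\<Sum>k\<in>I. C i k * u k))) = e * (C j j * e + (\<Sum>k\<in>I. C j k * u k))"
    using I j by (simp add: if_distrib[of "\<lambda>x. x * _"] cong: if_cong)
  also have "(\<Sum>i\<in>I. u i * (C i j * e + (\<Sum>k\<in>I. C i k * u k))) =
      e * (\<Sum>i\<in>I. C j i * u i) + (\<Sum>i\<in>I. u i * (\<Sum>k\<in>I. C i k * u k))"
    using sym j by (simp add: distrib_left sum.distrib sum_distrib_left mult_ac)
  finally show ?thesis by (simp add: algebra_simps power2_eq_square)
qed

text \<open>The variance is bounded by rotating one copy of the field into an independent one; the derivative
  of the correlation of the two log partition functions is computed by integration by parts.\<close>

lemma (in prob_space) log_partition_concentration: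
  fixes X :: "'i \<Rightarrow> 'a \<Rightarrow> real"
  assumes I: "finite I" "I \<noteq> {}"
    and X[measurable]: "\<And>i. i \<in> I \<Longrightarrow> X i \<in> borel_measurable M"
    and char: "\<And>a. (CLINT \<omega>|M. iexp (\<Sum>i\<in>I. a i * X i \<omega>)) =
       complex_of_real (exp (- (\<Sum>i\<in>I. a i * (\<Sum>k\<in>I. C i k * a k)) / 2))"
    and sym: "\<And>i k. i \<in> I \<Longrightarrow> k \<in> I \<Longrightarrow> C i k = C k i"
    and diag: "\<And>i k. i \<in> I \<Longrightarrow> k \<in> I \<Longrightarrow> \<bar>C i k\<bar> \<le> C i i"
    and v: "\<And>i. i \<in> I \<Longrightarrow> C i i \<le> v"
  defines "F \<equiv> \<lambda>\<omega>. log_partition I (\<lambda>i. X i \<omega>)"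
  shows "integrable M F" "expectation (\<lambda>\<omega>. \<bar>F \<omega> - expectation F\<bar>) \<le> sqrt v"
proof -
  interpret P: pair_prob_space M M ..
  let ?P = "M \<Otimes>\<^sub>M M"
  define Q where "Q a = (\<Sum>i\<in>I. a i * (\<Sum>k\<in>I. C i k * a k))" for a
  have C0: "0 \<le> C i i" if "i \<in> I" for i using diag[OF that that] by linarith
  have Q_shift: "Q (\<lambda>i. (if i = j then e else 0) + u i) = e\<^sup>2 * C j j + 2 * e * (\<Sum>i\<in>I. C j i * u i) + Q u"
    if j: "j \<in> I" for j e u
    unfolding Q_def by (rule quadratic_form_shift[OF I(1) sym j])
  have Xchar: "(CLINT \<omega>|M. iexp (t * X i \<omega>)) = exp (- (C i i * t\<^sup>2) / 2)" if i: "i \<in> I" for i t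
  proof -
    have "(\<Sum>k\<in>I. (if k = i then t else 0) * X k \<omega>) = t * X i \<omega>" for \<omega>
      using I i by (simp add: if_distrib[of "\<lambda>x. x * _"] cong: if_cong)
    moreover have "Q (\<lambda>k. (if k = i then t else 0)) = C i i * t\<^sup>2"
      using Q_shift[OF i, of t "\<lambda>_. 0"] by (simp add: Q_def mult.commute)
    ultimately show ?thesis using char[of "\<lambda>k. if k = i then t else 0"] by (simp only: Q_def)
  qed
  have X2: "integrable M (\<lambda>\<omega>. (X i \<omega>)\<^sup>2)" if "i \<in> I" for i
    by (rule char_gaussian_moments(2)[OF X[OF that] C0[OF that] Xchar[OF that]])
  define lc where "lc = ln (card I)"
  have lc0: "0 \<le> lc" using I by (simp add: lc_def Suc_leI card_gt_0_iff)
  have Fm[measurable]: "F \<in> borel_measurable M" unfolding F_def by (rule measurable_log_partition[OF I]) auto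
  have F2: "integrable M (\<lambda>\<omega>. (F \<omega>)\<^sup>2)"
  proof (rule Bochner_Integration.integrable_bound)
    show "integrable M (\<lambda>\<omega>. (lc + (\<Sum>i\<in>I. \<bar>X i \<omega>\<bar>))\<^sup>2)"
      by (rule square_integrable_sum_abs) (use I X2 in auto)
    show "AE \<omega> in M. norm ((F \<omega>)\<^sup>2) \<le> norm ((lc + (\<Sum>i\<in>I. \<bar>X i \<omega>\<bar>))\<^sup>2)"
      by (rule AE_I2) (auto simp: F_def lc_def intro!: abs_le_square_iff[THEN iffD1] order_trans[OF abs_log_partition_le[OF I]])
  qed measurable
  show F1: "integrable M F" by (rule square_integrable_imp_integrable[OF Fm F2])
  define J where "J = I <+> I"
  have J: "finite J" using I by (simp add: J_def)
  have sumJ: "(\<Sum>k\<in>J. h k) = (\<Sum>i\<in>I. h (Inl i)) + (\<Sum>i\<in>I. h (Inr i))" for h :: "'i + 'i \<Rightarrow> real"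
    using I by (simp add: J_def sum.Plus)
  \<comment> \<open>Two independent copies of the field, one on each factor of the product
    space.\<close>
  define X1 where "X1 i p = X i (fst p)" for i and p :: "'a \<times> 'a"
  define X2 where "X2 i p = X i (snd p)" for i and p :: "'a \<times> 'a"
  have X1m[measurable]: "X1 i \<in> borel_measurable ?P" and X2m[measurable]: "X2 i \<in> borel_measurable ?P" if "i \<in> I" for i
    unfolding X1_def X2_def using X[OF that] by measurable
  have X1i: "integrable ?P (\<lambda>p. (X1 i p)\<^sup>2)" and X2i: "integrable ?P (\<lambda>p. (X2 i p)\<^sup>2)" if "i \<in> I" for i
    using P.integral_mult_fst_snd(1)[OF X2[OF that], of "\<lambda>_. 1"] P.integral_mult_fst_snd(1)[OF _ X2[OF that], of "\<lambda>_. 1"]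
    by (auto simp: X1_def X2_def)
  have charP: "(CLINT p|?P. iexp ((\<Sum>i\<in>I. a i * X1 i p) + (\<Sum>i\<in>I. b i * X2 i p))) = complex_of_real (exp (- (Q a + Q b) / 2))" for a b
  proof -
    have "(CLINT p|?P. iexp ((\<Sum>i\<in>I. a i * X1 i p) + (\<Sum>i\<in>I. b i * X2 i p))) =
      (CLINT p|?P. iexp (\<Sum>i\<in>I. a i * X i (fst p)) * iexp (\<Sum>i\<in>I. b i * X i (snd p)))"
      by (simp add: X1_def X2_def distrib_left flip: exp_add)
    also have "\<dots> = (CLINT \<omega>|M. iexp (\<Sum>i\<in>I. a i * X i \<omega>)) * (CLINT \<omega>|M. iexp (\<Sum>i\<in>I. b i * X i \<omega>))"
      by (rule P.integral_mult_fst_snd) (auto intro!: integrable_iexp)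
    also have "\<dots> = complex_of_real (exp (- (Q a + Q b) / 2))"
      unfolding char Q_def[symmetric] of_real_mult[symmetric] exp_add[symmetric] by (simp add: field_simps)
    finally show ?thesis .
  qed
  \<comment> \<open>At each angle \<open>Xt t\<close> has the law of \<open>X\<close>, and \<xi>,
    its derivative in the angle, is uncorrelated with it. The covariance of \<open>\<xi> t j\<close>
    with \<open>X1 i\<close> is \<open>- sin t * C j i\<close>.\<close>
  define Xt where "Xt t i p = cos t * X1 i p + sin t * X2 i p" for t i p
  define \<xi> where "\<xi> t i p = - sin t * X1 i p + cos t * X2 i p" for t i p
  have Xtm[measurable]: "Xt t i \<in> borel_measurable ?P" and \<xi>m[measurable]: "\<xi> t i \<in> borel_measurable ?P" if "i \<in> I" for t i
    unfolding Xt_def \<xi>_def using that by measurable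
  \<comment> \<open>A square-integrable envelope that serves all angles at once.\<close>
  define T where "T p = (1 + lc) + (\<Sum>k\<in>J. \<bar>case_sum X1 X2 k p\<bar>)" for p
  have T: "T p = 1 + lc + (\<Sum>i\<in>I. \<bar>X1 i p\<bar> + \<bar>X2 i p\<bar>)" for p
    by (simp add: T_def sumJ sum.distrib)
  have T1: "1 + lc \<le> T p" for p unfolding T by (simp add: sum_nonneg)
  have T2: "integrable ?P (\<lambda>p. (T p)\<^sup>2)"
    unfolding T_def by (rule P.square_integrable_sum_abs[OF J]) (auto simp: J_def X1i X2i)
  define L1 where "L1 p = log_partition I (\<lambda>i. X1 i p)" for p
  define Lt where "Lt t p = log_partition I (\<lambda>i. Xt t i p)" for t p
  define W where "W t j p = gibbs_weight I (\<lambda>i. Xt t i p) j" for t j p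
  define W1 where "W1 j p = gibbs_weight I (\<lambda>i. X1 i p) j" for j p
  have [measurable]: "L1 \<in> borel_measurable ?P" "Lt t \<in> borel_measurable ?P" for t
    unfolding L1_def Lt_def by (rule measurable_log_partition[OF I]; measurable)+
  have [measurable]: "W t j \<in> borel_measurable ?P" "W1 j \<in> borel_measurable ?P" if "j \<in> I" for t j
    unfolding W_def W1_def by (rule measurable_gibbs_weight[OF I]; use that in measurable)+
  have sc: "\<bar>sin t * x\<bar> \<le> \<bar>x\<bar>" "\<bar>cos t * x\<bar> \<le> \<bar>x\<bar>" for t x :: real
    using mult_right_mono[OF abs_sin_le_one[of t], of "\<bar>x\<bar>"] mult_right_mono[OF abs_cos_le_one[of t], of "\<bar>x\<bar>"]
    by (simp_all add: abs_mult)
  have Xt_le: "\<bar>Xt t i p\<bar> \<le> \<bar>X1 i p\<bar> + \<bar>X2 i p\<bar>" for t i p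
    unfolding Xt_def using abs_triangle_ineq[of "cos t * X1 i p" "sin t * X2 i p"] sc(2)[of t "X1 i p"] sc(1)[of t "X2 i p"] by linarith
  have \<xi>_le: "\<bar>\<xi> t i p\<bar> \<le> \<bar>X1 i p\<bar> + \<bar>X2 i p\<bar>" for t i p
    unfolding \<xi>_def using abs_triangle_ineq[of "- sin t * X1 i p" "cos t * X2 i p"] sc(1)[of t "X1 i p"] sc(2)[of t "X2 i p"] by simp
  have Lt_le: "\<bar>Lt t p\<bar> \<le> T p" for t p
  proof -
    have "\<bar>Lt t p\<bar> \<le> lc + (\<Sum>i\<in>I. \<bar>Xt t i p\<bar>)" unfolding Lt_def lc_def by (rule abs_log_partition_le[OF I])
    also have "\<dots> \<le> T p" unfolding T
      using sum_mono[of I "\<lambda>i. \<bar>Xt t i p\<bar>" "\<lambda>i. \<bar>X1 i p\<bar> + \<bar>X2 i p\<bar>"] Xt_le by simp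
    finally show ?thesis .
  qed
  have L1_Lt: "L1 = Lt 0" by (simp add: L1_def Lt_def Xt_def fun_eq_iff)
  have L1_le: "\<bar>L1 p\<bar> \<le> T p" for p using Lt_le by (simp add: L1_Lt)
  have S_le: "\<bar>\<Sum>j\<in>I. W t j p * \<xi> t j p\<bar> \<le> T p" for t p
  proof -
    have "\<bar>\<Sum>j\<in>I. W t j p * \<xi> t j p\<bar> \<le> (\<Sum>j\<in>I. \<bar>W t j p * \<xi> t j p\<bar>)" by (rule sum_abs)
    also have "\<dots> \<le> (\<Sum>j\<in>I. 1 * (\<bar>X1 j p\<bar> + \<bar>X2 j p\<bar>))"
      unfolding abs_mult
      by (intro sum_mono mult_mono \<xi>_le) (auto simp: W_def gibbs_weight_nonneg[OF I] gibbs_weight_le_1[OF I])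
    also have "\<dots> \<le> T p" unfolding T using lc0 by simp
    finally show ?thesis .
  qed
  \<comment> \<open>\<phi> runs from the second moment of \<open>F\<close> at angle 0 to the square
    of its mean at angle \<open>pi/2\<close>.\<close>
  define \<phi> where "\<phi> t = (\<integral>p. Lt t p * L1 p \<partial>?P)" for t
  have ibp: "(\<integral>p. \<xi> t j p * (W t j p * L1 p) \<partial>?P) = sin t * (\<Sum>k\<in>I. C j k * (\<integral>p. W t j p * W1 k p \<partial>?P))"
    if j: "j \<in> I" for t j
  proof -
    define Y where "Y k = case_sum (Xt t) X1 k" for k :: "'i + 'i"
    \<comment> \<open>Covariances of \<open>\<xi> t j\<close> divided by \<open>C j j\<close>: zero
      for the rotated field (\<open>Inl\<close>), proportional to \<open>sin t\<close> for the fixed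
      copy (\<open>Inr\<close>). If \<open>C j j = 0\<close>, then by \<open>diag\<close> the row
      \<open>C j\<close> vanishes, and division by zero gives the right value 0.\<close>
    define b where "b k = (case k of Inl i \<Rightarrow> 0 | Inr i \<Rightarrow> - sin t * C j i / C j j)" for k :: "'i + 'i"
    define G where "G z = gibbs_weight I (\<lambda>i. z (Inl i)) j * log_partition I (\<lambda>i. z (Inr i))" for z :: "'i + 'i \<Rightarrow> real"
    define G' where "G' k z = (case k of
        Inl k \<Rightarrow> gibbs_weight I (\<lambda>i. z (Inl i)) j * (gibbs_weight I (\<lambda>i. z (Inl i)) k - (if k = j then 1 else 0)) * log_partition I (\<lambda>i. z (Inr i))
      | Inr k \<Rightarrow> - (gibbs_weight I (\<lambda>i. z (Inl i)) j * gibbs_weight I (\<lambda>i. z (Inr i)) k))" for k and z :: "'i + 'i \<Rightarrow> real"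
    have JI: "i \<in> I \<Longrightarrow> Inl i \<in> J" "i \<in> I \<Longrightarrow> Inr i \<in> J" for i by (auto simp: J_def)
    have comp[measurable]: "(\<lambda>z. z k) \<in> borel_measurable (PiM J (\<lambda>_. borel :: real measure))" if "k \<in> J" for k
      using that by (rule measurable_component_singleton)
    have gl[measurable]: "(\<lambda>z. gibbs_weight I (\<lambda>i. z (Inl i)) k) \<in> borel_measurable (PiM J (\<lambda>_. borel))" if "k \<in> I" for k
      by (rule measurable_gibbs_weight[OF I]) (use that JI comp in auto)
    have gr[measurable]: "(\<lambda>z. gibbs_weight I (\<lambda>i. z (Inr i)) k) \<in> borel_measurable (PiM J (\<lambda>_. borel))" if "k \<in> I" for k
      by (rule measurable_gibbs_weight[OF I]) (use that JI comp in auto)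
    have lr[measurable]: "(\<lambda>z. log_partition I (\<lambda>i. z (Inr i))) \<in> borel_measurable (PiM J (\<lambda>_. borel))"
      by (rule measurable_log_partition[OF I]) (use JI comp in auto)
    have L_le: "\<bar>log_partition I (\<lambda>i. z (Inr i))\<bar> \<le> (1 + lc) + 1 * (\<Sum>k\<in>J. \<bar>z k\<bar>)" for z :: "'i + 'i \<Rightarrow> real"
    proof (rule order_trans[OF abs_log_partition_le[OF I]])
      define l r where "l = (\<Sum>i\<in>I. \<bar>z (Inl i)\<bar>)" and "r = (\<Sum>i\<in>I. \<bar>z (Inr i)\<bar>)"
      have "0 \<le> l" by (simp add: l_def sum_nonneg)
      then show "ln (card I) + (\<Sum>i\<in>I. \<bar>z (Inr i)\<bar>) \<le> (1 + lc) + 1 * (\<Sum>k\<in>J. \<bar>z k\<bar>)"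
        unfolding sumJ lc_def l_def[symmetric] r_def[symmetric] by simp
    qed
    have one_le: "1 \<le> (1 + lc) + 1 * (\<Sum>k\<in>J. \<bar>z k\<bar>)" for z :: "'i + 'i \<Rightarrow> real"
      using lc0 by (simp add: sum_nonneg)
    have bmult: "\<bar>x * y\<bar> \<le> K" if "\<bar>x\<bar> \<le> 1" "\<bar>y\<bar> \<le> K" for x y K :: real
      using mult_mono[OF that] by (simp add: abs_mult)
    have gw1: "\<bar>gibbs_weight I x k\<bar> \<le> 1" if "k \<in> I" for x k
      using gibbs_weight_nonneg[OF I, of x k] gibbs_weight_le_1[OF I that, of x] by simp
    have gw2: "\<bar>gibbs_weight I x k - (if k = j then 1 else 0)\<bar> \<le> 1" if "k \<in> I" for x k
      using gibbs_weight_nonneg[OF I, of x k] gibbs_weight_le_1[OF I that, of x] by (auto simp: abs_le_iff)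
    have "P.expectation (\<lambda>p. \<xi> t j p * G (\<lambda>k\<in>J. Y k p)) = C j j * (\<Sum>k\<in>J. b k * P.expectation (\<lambda>p. G' k (\<lambda>k\<in>J. Y k p)))"
    proof (rule P.gaussian_integration_by_parts[where A="1 + lc" and B=1, OF J C0[OF j]])
      show "Y k \<in> borel_measurable ?P" if "k \<in> J" for k
        using that by (auto simp: J_def Y_def)
      show "integrable ?P (\<lambda>p. (Y k p)\<^sup>2)" if "k \<in> J" for k
      proof -
        have "integrable ?P (\<lambda>p. (Xt t i p)\<^sup>2)" if "i \<in> I" for i
        proof (rule Bochner_Integration.integrable_bound[OF T2])
          have "\<bar>Xt t i p\<bar> \<le> \<bar>T p\<bar>" for p
            using Xt_le[of t i p] lc0 member_le_sum[of i I "\<lambda>i. \<bar>X1 i p\<bar> + \<bar>X2 i p\<bar>"] that I by (simp add: T)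
          then show "AE p in ?P. norm ((Xt t i p)\<^sup>2) \<le> norm ((T p)\<^sup>2)" by (simp add: abs_le_square_iff)
        qed (use that in measurable)
        then show ?thesis using that X1i by (auto simp: J_def Y_def)
      qed
      show "integrable ?P (\<lambda>p. (\<xi> t j p)\<^sup>2)"
      proof (rule Bochner_Integration.integrable_bound[OF T2])
        have "\<bar>\<xi> t j p\<bar> \<le> \<bar>T p\<bar>" for p
          using \<xi>_le[of t j p] lc0 member_le_sum[of j I "\<lambda>i. \<bar>X1 i p\<bar> + \<bar>X2 i p\<bar>"] j I by (simp add: T)
        then show "AE p in ?P. norm ((\<xi> t j p)\<^sup>2) \<le> norm ((T p)\<^sup>2)" by (simp add: abs_le_square_iff)
      qed (use j in measurable)
      fix s and a :: "'i + 'i \<Rightarrow> real"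
      define al where "al i = a (Inl i)" for i
      define ar where "ar i = a (Inr i)" for i
      \<comment> \<open>Sorts a combination of \<xi>, the rotated field and the fixed copy by the
        two independent copies, so that \<open>charP\<close> applies.\<close>
      have e: "e * \<xi> t j p + (\<Sum>k\<in>J. a k * Y k p) =
         (\<Sum>i\<in>I. ((if i = j then - e * sin t else 0) + (cos t * al i + ar i)) * X1 i p) +
         (\<Sum>i\<in>I. ((if i = j then e * cos t else 0) + sin t * al i) * X2 i p)" for e p
      proof -
        have "(\<Sum>i\<in>I. (if i = j then u else 0) * x i) = u * x j" for u and x :: "'i \<Rightarrow> real"
          using I j by (simp add: if_distrib[of "\<lambda>x. x * _"] cong: if_cong)
        then show ?thesis
          by (simp add: sumJ Y_def al_def ar_def \<xi>_def Xt_def distrib_right distrib_left right_diff_distrib sum.distrib sum_distrib_left mult_ac)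
      qed
      let ?R = "\<Sum>i\<in>I. C j i * ar i"
      let ?L = "\<Sum>i\<in>I. C j i * al i"
      \<comment> \<open>The squares combine through \<open>sin\<^sup>2 + cos\<^sup>2 = 1\<close>.
        The mixed terms with \<open>al\<close> carry \<open>- sin t * cos t\<close> from one copy
        and \<open>cos t * sin t\<close> from the other and cancel.\<close>
      have QQ: "Q (\<lambda>i. (if i = j then - e * sin t else 0) + (cos t * al i + ar i)) + Q (\<lambda>i. (if i = j then e * cos t else 0) + sin t * al i)
         = e\<^sup>2 * C j j - 2 * e * sin t * ?R + (Q (\<lambda>i. cos t * al i + ar i) + Q (\<lambda>i. sin t * al i))" for e
      proof -
        have "(\<Sum>i\<in>I. C j i * (cos t * al i + ar i)) = cos t * ?L + ?R" "(\<Sum>i\<in>I. C j i * (sin t * al i)) = sin t * ?L"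
          by (simp_all add: distrib_left sum.distrib sum_distrib_left mult_ac)
        moreover have "e\<^sup>2 * (sin t)\<^sup>2 * C j j + e\<^sup>2 * (cos t)\<^sup>2 * C j j = e\<^sup>2 * C j j"
          using sin_cos_squared_add[of t] by (metis distrib_left distrib_right mult_1_right mult.assoc)
        ultimately show ?thesis
          unfolding Q_shift[OF j] by (simp add: power_mult_distrib algebra_simps)
      qed
      have bsum: "C j j * (\<Sum>k\<in>J. a k * b k) = - sin t * ?R"
      proof -
        have "C j j * (ar i * (sin t * C j i / C j j)) = sin t * (C j i * ar i)" if "i \<in> I" for i
          using diag[OF j that] by (cases "C j j = 0") auto
        then show ?thesis
          by (simp add: sumJ b_def ar_def[symmetric] sum_distrib_left sum_negf)
      qed
      have 0: "(CLINT p|?P. iexp (\<Sum>k\<in>J. a k * Y k p)) = complex_of_real (exp (- (Q (\<lambda>i. cos t * al i + ar i) + Q (\<lambda>i. sin t * al i)) / 2))"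
        using charP[of "\<lambda>i. cos t * al i + ar i" "\<lambda>i. sin t * al i"] e[of 0]
        by (simp only: mult_zero_left add_0_left minus_zero if_cancel)
      have "(CLINT p|?P. iexp (s * \<xi> t j p + (\<Sum>k\<in>J. a k * Y k p))) =
         complex_of_real (exp (- (s\<^sup>2 * C j j - 2 * s * sin t * ?R + (Q (\<lambda>i. cos t * al i + ar i) + Q (\<lambda>i. sin t * al i))) / 2))"
        unfolding e charP QQ ..
      also have "\<dots> = complex_of_real (exp (- C j j * (s\<^sup>2 + 2 * s * (\<Sum>k\<in>J. a k * b k)) / 2)) * (CLINT p|?P. iexp (\<Sum>k\<in>J. a k * Y k p))"
      proof -
        have "C j j * (s\<^sup>2 + 2 * s * (\<Sum>k\<in>J. a k * b k)) = s\<^sup>2 * C j j + 2 * s * (C j j * (\<Sum>k\<in>J. a k * b k))"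
          by (simp add: algebra_simps)
        then have "- C j j * (s\<^sup>2 + 2 * s * (\<Sum>k\<in>J. a k * b k)) = - (s\<^sup>2 * C j j - 2 * s * sin t * ?R)"
          unfolding bsum by simp
        then show ?thesis unfolding 0 of_real_mult[symmetric] exp_add[symmetric] by (simp add: diff_divide_distrib add_divide_distrib)
      qed
      finally show "(CLINT p|?P. iexp (s * \<xi> t j p + (\<Sum>k\<in>J. a k * Y k p))) =
        complex_of_real (exp (- C j j * (s\<^sup>2 + 2 * s * (\<Sum>k\<in>J. a k * b k)) / 2)) * (CLINT p|?P. iexp (\<Sum>k\<in>J. a k * Y k p))" .
    next
      show "G \<in> borel_measurable (PiM J (\<lambda>_. borel))" unfolding G_def using j by measurable
      show "G' k \<in> borel_measurable (PiM J (\<lambda>_. borel))" if "k \<in> J" for k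
      proof (cases k)
        case (Inl i)
        with that have i: "i \<in> I" by (auto simp: J_def)
        show ?thesis unfolding G'_def Inl sum.case using i j by measurable
      next
        case (Inr i)
        with that have i: "i \<in> I" by (auto simp: J_def)
        show ?thesis unfolding G'_def Inr sum.case using i j by measurable
      qed
    next
      fix y d :: "'i + 'i \<Rightarrow> real" and s :: real
      let ?z = "\<lambda>s. \<lambda>k\<in>J. y k + s * d k"
      have dz: "((\<lambda>s. ?z s k) has_real_derivative d k) (at s)" if "k \<in> J" for k
        using that by (auto intro!: derivative_eq_intros)
      have "((\<lambda>s. G (?z s)) has_real_derivative
          gibbs_weight I (\<lambda>i. ?z s (Inl i)) j * ((\<Sum>i\<in>I. gibbs_weight I (\<lambda>i. ?z s (Inl i)) i * d (Inl i)) - d (Inl j)) * log_partition I (\<lambda>i. ?z s (Inr i))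
          + (- (\<Sum>i\<in>I. gibbs_weight I (\<lambda>i. ?z s (Inr i)) i * d (Inr i))) * gibbs_weight I (\<lambda>i. ?z s (Inl i)) j) (at s)"
        unfolding G_def
        by (rule DERIV_mult[OF gibbs_weight_has_derivative[OF I _ j] log_partition_has_derivative[OF I]]) (rule dz, erule JI)+
      moreover have "(\<Sum>k\<in>J. d k * G' k z) =
          gibbs_weight I (\<lambda>i. z (Inl i)) j * ((\<Sum>i\<in>I. gibbs_weight I (\<lambda>i. z (Inl i)) i * d (Inl i)) - d (Inl j)) * log_partition I (\<lambda>i. z (Inr i))
          + (- (\<Sum>i\<in>I. gibbs_weight I (\<lambda>i. z (Inr i)) i * d (Inr i))) * gibbs_weight I (\<lambda>i. z (Inl i)) j" for z
      proof -
        have "(\<Sum>i\<in>I. d (Inl i) * (g * (w i - (if i = j then 1 else 0)) * l)) = g * ((\<Sum>i\<in>I. w i * d (Inl i)) - d (Inl j)) * l" for g l and w :: "'i \<Rightarrow> real"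
        proof -
          have "(\<Sum>i\<in>I. d (Inl i) * (g * (w i - (if i = j then 1 else 0)) * l)) = (\<Sum>i\<in>I. g * l * (w i * d (Inl i)) - (if i = j then g * l * d (Inl j) else 0))"
            by (rule sum.cong) (auto simp: algebra_simps)
          then show ?thesis using I j by (simp add: sum_subtractf sum_distrib_left algebra_simps)
        qed
        note lin = this[of "gibbs_weight I (\<lambda>i. z (Inl i)) j" "gibbs_weight I (\<lambda>i. z (Inl i))" "log_partition I (\<lambda>i. z (Inr i))"]
        show ?thesis
          unfolding sumJ G'_def sum.case lin by (simp add: sum_negf sum_distrib_left mult_ac)
      qed
      ultimately show "((\<lambda>s. G (?z s)) has_real_derivative (\<Sum>k\<in>J. d k * G' k (?z s))) (at s)" by simp
    next
      fix k :: "'i + 'i" and y d :: "'i + 'i \<Rightarrow> real"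
      assume k: "k \<in> J"
      have cz: "continuous_on UNIV (\<lambda>s. (\<lambda>k\<in>J. y k + s * d k) k)" if "k \<in> J" for k
        using that by (auto intro!: continuous_intros)
      show "continuous_on UNIV (\<lambda>s. G' k (\<lambda>k\<in>J. y k + s * d k))"
      proof (cases k)
        case (Inl i)
        with k have i: "i \<in> I" by (auto simp: J_def)
        show ?thesis unfolding G'_def Inl sum.case
          by (intro continuous_intros continuous_on_gibbs_weight[OF I] continuous_on_log_partition[OF I] cz JI i j)
      next
        case (Inr i)
        with k have i: "i \<in> I" by (auto simp: J_def)
        show ?thesis unfolding G'_def Inr sum.case
          by (intro continuous_intros continuous_on_gibbs_weight[OF I] cz JI i j)
      qed
    next
      fix z :: "'i + 'i \<Rightarrow> real"
      show "\<bar>G z\<bar> \<le> 1 + lc + 1 * (\<Sum>k\<in>J. \<bar>z k\<bar>)" unfolding G_def by (intro bmult gw1 L_le j)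
      fix k assume "k \<in> J"
      then show "\<bar>G' k z\<bar> \<le> 1 + lc + 1 * (\<Sum>k\<in>J. \<bar>z k\<bar>)"
      proof (cases k)
        case (Inl i)
        with \<open>k \<in> J\<close> have i: "i \<in> I" by (auto simp: J_def)
        show ?thesis unfolding G'_def Inl sum.case by (intro bmult gw1 gw2 L_le i j)
      next
        case (Inr i)
        with \<open>k \<in> J\<close> have i: "i \<in> I" by (auto simp: J_def)
        show ?thesis unfolding G'_def Inr sum.case abs_minus
          by (rule order_trans[OF bmult[OF gw1 gw1] one_le]) (use i j in auto)
      qed
    qed (use lc0 j in auto)
    moreover have "G (\<lambda>k\<in>J. Y k p) = W t j p * L1 p" for p
      unfolding G_def W_def L1_def
      by (intro arg_cong2[where f="(*)"] gibbs_weight_cong[OF I] log_partition_cong[OF I] j) (auto simp: Y_def JI)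
    moreover have "G' (Inr i) (\<lambda>k\<in>J. Y k p) = - (W t j p * W1 i p)" if "i \<in> I" for i p
      unfolding G'_def W_def W1_def sum.case
      by (intro arg_cong[where f=uminus] arg_cong2[where f="(*)"] gibbs_weight_cong[OF I] j that) (auto simp: Y_def JI)
    ultimately have "(\<integral>p. \<xi> t j p * (W t j p * L1 p) \<partial>?P) = C j j * (\<Sum>i\<in>I. (- sin t * C j i / C j j) * (\<integral>p. - (W t j p * W1 i p) \<partial>?P))"
      by (simp add: sumJ b_def)
    also have "\<dots> = (\<Sum>i\<in>I. sin t * (C j i * (\<integral>p. W t j p * W1 i p \<partial>?P)))"
      unfolding sum_distrib_left
    proof (rule sum.cong[OF refl])
      fix i assume "i \<in> I"
      from diag[OF j this]
      show "C j j * (- sin t * C j i / C j j * (\<integral>p. - (W t j p * W1 i p) \<partial>?P)) = sin t * (C j i * (\<integral>p. W t j p * W1 i p \<partial>?P))"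
        by (cases "C j j = 0") auto
    qed
    finally show ?thesis by (simp add: sum_distrib_left)
  qed
  have iWW: "integrable ?P (\<lambda>p. W t j p * W1 k p)" if "j \<in> I" "k \<in> I" for t j k
  proof (rule P.integrable_const_bound[where B=1])
    show "AE p in ?P. norm (W t j p * W1 k p) \<le> 1"
      using that by (auto simp: W_def W1_def abs_mult gibbs_weight_nonneg[OF I] gibbs_weight_le_1[OF I] intro!: mult_le_one)
  qed (use that in measurable)
  have d\<phi>: "(\<phi> has_real_derivative - sin t * (\<Sum>j\<in>I. \<Sum>k\<in>I. C j k * (\<integral>p. W t j p * W1 k p \<partial>?P))) (at t)" for t
  proof -
    have bT: "\<bar>x * y\<bar> \<le> (T p)\<^sup>2" if "\<bar>x\<bar> \<le> T p" "\<bar>y\<bar> \<le> T p" for x y p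
      using mult_mono[OF that] T1[of p] lc0 by (simp add: abs_mult power2_eq_square)
    have "(\<phi> has_real_derivative (\<integral>p. - (\<Sum>j\<in>I. W t j p * \<xi> t j p) * L1 p \<partial>?P)) (at t)"
      unfolding \<phi>_def
    proof (rule has_real_derivative_integral_dominated[where w="\<lambda>p. (T p)\<^sup>2"])
      show "integrable ?P (\<lambda>p. Lt t p * L1 p)" for t
        by (rule Bochner_Integration.integrable_bound[OF T2]) (use bT[OF Lt_le L1_le] in auto)
      show "((\<lambda>t. Lt t p * L1 p) has_real_derivative - (\<Sum>j\<in>I. W t j p * \<xi> t j p) * L1 p) (at t)" for t p
        unfolding Lt_def W_def
        by (rule DERIV_cmult_right, rule log_partition_has_derivative[OF I])
           (auto simp: Xt_def \<xi>_def intro!: derivative_eq_intros)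
      show "\<bar>- (\<Sum>j\<in>I. W t j p * \<xi> t j p) * L1 p\<bar> \<le> (T p)\<^sup>2" for t p
        using bT[OF S_le L1_le, of t p] by simp
      show "(\<lambda>p. - (\<Sum>j\<in>I. W t j p * \<xi> t j p) * L1 p) \<in> borel_measurable ?P" by measurable
    qed (rule T2)
    also have "(\<integral>p. - (\<Sum>j\<in>I. W t j p * \<xi> t j p) * L1 p \<partial>?P) = - (\<integral>p. (\<Sum>j\<in>I. \<xi> t j p * (W t j p * L1 p)) \<partial>?P)"
      by (simp add: sum_distrib_left mult_ac)
    also have "(\<integral>p. (\<Sum>j\<in>I. \<xi> t j p * (W t j p * L1 p)) \<partial>?P) = (\<Sum>j\<in>I. (\<integral>p. \<xi> t j p * (W t j p * L1 p) \<partial>?P))"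
    proof (rule Bochner_Integration.integral_sum)
      fix j assume j: "j \<in> I"
      show "integrable ?P (\<lambda>p. \<xi> t j p * (W t j p * L1 p))"
      proof (rule Bochner_Integration.integrable_bound[OF T2])
        have "\<bar>\<xi> t j p * (W t j p * L1 p)\<bar> \<le> (T p)\<^sup>2" for p
        proof (rule bT)
          show "\<bar>\<xi> t j p\<bar> \<le> T p"
            using \<xi>_le[of t j p] lc0 member_le_sum[of j I "\<lambda>i. \<bar>X1 i p\<bar> + \<bar>X2 i p\<bar>"] j I by (simp add: T)
          show "\<bar>W t j p * L1 p\<bar> \<le> T p"
            using mult_mono[of "\<bar>W t j p\<bar>" 1 "\<bar>L1 p\<bar>" "T p"] L1_le[of p] j
            by (simp add: abs_mult W_def gibbs_weight_nonneg[OF I] gibbs_weight_le_1[OF I])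
        qed
        then show "AE p in ?P. norm (\<xi> t j p * (W t j p * L1 p)) \<le> norm ((T p)\<^sup>2)" by simp
      qed (use j in measurable)
    qed
    also have "\<dots> = sin t * (\<Sum>j\<in>I. \<Sum>k\<in>I. C j k * (\<integral>p. W t j p * W1 k p \<partial>?P))"
      by (simp add: ibp sum_distrib_left)
    finally show ?thesis by simp
  qed
  \<comment> \<open>Every \<open>C j k\<close> is at most \<open>v\<close>, and the products of
    weights sum to 1 over all pairs.\<close>
  have bound: "(\<Sum>j\<in>I. \<Sum>k\<in>I. C j k * (\<integral>p. W t j p * W1 k p \<partial>?P)) \<le> v" for t
  proof -
    have W0: "0 \<le> W t j p * W1 k p" for j k p
      by (simp add: W_def W1_def gibbs_weight_nonneg[OF I])
    have "(\<Sum>j\<in>I. \<Sum>k\<in>I. C j k * (\<integral>p. W t j p * W1 k p \<partial>?P)) \<le> (\<Sum>j\<in>I. \<Sum>k\<in>I. v * (\<integral>p. W t j p * W1 k p \<partial>?P))"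
    proof (intro sum_mono mult_right_mono)
      show "0 \<le> (\<integral>p. W t j p * W1 k p \<partial>?P)" for j k by (rule Bochner_Integration.integral_nonneg) (rule W0)
      show "C j k \<le> v" if "j \<in> I" "k \<in> I" for j k using diag[OF that] v[OF that(1)] by linarith
    qed
    also have "\<dots> = v * (\<integral>p. (\<Sum>j\<in>I. \<Sum>k\<in>I. W t j p * W1 k p) \<partial>?P)"
      using iWW by (simp add: sum_distrib_left)
    also have "(\<lambda>p. (\<Sum>j\<in>I. \<Sum>k\<in>I. W t j p * W1 k p)) = (\<lambda>p. 1)"
      by (simp add: W_def W1_def sum_gibbs_weight[OF I] flip: sum_product)
    finally show ?thesis by (simp add: P.prob_space)
  qed
  \<comment> \<open>The derivative of \<phi> is at least \<open>- v * sin t\<close>, so \<phi> minus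
    \<open>v * cos\<close> is nondecreasing on the quarter circle; its endpoints give the variance
    bound.\<close>
  have "\<phi> 0 - v * cos 0 \<le> \<phi> (pi/2) - v * cos (pi/2)"
  proof (rule DERIV_nonneg_imp_nondecreasing[where f="\<lambda>t. \<phi> t - v * cos t"])
    fix t :: real assume t: "0 \<le> t" "t \<le> pi/2"
    have "0 \<le> sin t" using t by (intro sin_ge_zero) auto
    then have "0 \<le> - sin t * (\<Sum>j\<in>I. \<Sum>k\<in>I. C j k * (\<integral>p. W t j p * W1 k p \<partial>?P)) + v * sin t"
      using mult_left_mono[OF bound[of t], of "sin t"] by (simp add: mult.commute)
    moreover have "((\<lambda>t. \<phi> t - v * cos t) has_real_derivative - sin t * (\<Sum>j\<in>I. \<Sum>k\<in>I. C j k * (\<integral>p. W t j p * W1 k p \<partial>?P)) + v * sin t) (at t)"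
      by (auto intro!: derivative_eq_intros d\<phi>)
    ultimately show "\<exists>y. ((\<lambda>t. \<phi> t - v * cos t) has_real_derivative y) (at t) \<and> 0 \<le> y" by blast
  qed simp
  moreover have "\<phi> 0 = expectation (\<lambda>\<omega>. (F \<omega>)\<^sup>2)"
    using P.integral_mult_fst_snd(2)[OF F2, of "\<lambda>_. 1"]
    by (simp add: \<phi>_def Lt_def L1_def F_def Xt_def X1_def power2_eq_square prob_space)
  moreover have "\<phi> (pi/2) = (expectation F)\<^sup>2"
    using P.integral_mult_fst_snd(2)[OF F1 F1]
    by (simp add: \<phi>_def Lt_def L1_def F_def Xt_def X1_def X2_def power2_eq_square mult.commute)
  ultimately have "variance F \<le> v" using F1 F2 by (simp add: variance_eq)
  have iD: "integrable M (\<lambda>\<omega>. \<bar>F \<omega> - expectation F\<bar>)" using F1 by simp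
  have "integrable M (\<lambda>\<omega>. (F \<omega> - expectation F)\<^sup>2)" using F1 F2 by (simp add: power2_diff)
  \<comment> \<open>The square of the mean absolute deviation is at most the variance: the gap is
    the variance of the absolute deviation.\<close>
  then have "0 \<le> expectation (\<lambda>\<omega>. \<bar>F \<omega> - expectation F\<bar>\<^sup>2) - (expectation (\<lambda>\<omega>. \<bar>F \<omega> - expectation F\<bar>))\<^sup>2"
    using variance_positive[of "\<lambda>\<omega>. \<bar>F \<omega> - expectation F\<bar>"] variance_eq[OF iD] by simp
  then have "(expectation (\<lambda>\<omega>. \<bar>F \<omega> - expectation F\<bar>))\<^sup>2 \<le> v" using \<open>variance F \<le> v\<close> by simp
  then show "expectation (\<lambda>\<omega>. \<bar>F \<omega> - expectation F\<bar>) \<le> sqrt v" by (rule real_le_rsqrt)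
qed

section \<open>Thermal fluctuations and second differences\<close>

context
  fixes I :: "'i set" and R X :: "'i \<Rightarrow> real"
  assumes I: "finite I" "I \<noteq> {}"
begin

text \<open>Here \<open>- m\<close> and \<open>V\<close> turn out to be the first two derivatives of
  \<psi>. The fluctuation is measured by the two-replica quantity \<open>u\<close> because
  \<open>\<bar>X i - X j\<bar>\<close> does not involve \<open>x\<close>, whereas
  \<open>\<bar>X i - m x\<bar>\<close> need not be differentiable in \<open>x\<close>.\<close>

private definition "\<psi> x = log_partition I (\<lambda>i. R i + x * X i)"
private definition "w x i = gibbs_weight I (\<lambda>i. R i + x * X i) i"
private definition "m x = (\<Sum>i\<in>I. w x i * X i)"
private definition "V x = (\<Sum>i\<in>I. w x i * (X i - m x)\<^sup>2)"
private definition "u x = (\<Sum>i\<in>I. \<Sum>j\<in>I. w x i * w x j * \<bar>X i - X j\<bar>)"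

private lemma w_nonneg: "0 \<le> w x i" by (simp add: w_def gibbs_weight_nonneg[OF I])
private lemma w_sum: "(\<Sum>i\<in>I. w x i) = 1" by (simp add: w_def sum_gibbs_weight[OF I])

private lemma deriv_\<psi>: "(\<psi> has_real_derivative - m x) (at x)"
  unfolding \<psi>_def m_def w_def
  by (rule log_partition_has_derivative[OF I]) (auto intro!: derivative_eq_intros)

private lemma deriv_w: "i \<in> I \<Longrightarrow> ((\<lambda>x. w x i) has_real_derivative w x i * (m x - X i)) (at x)"
  unfolding m_def w_def
  by (rule gibbs_weight_has_derivative[OF I]) (auto intro!: derivative_eq_intros)

private lemma sum_w_centered: "(\<Sum>i\<in>I. w x i * (X i - m x)) = 0"
  by (simp add: right_diff_distrib sum_subtractf w_sum flip: sum_distrib_right m_def)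

private lemma deriv_m: "(m has_real_derivative - V x) (at x)"
proof -
  have "((\<lambda>x. \<Sum>i\<in>I. w x i * X i) has_real_derivative (\<Sum>i\<in>I. w x i * (m x - X i) * X i)) (at x)"
    by (rule DERIV_sum) (auto intro!: derivative_eq_intros deriv_w)
  moreover have "(\<Sum>i\<in>I. w x i * (m x - X i) * X i) = - V x"
  proof -
    have "(\<Sum>i\<in>I. w x i * (m x - X i) * X i) = (\<Sum>i\<in>I. - (w x i * (X i - m x)\<^sup>2) - w x i * (X i - m x) * m x)"
      by (rule sum.cong) (auto simp: power2_eq_square algebra_simps)
    then show ?thesis by (simp add: sum_subtractf sum_negf V_def sum_w_centered flip: sum_distrib_right)
  qed
  ultimately show ?thesis by (simp add: m_def[abs_def])
qed

private lemma V_nonneg: "0 \<le> V x" unfolding V_def by (intro sum_nonneg mult_nonneg_nonneg w_nonneg) auto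

private lemma sum2_V: "(\<Sum>i\<in>I. \<Sum>j\<in>I. w x i * w x j * ((X i - m x)\<^sup>2 + (X j - m x)\<^sup>2)) = 2 * V x"
proof -
  have "(\<Sum>i\<in>I. \<Sum>j\<in>I. w x i * w x j * ((X i - m x)\<^sup>2 + (X j - m x)\<^sup>2)) =
    (\<Sum>i\<in>I. w x i * (X i - m x)\<^sup>2 * (\<Sum>j\<in>I. w x j)) + (\<Sum>i\<in>I. w x i * (\<Sum>j\<in>I. w x j * (X j - m x)\<^sup>2))"
    unfolding sum_distrib_left sum.distrib[symmetric] by (intro sum.cong refl) (simp add: algebra_simps)
  then show ?thesis by (simp add: w_sum V_def flip: sum_distrib_right)
qed

text \<open>With \<open>a = X i - m x\<close> and \<open>b = X j - m x\<close> the derivative is a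
  two-replica average of \<open>(- a - b) * \<bar>a - b\<bar>\<close>. This is bounded below by
  minus twice the sum of the squares of \<open>a\<close> and \<open>b\<close>, whose average is
  \<open>- 4 * V x\<close> by \<open>sum2_V\<close>.\<close>

private lemma deriv_u: "\<exists>d. (u has_real_derivative d) (at x) \<and> - (4 * V x) \<le> d"
proof (intro exI conjI)
  let ?d = "\<Sum>i\<in>I. \<Sum>j\<in>I. w x i * w x j * (2 * m x - X i - X j) * \<bar>X i - X j\<bar>"
  have "((\<lambda>x. \<Sum>i\<in>I. \<Sum>j\<in>I. w x i * w x j * \<bar>X i - X j\<bar>) has_real_derivative ?d) (at x)"
    by (rule DERIV_sum)+ (auto intro!: derivative_eq_intros deriv_w simp: algebra_simps)
  then show "(u has_real_derivative ?d) (at x)" by (simp add: u_def[abs_def])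
  have *: "- (2 * (a\<^sup>2 + b\<^sup>2)) \<le> (- a - b) * \<bar>a - b\<bar>" for a b :: real
  proof -
    define p where "p = (- a - b) * \<bar>a - b\<bar>"
    have "\<bar>p\<bar> = \<bar>(- a - b) * (a - b)\<bar>" by (simp add: abs_mult p_def)
    also have "(- a - b) * (a - b) = - (a\<^sup>2 - b\<^sup>2)" by (simp add: power2_eq_square algebra_simps)
    also have "\<bar>- (a\<^sup>2 - b\<^sup>2)\<bar> = \<bar>a\<^sup>2 - b\<^sup>2\<bar>" by (rule abs_minus_cancel)
    also have "\<dots> \<le> a\<^sup>2 + b\<^sup>2" by (auto simp: abs_le_iff)
    finally have "- p \<le> a\<^sup>2 + b\<^sup>2" by (simp only: abs_le_iff)
    moreover have "0 \<le> a\<^sup>2 + b\<^sup>2" by simp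
    moreover have "- s \<le> p" if "- p \<le> q" "0 \<le> q" "s = 2 * q" for s q using that by simp
    ultimately have "- (2 * (a\<^sup>2 + b\<^sup>2)) \<le> p" by blast
    then show ?thesis by (simp only: p_def)
  qed
  have "(\<Sum>i\<in>I. \<Sum>j\<in>I. w x i * w x j * (- (2 * ((X i - m x)\<^sup>2 + (X j - m x)\<^sup>2)))) \<le> ?d"
  proof (intro sum_mono)
    fix i j
    have "w x i * w x j * (- (2 * ((X i - m x)\<^sup>2 + (X j - m x)\<^sup>2))) \<le>
       w x i * w x j * ((- (X i - m x) - (X j - m x)) * \<bar>(X i - m x) - (X j - m x)\<bar>)"
      by (intro mult_left_mono[OF *] mult_nonneg_nonneg w_nonneg)
    moreover have "(- (X i - m x) - (X j - m x)) = 2 * m x - X i - X j" "(X i - m x) - (X j - m x) = X i - X j"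
      by simp_all
    ultimately show "w x i * w x j * (- (2 * ((X i - m x)\<^sup>2 + (X j - m x)\<^sup>2))) \<le> w x i * w x j * (2 * m x - X i - X j) * \<bar>X i - X j\<bar>"
      by (simp only: mult.assoc)
  qed
  moreover have "(\<Sum>i\<in>I. \<Sum>j\<in>I. w x i * w x j * (- (2 * ((X i - m x)\<^sup>2 + (X j - m x)\<^sup>2)))) = - (4 * V x)"
  proof -
    have "(\<Sum>i\<in>I. \<Sum>j\<in>I. w x i * w x j * (- (2 * ((X i - m x)\<^sup>2 + (X j - m x)\<^sup>2)))) =
       -2 * (\<Sum>i\<in>I. \<Sum>j\<in>I. w x i * w x j * ((X i - m x)\<^sup>2 + (X j - m x)\<^sup>2))"
      unfolding sum_distrib_left by (intro sum.cong refl) (simp add: distrib_left right_diff_distrib)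
    then show ?thesis unfolding sum2_V by simp
  qed
  ultimately show "- (4 * V x) \<le> ?d" by simp
qed

text \<open>A weak form of the bound of \<open>u\<close> by a multiple of the root of
  \<open>V\<close>, linearised with a free parameter: an estimate linear in \<open>V\<close> can be
  integrated over the disorder afterwards.\<close>

private lemma u_le: "\<epsilon> > 0 \<Longrightarrow> u x \<le> \<epsilon> + V x / \<epsilon>"
proof -
  assume e: "\<epsilon> > 0"
  have *: "\<bar>a - b\<bar> \<le> \<epsilon> + (a\<^sup>2 + b\<^sup>2) / (2 * \<epsilon>)" for a b
  proof -
    have "2 * \<epsilon> * \<bar>a - b\<bar> \<le> 2 * \<epsilon>\<^sup>2 + (a\<^sup>2 + b\<^sup>2)"
    proof -
      have "0 \<le> (\<epsilon> - \<bar>a\<bar>)\<^sup>2 + (\<epsilon> - \<bar>b\<bar>)\<^sup>2" by simp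
      also have "\<dots> = 2 * \<epsilon>\<^sup>2 + (a\<^sup>2 + b\<^sup>2) - 2 * \<epsilon> * (\<bar>a\<bar> + \<bar>b\<bar>)"
        by (simp add: power2_eq_square algebra_simps)
      finally have "2 * \<epsilon> * (\<bar>a\<bar> + \<bar>b\<bar>) \<le> 2 * \<epsilon>\<^sup>2 + (a\<^sup>2 + b\<^sup>2)" by simp
      moreover have "2 * \<epsilon> * \<bar>a - b\<bar> \<le> 2 * \<epsilon> * (\<bar>a\<bar> + \<bar>b\<bar>)"
        using e by (intro mult_left_mono) auto
      ultimately show ?thesis by linarith
    qed
    moreover have "\<epsilon> + (a\<^sup>2 + b\<^sup>2) / (2 * \<epsilon>) = (2 * \<epsilon>\<^sup>2 + (a\<^sup>2 + b\<^sup>2)) / (2 * \<epsilon>)"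
      using e by (simp add: add_divide_distrib power2_eq_square)
    ultimately show ?thesis using e by (simp add: pos_le_divide_eq mult.commute)
  qed
  have "u x \<le> (\<Sum>i\<in>I. \<Sum>j\<in>I. w x i * w x j * (\<epsilon> + ((X i - m x)\<^sup>2 + (X j - m x)\<^sup>2) / (2 * \<epsilon>)))"
    unfolding u_def
  proof (intro sum_mono mult_left_mono mult_nonneg_nonneg w_nonneg)
    show "\<bar>X i - X j\<bar> \<le> \<epsilon> + ((X i - m x)\<^sup>2 + (X j - m x)\<^sup>2) / (2 * \<epsilon>)" for i j
      using *[of "X i - m x" "X j - m x"] by simp
  qed
  also have "\<dots> = \<epsilon> * (\<Sum>i\<in>I. w x i * (\<Sum>j\<in>I. w x j)) +
      (\<Sum>i\<in>I. \<Sum>j\<in>I. w x i * w x j * ((X i - m x)\<^sup>2 + (X j - m x)\<^sup>2)) / (2 * \<epsilon>)"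
    unfolding sum_divide_distrib sum_distrib_left sum.distrib[symmetric]
    by (intro sum.cong refl) (simp add: distrib_left add_divide_distrib mult_ac)
  also have "\<dots> = \<epsilon> + V x / \<epsilon>" unfolding sum2_V by (simp add: w_sum)
  finally show ?thesis .
qed

private lemma m_antimono: "x \<le> y \<Longrightarrow> m y \<le> m x"
  by (rule DERIV_nonpos_imp_nonincreasing[where f=m]) (use deriv_m V_nonneg in \<open>auto intro!: exI\<close>)

text \<open>The thermal fluctuation is controlled by \<open>u\<close>, the mean distance of two replicas, whose derivative
  is bounded by four times the second derivative of the log partition function.\<close>

lemma gibbs_fluctuation_le:
  fixes a h \<epsilon> :: real
  assumes h: "h > 0" and e: "\<epsilon> > 0"
  defines "A \<equiv> (log_partition I (\<lambda>i. R i + (a + 2 * h) * X i) - log_partition I (\<lambda>i. R i + (a + h) * X i)) / h"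
    and "B \<equiv> (log_partition I (\<lambda>i. R i + a * X i) - log_partition I (\<lambda>i. R i + (a - h) * X i)) / h"
    and "W \<equiv> gibbs_weight I (\<lambda>i. R i + a * X i)"
  shows "B \<le> - (\<Sum>i\<in>I. W i * X i)" "- (\<Sum>i\<in>I. W i * X i) \<le> A"
    "(\<Sum>i\<in>I. W i * \<bar>X i - (\<Sum>i\<in>I. W i * X i)\<bar>) \<le> \<epsilon> + (1 / (\<epsilon> * h) + 4) * (A - B)"
proof -
  have ma: "(\<Sum>i\<in>I. W i * X i) = m a" by (simp add: W_def m_def w_def)
  \<comment> \<open>The quotient \<open>A\<close> is taken on the interval from \<open>a + h\<close>
    to \<open>a + 2 * h\<close>, not from \<open>a\<close> to \<open>a + h\<close>, so that it
    dominates \<open>- m (a + h)\<close> too; then \<open>A - B\<close> bounds the whole increment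
    of \<open>- m\<close> from \<open>a\<close> to \<open>a + h\<close>.\<close>
  obtain z where z: "a + h < z" "z < a + 2 * h" "\<psi> (a + 2 * h) - \<psi> (a + h) = (a + 2 * h - (a + h)) * (- m z)"
    using MVT2[of "a + h" "a + 2 * h" "\<psi>" "\<lambda>x. - m x"] deriv_\<psi> h by auto
  then have A: "A = - m z" using h by (simp add: A_def \<psi>_def)
  obtain y where y: "a - h < y" "y < a" "\<psi> a - \<psi> (a - h) = (a - (a - h)) * (- m y)"
    using MVT2[of "a - h" a "\<psi>" "\<lambda>x. - m x"] deriv_\<psi> h by auto
  then have B: "B = - m y" using h by (simp add: B_def \<psi>_def)
  show "B \<le> - (\<Sum>i\<in>I. W i * X i)" "- (\<Sum>i\<in>I. W i * X i) \<le> A"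
    using m_antimono[of y a] m_antimono[of a z] y z h unfolding ma A B by auto
  have AB: "m a - m (a + h) \<le> A - B" "m a \<le> m y"
    using m_antimono[of y a] m_antimono[of "a + h" z] y z h unfolding A B by auto
  \<comment> \<open>A point where \<open>V\<close> equals its average over the interval from
    \<open>a\<close> to \<open>a + h\<close>, so that it is controlled by the increment of
    \<open>m\<close> divided by \<open>h\<close>.\<close>
  obtain t where t: "a < t" "t < a + h" "m (a + h) - m a = (a + h - a) * (- V t)"
    using MVT2[of a "a + h" m "\<lambda>x. - V x"] deriv_m h by auto
  have Vt: "V t = (m a - m (a + h)) / h" using t h by (simp add: field_simps)
  \<comment> \<open>By \<open>deriv_u\<close> the function \<open>u - 4 * m\<close> is
    nondecreasing, which carries the bound at \<open>t\<close> back to \<open>a\<close>.\<close>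
  have "u a - 4 * m a \<le> u t - 4 * m t"
  proof (rule DERIV_nonneg_imp_nondecreasing[where f="\<lambda>x. u x - 4 * m x"])
    fix x
    obtain d where d: "(u has_real_derivative d) (at x)" "- (4 * V x) \<le> d" using deriv_u by blast
    then have "((\<lambda>x. u x - 4 * m x) has_real_derivative d + 4 * V x) (at x)"
      by (auto intro!: derivative_eq_intros deriv_m)
    then show "\<exists>y. ((\<lambda>x. u x - 4 * m x) has_real_derivative y) (at x) \<and> 0 \<le> y" using d by force
  qed (use t in auto)
  moreover have "u t \<le> \<epsilon> + V t / \<epsilon>" using u_le[OF e] .
  moreover have "m (a + h) \<le> m t" using m_antimono t by auto
  ultimately have "u a \<le> \<epsilon> + V t / \<epsilon> + 4 * (m a - m (a + h))" by argo
  also have "\<dots> = \<epsilon> + (1 / (\<epsilon> * h) + 4) * (m a - m (a + h))"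
    using h e by (simp add: Vt field_simps)
  also have "\<dots> \<le> \<epsilon> + (1 / (\<epsilon> * h) + 4) * (A - B)"
    using AB h e by (intro add_left_mono mult_left_mono) auto
  finally have *: "u a \<le> \<epsilon> + (1 / (\<epsilon> * h) + 4) * (A - B)" .
  \<comment> \<open>The mean \<open>m a\<close> is an average over a second replica, so the
    deviation from it is at most the mean distance of two replicas.\<close>
  have "(\<Sum>i\<in>I. W i * \<bar>X i - (\<Sum>i\<in>I. W i * X i)\<bar>) \<le> u a"
    unfolding u_def ma
  proof (rule sum_mono)
    fix i
    have "X i - m a = (\<Sum>j\<in>I. w a j * (X i - X j))"
      by (simp add: right_diff_distrib sum_subtractf w_sum m_def flip: sum_distrib_right)
    then have "\<bar>X i - m a\<bar> \<le> (\<Sum>j\<in>I. w a j * \<bar>X i - X j\<bar>)"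
      using sum_abs[of "\<lambda>j. w a j * (X i - X j)" I] by (simp add: abs_mult w_nonneg)
    then have "w a i * \<bar>X i - m a\<bar> \<le> w a i * (\<Sum>j\<in>I. w a j * \<bar>X i - X j\<bar>)" by (rule mult_left_mono) (rule w_nonneg)
    then show "W i * \<bar>X i - m a\<bar> \<le> (\<Sum>j\<in>I. w a i * w a j * \<bar>X i - X j\<bar>)"
      by (simp add: W_def w_def sum_distrib_left mult.assoc)
  qed
  with * show "(\<Sum>i\<in>I. W i * \<bar>X i - (\<Sum>i\<in>I. W i * X i)\<bar>) \<le> \<epsilon> + (1 / (\<epsilon> * h) + 4) * (A - B)" by linarith
qed

lemma log_partition_convex: "convex_on S (\<lambda>x. log_partition I (\<lambda>i. R i + x * X i))" if "convex S"
proof -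
  have "convex_on UNIV \<psi>"
    by (rule f''_ge0_imp_convex[where f'="\<lambda>x. - m x" and f''=V])
       (auto intro!: deriv_\<psi> V_nonneg derivative_eq_intros deriv_m)
  then show ?thesis using that by (auto simp: \<psi>_def[abs_def] convex_on_def)
qed

end

text \<open>The linear parts of the four-point combination cancel, as 2 - 1 - 1 = 0. The three
  errors, at most \<open>e / 4\<close> times \<open>2 * h\<close>, \<open>h\<close> and
  \<open>h\<close>, add up to \<open>e * h\<close>.\<close>

lemma differentiable_second_difference:
  fixes q :: "real \<Rightarrow> real"
  assumes "q differentiable (at a)" "a > 0" "e > 0"
  shows "\<exists>h>0. h < a \<and> (q (a + 2 * h) - q (a + h) - q a + q (a - h)) / h \<le> e"
proof -
  obtain D where "(q has_real_derivative D) (at a)" using assms(1) by (auto simp: real_differentiable_def)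
  then have "\<forall>e>0. \<exists>d>0. \<forall>y. norm (y - a) < d \<longrightarrow> norm (q y - q a - D * (y - a)) \<le> e * norm (y - a)"
    by (simp add: has_field_derivative_def has_derivative_at_alt)
  moreover have "e / 4 > 0" using assms by simp
  ultimately obtain d where d: "d > 0" "\<And>y. norm (y - a) < d \<Longrightarrow> norm (q y - q a - D * (y - a)) \<le> e / 4 * norm (y - a)"
    by blast
  \<comment> \<open>The first bound keeps \<open>a + 2 * h\<close> within distance \<open>d\<close>
    of \<open>a\<close>, the second keeps \<open>a - h\<close> positive.\<close>
  define h where "h = min (d / 3) (a / 2)"
  have h: "h > 0" "h < a" "2 * h < d" using d assms by (auto simp: h_def min_def)
  have "\<bar>q (a + 2 * h) - q a - D * (2 * h)\<bar> \<le> e / 4 * (2 * h)" "\<bar>q (a + h) - q a - D * h\<bar> \<le> e / 4 * h"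
    "\<bar>q (a - h) - q a + D * h\<bar> \<le> e / 4 * h"
    using d(2)[of "a + 2 * h"] d(2)[of "a + h"] d(2)[of "a - h"] h by auto
  then have "q (a + 2 * h) - q a - D * (2 * h) \<le> e / 4 * (2 * h)" "- (q (a + h) - q a - D * h) \<le> e / 4 * h"
    "q (a - h) - q a + D * h \<le> e / 4 * h"
    by (auto simp only: abs_le_iff)
  moreover have "e / 4 * (2 * h) = e * h / 2" "e / 4 * h = e * h / 4" "D * (2 * h) = 2 * (D * h)" by simp_all
  ultimately have "q (a + 2 * h) - q (a + h) - q a + q (a - h) \<le> e * h"
    by argo
  then show ?thesis using h by (intro exI[of _ h]) (simp add: divide_le_eq)
qed

text \<open>A subgradient of a convex function is monotone, hence continuous off a countable set.
  Supporting lines at the two outer points bound the second difference by \<open>h\<close> times an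
  increment of the subgradient, which is small at a continuity point.\<close>

lemma convex_second_difference_AE:
  fixes q :: "real \<Rightarrow> real"
  assumes q: "convex_on {0<..} q"
  shows "AE a in lborel. 0 < a \<longrightarrow> (\<forall>e>0. \<exists>h>0. h < a \<and> (q (a + 2 * h) - q (a + h) - q a + q (a - h)) / h \<le> e)"
proof -
  \<comment> \<open>For \<open>x > 0\<close> this is the right derivative of \<open>q\<close>, which
    is a subgradient.\<close>
  define r where "r x = Inf ((\<lambda>t. (q x - q t) / (x - t)) ` ({x<..} \<inter> {0<..}))" for x
  have sub: "q y \<ge> q x + r x * (y - x)" if "x > 0" "y > 0" for x y
    unfolding r_def by (rule convex_le_Inf_differential[OF q]) (use that in \<open>auto simp: interior_open\<close>)
  have "mono_on {0<..} r"
  proof (rule mono_onI)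
    fix x y :: real assume xy: "x \<in> {0<..}" "y \<in> {0<..}" "x \<le> y"
    have "q y \<ge> q x + r x * (y - x)" "q x \<ge> q y + r y * (x - y)" using sub xy by auto
    then have "0 \<le> (r y - r x) * (y - x)" by (simp add: algebra_simps)
    then show "r x \<le> r y" using xy by (cases "x = y") (auto simp: zero_le_mult_iff)
  qed
  then have "countable {a \<in> {0<..}. \<not> isCont r a}"
    by (intro mono_on_ctble_discont_open) auto
  then have "AE a in lborel. a \<notin> {a \<in> {0<..}. \<not> isCont r a}"
    by (intro AE_not_in countable_imp_null_set_lborel)
  then show ?thesis
  proof eventually_elim
    case (elim a)
    show ?case
    proof (intro impI allI)
      fix e :: real assume a: "0 < a" and e: "0 < e"
      with elim have "isCont r a" by auto
      then have "\<forall>e>0. \<exists>d>0. \<forall>y. \<bar>y - a\<bar> < d \<longrightarrow> \<bar>r y - r a\<bar> < e"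
        by (simp add: continuous_at_eps_delta dist_real_def)
      moreover have "e / 2 > 0" using e by simp
      ultimately obtain d where d: "d > 0" "\<And>y. \<bar>y - a\<bar> < d \<Longrightarrow> \<bar>r y - r a\<bar> < e / 2" by blast
      define h where "h = min (d / 3) (a / 2)"
      have h: "h > 0" "h < a" "2 * h < d" using d a by (auto simp: h_def min_def)
      have "q (a + h) \<ge> q (a + 2 * h) + r (a + 2 * h) * (- h)" "q a \<ge> q (a - h) + r (a - h) * h"
        using sub[of "a + 2 * h" "a + h"] sub[of "a - h" a] h a by auto
      then have "q (a + 2 * h) - q (a + h) - q a + q (a - h) \<le> (r (a + 2 * h) - r (a - h)) * h"
        by (simp add: algebra_simps)
      also have "\<dots> \<le> e * h"
      proof (rule mult_right_mono)
        have "\<bar>r (a + 2 * h) - r a\<bar> < e / 2" "\<bar>r (a - h) - r a\<bar> < e / 2"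
          using d(2)[of "a + 2 * h"] d(2)[of "a - h"] h by auto
        then show "r (a + 2 * h) - r (a - h) \<le> e" unfolding abs_less_iff by argo
      qed (use h in simp)
      finally show "\<exists>h>0. h < a \<and> (q (a + 2 * h) - q (a + h) - q a + q (a - h)) / h \<le> e"
        using h by (intro exI[of _ h]) (simp add: divide_le_eq)
    qed
  qed
qed

section \<open>Gaussian series\<close>

lemma (in prob_space) indep_vars_reindex:
  assumes "indep_vars M' X (f ` I)" "inj_on f I"
  shows "indep_vars (\<lambda>i. M' (f i)) (\<lambda>i. X (f i)) I"
proof -
  have "indep_vars (\<lambda>j. PiM {f j} M') (\<lambda>j \<omega>. restrict (\<lambda>i. X i \<omega>) {f j}) I"
    by (rule indep_vars_restrict[OF assms(1)]) (use assms(2) in \<open>auto simp: disjoint_family_on_def inj_on_def\<close>)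
  then have "indep_vars (\<lambda>i. M' (f i)) (\<lambda>j \<omega>. (\<lambda>g. g (f j)) (restrict (\<lambda>i. X i \<omega>) {f j})) I"
    by (rule indep_vars_compose2) (rule measurable_component_singleton, simp)
  then show ?thesis by simp
qed

lemma borel_measurable_of_bool:
  "Measurable.pred M P \<Longrightarrow> (\<lambda>x. of_bool (P x) :: real) \<in> borel_measurable M"
  unfolding of_bool_def by measurable

text \<open>Kolmogorov's maximal inequality is Chebyshev's inequality for the partial sums stopped when they
  first exceed \<open>\<epsilon>\<close>.\<close>

lemma (in prob_space) kolmogorov_maximal_inequality:
  fixes \<zeta> :: "nat \<Rightarrow> 'a \<Rightarrow> real"
  assumes ind: "indep_vars (\<lambda>_. borel) \<zeta> UNIV"
    and sq: "\<And>k. integrable M (\<lambda>\<omega>. (\<zeta> k \<omega>)\<^sup>2)" and mean: "\<And>k. expectation (\<zeta> k) = 0"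
    and \<epsilon>: "\<epsilon> > 0"
  shows "prob {\<omega>\<in>space M. \<exists>k\<le>n. \<epsilon> \<le> \<bar>\<Sum>i<k. \<zeta> i \<omega>\<bar>} \<le> (\<Sum>i<n. expectation (\<lambda>\<omega>. (\<zeta> i \<omega>)\<^sup>2)) / \<epsilon>\<^sup>2"
proof -
  have [measurable]: "\<zeta> k \<in> borel_measurable M" for k using ind by (auto simp: indep_vars_def)
  \<comment> \<open>\<open>B k\<close> is the event that no partial sum up to index \<open>k\<close>
    has reached \<epsilon>. \<open>T\<close> adds a term only while this holds, so it is the partial
    sum frozen at the first exceedance.\<close>
  define B where "B k x \<longleftrightarrow> (\<forall>j\<le>k. \<bar>\<Sum>i<j. x i\<bar> < \<epsilon>)" for k and x :: "nat \<Rightarrow> real"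
  define T where "T n x = (\<Sum>k<n. of_bool (B k x) * x k)" for n and x :: "nat \<Rightarrow> real"
  define Z where "Z \<omega> i = \<zeta> i \<omega>" for \<omega> i
  have B_mono: "B l x \<Longrightarrow> k \<le> l \<Longrightarrow> B k x" for k l x by (auto simp: B_def)
  have T_eq: "T k x = (\<Sum>i<k. x i)" if "\<And>l. l < k \<Longrightarrow> B l x" for k x
    unfolding T_def using that by (intro sum.cong) auto
  have stop: "\<epsilon> \<le> \<bar>T n x\<bar>" if k: "k \<le> n" "\<epsilon> \<le> \<bar>\<Sum>i<k. x i\<bar>" for k n x
  proof -
    define k0 where "k0 = (LEAST k. \<epsilon> \<le> \<bar>\<Sum>i<k. x i\<bar>)"
    have k0: "\<epsilon> \<le> \<bar>\<Sum>i<k0. x i\<bar>" "k0 \<le> k" unfolding k0_def using k by (auto intro: LeastI Least_le)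
    have lt: "\<bar>\<Sum>i<l. x i\<bar> < \<epsilon>" if "l < k0" for l
      using not_less_Least[of l "\<lambda>k. \<epsilon> \<le> \<bar>\<Sum>i<k. x i\<bar>"] that by (simp add: k0_def)
    have "T n x = T k0 x"
      unfolding T_def
    proof (rule sum.mono_neutral_right)
      show "\<forall>i\<in>{..<n} - {..<k0}. of_bool (B i x) * x i = 0"
      proof
        fix i assume "i \<in> {..<n} - {..<k0}"
        then have "\<not> B i x" using k0(1) unfolding B_def by (intro notI) (metis DiffD2 lessThan_iff linorder_not_less)
        then show "of_bool (B i x) * x i = 0" by simp
      qed
    qed (use k0 k in auto)
    also have "\<dots> = (\<Sum>i<k0. x i)"
      by (rule T_eq) (use lt in \<open>auto simp: B_def\<close>)
    finally show ?thesis using k0 by simp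
  qed
  have Bm[measurable]: "Measurable.pred M (\<lambda>\<omega>. B k (Z \<omega>))" for k
    unfolding B_def Z_def by measurable
  have Tm[measurable]: "(\<lambda>\<omega>. T k (Z \<omega>)) \<in> borel_measurable M" for k
    unfolding T_def by (intro borel_measurable_sum borel_measurable_times borel_measurable_of_bool Bm) (simp add: Z_def)
  have bz: "integrable M (\<lambda>\<omega>. of_bool (B k (Z \<omega>)) * (\<zeta> k \<omega>)\<^sup>2)"
    "expectation (\<lambda>\<omega>. of_bool (B k (Z \<omega>)) * (\<zeta> k \<omega>)\<^sup>2) \<le> expectation (\<lambda>\<omega>. (\<zeta> k \<omega>)\<^sup>2)" for k
  proof -
    show i: "integrable M (\<lambda>\<omega>. of_bool (B k (Z \<omega>)) * (\<zeta> k \<omega>)\<^sup>2)"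
      by (rule Bochner_Integration.integrable_bound[OF sq[of k]])
         (auto intro!: borel_measurable_times)
    show "expectation (\<lambda>\<omega>. of_bool (B k (Z \<omega>)) * (\<zeta> k \<omega>)\<^sup>2) \<le> expectation (\<lambda>\<omega>. (\<zeta> k \<omega>)\<^sup>2)"
      by (rule integral_mono[OF i sq]) auto
  qed
  have main: "integrable M (\<lambda>\<omega>. (T n (Z \<omega>))\<^sup>2) \<and>
     expectation (\<lambda>\<omega>. (T n (Z \<omega>))\<^sup>2) \<le> (\<Sum>i<n. expectation (\<lambda>\<omega>. (\<zeta> i \<omega>)\<^sup>2))" for n
  proof (induction n)
    case 0 show ?case by (simp add: T_def)
  next
    case (Suc n)
    \<comment> \<open>\<Phi> depends on the first \<open>n\<close> variables alone, hence is
      independent of \<open>\<zeta> n\<close>, and the mixed term in the square of the next stopped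
      sum has mean zero.\<close>
    define \<Phi> where "\<Phi> x = of_bool (B n x) * T n x" for x
    have \<Phi>cong: "\<Phi> (restrict x {..<n}) = \<Phi> x" for x
    proof -
      have "(\<Sum>i<j. restrict x {..<n} i) = (\<Sum>i<j. x i)" if "j \<le> n" for j
        using that by (intro sum.cong) auto
      then have "B k (restrict x {..<n}) = B k x" if "k \<le> n" for k using that by (auto simp: B_def)
      then show ?thesis unfolding \<Phi>_def T_def by (auto intro!: sum.cong arg_cong2[where f="(*)"])
    qed
    have cm: "(\<lambda>x. x i) \<in> borel_measurable (PiM {..<n} (\<lambda>_. borel :: real measure))" if "i < n" for i
      by (rule measurable_component_singleton) (use that in auto)
    have \<Phi>m: "\<Phi> \<in> borel_measurable (PiM {..<n} (\<lambda>_. borel))"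
    proof -
      have [measurable]: "(\<lambda>x. \<Sum>i<j. x i) \<in> borel_measurable (PiM {..<n} (\<lambda>_. borel :: real measure))" if "j \<le> n" for j
        by (intro borel_measurable_sum cm) (use that in auto)
      have Bm: "Measurable.pred (PiM {..<n} (\<lambda>_. borel)) (B k)" if "k \<le> n" for k
      proof -
        have "B k = (\<lambda>x. \<forall>j\<in>{..k}. \<bar>\<Sum>i<j. x i\<bar> < \<epsilon>)" by (auto simp: B_def)
        moreover have "Measurable.pred (PiM {..<n} (\<lambda>_. borel)) (\<lambda>x. \<forall>j\<in>{..k}. \<bar>\<Sum>i<j. x i\<bar> < \<epsilon>)"
          by (rule pred_intros_finite) (use that in \<open>auto intro!: borel_measurable_pred_less\<close>)
        ultimately show ?thesis by simp
      qed
      show ?thesis unfolding \<Phi>_def T_def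
        by (intro borel_measurable_times borel_measurable_of_bool borel_measurable_sum Bm cm) auto
    qed
    have "indep_var (PiM {..<n} (\<lambda>_. borel)) (\<lambda>\<omega>. restrict (\<lambda>i. \<zeta> i \<omega>) {..<n}) (PiM {n} (\<lambda>_. borel)) (\<lambda>\<omega>. restrict (\<lambda>i. \<zeta> i \<omega>) {n})"
      by (rule indep_var_restrict[OF ind]) auto
    from indep_var_compose[OF this \<Phi>m measurable_component_singleton[of n]]
    have iv: "indep_var borel (\<lambda>\<omega>. \<Phi> (Z \<omega>)) borel (\<zeta> n)"
      by (simp add: comp_def \<Phi>cong Z_def[abs_def])
    have [measurable]: "(\<lambda>\<omega>. \<Phi> (Z \<omega>)) \<in> borel_measurable M" by (rule indep_var_rv1[OF iv])
    have i\<Phi>: "integrable M (\<lambda>\<omega>. \<Phi> (Z \<omega>))"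
    proof (rule square_integrable_imp_integrable)
      show "integrable M (\<lambda>\<omega>. (\<Phi> (Z \<omega>))\<^sup>2)"
        by (rule Bochner_Integration.integrable_bound[OF conjunct1[OF Suc.IH]]) (auto simp: \<Phi>_def)
    qed measurable
    have i\<zeta>: "integrable M (\<zeta> n)" by (rule square_integrable_imp_integrable[OF _ sq]) simp
    have i\<Phi>\<zeta>: "integrable M (\<lambda>\<omega>. \<Phi> (Z \<omega>) * \<zeta> n \<omega>)" and "expectation (\<lambda>\<omega>. \<Phi> (Z \<omega>) * \<zeta> n \<omega>) = 0"
      using indep_var_integrable[OF iv i\<Phi> i\<zeta>] indep_var_lebesgue_integral[OF iv i\<Phi> i\<zeta>] mean by auto
    have eq: "(T (Suc n) (Z \<omega>))\<^sup>2 = (T n (Z \<omega>))\<^sup>2 + 2 * (\<Phi> (Z \<omega>) * \<zeta> n \<omega>) + of_bool (B n (Z \<omega>)) * (\<zeta> n \<omega>)\<^sup>2" for \<omega>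
      by (simp add: T_def \<Phi>_def Z_def power2_sum)
    have "integrable M (\<lambda>\<omega>. (T (Suc n) (Z \<omega>))\<^sup>2)" unfolding eq using i\<Phi>\<zeta> bz(1) Suc.IH by simp
    moreover have "expectation (\<lambda>\<omega>. (T (Suc n) (Z \<omega>))\<^sup>2) = expectation (\<lambda>\<omega>. (T n (Z \<omega>))\<^sup>2) + expectation (\<lambda>\<omega>. of_bool (B n (Z \<omega>)) * (\<zeta> n \<omega>)\<^sup>2)"
      unfolding eq using i\<Phi>\<zeta> bz(1) Suc.IH \<open>expectation (\<lambda>\<omega>. \<Phi> (Z \<omega>) * \<zeta> n \<omega>) = 0\<close> by simp
    ultimately show ?case using Suc.IH bz(2)[of n] by auto
  qed
  have "{\<omega>\<in>space M. \<exists>k\<le>n. \<epsilon> \<le> \<bar>\<Sum>i<k. \<zeta> i \<omega>\<bar>} \<subseteq> {\<omega>\<in>space M. \<epsilon>\<^sup>2 \<le> (T n (Z \<omega>))\<^sup>2}"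
  proof safe
    fix \<omega> k assume "k \<le> n" "\<epsilon> \<le> \<bar>\<Sum>i<k. \<zeta> i \<omega>\<bar>"
    from stop[of k n "Z \<omega>"] this have "\<bar>\<epsilon>\<bar> \<le> \<bar>T n (Z \<omega>)\<bar>" using \<epsilon> by (simp add: Z_def)
    then show "\<epsilon>\<^sup>2 \<le> (T n (Z \<omega>))\<^sup>2" by (simp add: abs_le_square_iff)
  qed
  then have "prob {\<omega>\<in>space M. \<exists>k\<le>n. \<epsilon> \<le> \<bar>\<Sum>i<k. \<zeta> i \<omega>\<bar>} \<le> prob {\<omega>\<in>space M. \<epsilon>\<^sup>2 \<le> (T n (Z \<omega>))\<^sup>2}"
    by (rule finite_measure_mono) measurable
  also have "\<dots> \<le> expectation (\<lambda>\<omega>. (T n (Z \<omega>))\<^sup>2) / \<epsilon>\<^sup>2"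
    by (rule integral_Markov_inequality_measure[where A="{}"]) (use main \<epsilon> in auto)
  also have "\<dots> \<le> (\<Sum>i<n. expectation (\<lambda>\<omega>. (\<zeta> i \<omega>)\<^sup>2)) / \<epsilon>\<^sup>2"
    using main by (intro divide_right_mono) auto
  finally show ?thesis .
qed

text \<open>The maximal inequality after index \<open>m\<close> bounds the probability of an
  oscillation of size \<epsilon> by a tail of the variance series, whatever the length of the block;
  then \<open>m\<close> tends to infinity.\<close>

lemma (in prob_space) AE_summable_indep:
  fixes \<zeta> :: "nat \<Rightarrow> 'a \<Rightarrow> real"
  assumes ind: "indep_vars (\<lambda>_. borel) \<zeta> UNIV"
    and sq: "\<And>k. integrable M (\<lambda>\<omega>. (\<zeta> k \<omega>)\<^sup>2)" and mean: "\<And>k. expectation (\<zeta> k) = 0"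
    and sum: "summable (\<lambda>k. expectation (\<lambda>\<omega>. (\<zeta> k \<omega>)\<^sup>2))"
  shows "AE \<omega> in M. summable (\<lambda>k. \<zeta> k \<omega>)"
proof -
  have [measurable]: "\<zeta> k \<in> borel_measurable M" for k using ind by (auto simp: indep_vars_def)
  let ?e = "\<lambda>k. expectation (\<lambda>\<omega>. (\<zeta> k \<omega>)\<^sup>2)"
  have e0: "0 \<le> ?e k" for k by simp
  \<comment> \<open>Off \<open>N \<epsilon>\<close> some tail has all its partial sums below
    \<epsilon>. Off all of the sets \<open>N (1 / Suc j)\<close> the series is Cauchy.\<close>
  define N where "N \<epsilon> = {\<omega>\<in>space M. \<forall>m. \<exists>k. \<epsilon> \<le> \<bar>\<Sum>i<k. \<zeta> (m + i) \<omega>\<bar>}" for \<epsilon> :: real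
  have N: "N \<epsilon> \<in> null_sets M" if \<epsilon>: "\<epsilon> > 0" for \<epsilon>
  proof -
    have [measurable]: "N \<epsilon> \<in> sets M" unfolding N_def by measurable
    have "prob (N \<epsilon>) \<le> (\<Sum>k. ?e (m + k)) / \<epsilon>\<^sup>2" for m
    proof -
      define A where "A n = {\<omega>\<in>space M. \<exists>k\<le>n. \<epsilon> \<le> \<bar>\<Sum>i<k. \<zeta> (m + i) \<omega>\<bar>}" for n
      have [measurable]: "A n \<in> sets M" for n unfolding A_def by measurable
      have "indep_vars (\<lambda>_. borel) \<zeta> (range (\<lambda>i. m + i))" by (rule indep_vars_subset[OF ind]) auto
      from indep_vars_reindex[OF this] have ind': "indep_vars (\<lambda>_. borel) (\<lambda>i. \<zeta> (m + i)) UNIV" by simp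
      have "prob (A n) \<le> (\<Sum>k. ?e (m + k)) / \<epsilon>\<^sup>2" for n
      proof -
        have "prob (A n) \<le> (\<Sum>i<n. ?e (m + i)) / \<epsilon>\<^sup>2"
          unfolding A_def by (rule kolmogorov_maximal_inequality[OF ind' sq mean \<epsilon>])
        also have "\<dots> \<le> (\<Sum>k. ?e (m + k)) / \<epsilon>\<^sup>2"
          using summable_ignore_initial_segment[OF sum, of m] by (intro divide_right_mono sum_le_suminf) (auto simp: add.commute)
        finally show ?thesis .
      qed
      moreover have "(\<lambda>n. prob (A n)) \<longlonglongrightarrow> prob (\<Union>n. A n)"
        by (rule finite_Lim_measure_incseq) (auto simp: incseq_def A_def intro: order_trans)
      ultimately have "prob (\<Union>n. A n) \<le> (\<Sum>k. ?e (m + k)) / \<epsilon>\<^sup>2" by (intro LIMSEQ_le_const2) auto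
      moreover have "prob (N \<epsilon>) \<le> prob (\<Union>n. A n)" by (rule finite_measure_mono) (auto simp: N_def A_def, meson order_refl)
      ultimately show ?thesis by linarith
    qed
    moreover have "(\<lambda>m. (\<Sum>k. ?e (m + k)) / \<epsilon>\<^sup>2) \<longlonglongrightarrow> 0 / \<epsilon>\<^sup>2"
      using suminf_exist_split2[OF sum] by (intro tendsto_divide tendsto_const) (auto simp: add.commute \<epsilon> less_imp_neq[symmetric])
    ultimately have "prob (N \<epsilon>) \<le> 0" by (intro LIMSEQ_le_const) auto
    then show ?thesis by (auto simp: null_sets_def emeasure_eq_measure measure_le_0_iff)
  qed
  have "AE \<omega> in M. \<forall>j. \<omega> \<notin> N (1 / Suc j)"
    unfolding AE_all_countable by (intro allI AE_not_in N) auto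
  then show ?thesis using AE_space
  proof eventually_elim
    case (elim \<omega>)
    show ?case unfolding summable_Cauchy
    proof (intro allI impI)
      fix e :: real assume "e > 0"
      then obtain j where j: "1 / Suc j < e / 2" using nat_approx_posE[of "e/2"] by auto
      from elim obtain m where m: "\<And>k. \<bar>\<Sum>i<k. \<zeta> (m + i) \<omega>\<bar> < 1 / Suc j"
        unfolding N_def by (auto simp: not_le)
      have S: "(\<Sum>i\<in>{m..<m+k}. \<zeta> i \<omega>) = (\<Sum>i<k. \<zeta> (m + i) \<omega>)" for k
        using sum.shift_bounds_nat_ivl[of "\<lambda>i. \<zeta> i \<omega>" 0 m k] by (simp add: lessThan_atLeast0 add.commute)
      have "norm (sum (\<lambda>k. \<zeta> k \<omega>) {p..<q}) < e" if "p \<ge> m" for p q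
      proof (cases "p \<le> q")
        case True
        have "(\<Sum>i\<in>{p..<q}. \<zeta> i \<omega>) = (\<Sum>i\<in>{m..<q}. \<zeta> i \<omega>) - (\<Sum>i\<in>{m..<p}. \<zeta> i \<omega>)"
          using sum.atLeastLessThan_concat[of m p q "\<lambda>i. \<zeta> i \<omega>"] that True by simp
        moreover have "\<bar>\<Sum>i\<in>{m..<q}. \<zeta> i \<omega>\<bar> < e / 2" "\<bar>\<Sum>i\<in>{m..<p}. \<zeta> i \<omega>\<bar> < e / 2"
          using m[of "q - m"] m[of "p - m"] S[of "q - m"] S[of "p - m"] that True j by auto
        ultimately show ?thesis unfolding real_norm_def abs_less_iff by argo
      qed (use \<open>e > 0\<close> in simp)
      then show "\<exists>m. \<forall>p\<ge>m. \<forall>q. norm (sum (\<lambda>k. \<zeta> k \<omega>) {p..<q}) < e" by blast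
    qed
  qed
qed

text \<open>Independence turns the characteristic function of a partial sum into a product.
  Dominated convergence passes to the series, whose \<open>suminf\<close> is the true limit almost
  surely by the first claim.\<close>

lemma (in prob_space) gaussian_series:
  fixes \<zeta> :: "nat \<Rightarrow> 'a \<Rightarrow> real"
  assumes ind: "indep_vars (\<lambda>_. borel) \<zeta> UNIV"
    and v: "\<And>k. v k \<ge> 0"
    and char: "\<And>k t. (CLINT \<omega>|M. iexp (t * \<zeta> k \<omega>)) = exp (- (v k * t\<^sup>2) / 2)"
    and sum: "v sums s"
  shows "AE \<omega> in M. summable (\<lambda>k. \<zeta> k \<omega>)"
    and "(CLINT \<omega>|M. iexp (\<Sum>k. \<zeta> k \<omega>)) = complex_of_real (exp (- s / 2))"
proof -
  have m[measurable]: "\<zeta> k \<in> borel_measurable M" for k using ind by (auto simp: indep_vars_def)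
  note mom = char_gaussian_moments[OF m v char]
  show ae: "AE \<omega> in M. summable (\<lambda>k. \<zeta> k \<omega>)"
    by (rule AE_summable_indep[OF ind]) (use mom sum in \<open>auto simp: sums_iff\<close>)
  have "(CLINT \<omega>|M. iexp (\<Sum>k<n. \<zeta> k \<omega>)) = complex_of_real (exp (- (\<Sum>k<n. v k) / 2))" for n
  proof -
    have "(CLINT \<omega>|M. iexp (\<Sum>k<n. \<zeta> k \<omega>)) = char (distr M borel (\<lambda>\<omega>. \<Sum>k<n. \<zeta> k \<omega>)) 1"
      by (simp add: char_def integral_distr)
    also have "\<dots> = (\<Prod>k<n. char (distr M borel (\<zeta> k)) 1)"
      by (rule char_distr_sum[OF indep_vars_subset[OF ind]]) simp
    also have "\<dots> = (\<Prod>k<n. complex_of_real (exp (- v k / 2)))"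
    proof (rule prod.cong[OF refl])
      fix k show "char (distr M borel (\<zeta> k)) 1 = complex_of_real (exp (- v k / 2))"
        using char[of 1 k] by (simp add: char_def integral_distr exp_of_real[symmetric])
    qed
    also have "\<dots> = complex_of_real (exp (\<Sum>k<n. - v k / 2))" by (simp add: exp_sum)
    also have "(\<Sum>k<n. - v k / 2) = - (\<Sum>k<n. v k) / 2" by (simp add: sum_negf sum_divide_distrib)
    finally show ?thesis .
  qed
  moreover have "(\<lambda>n. CLINT \<omega>|M. iexp (\<Sum>k<n. \<zeta> k \<omega>)) \<longlonglongrightarrow> (CLINT \<omega>|M. iexp (\<Sum>k. \<zeta> k \<omega>))"
  proof (rule integral_dominated_convergence[where w="\<lambda>_. 1"])
    show "AE \<omega> in M. (\<lambda>n. iexp (\<Sum>k<n. \<zeta> k \<omega>)) \<longlonglongrightarrow> iexp (\<Sum>k. \<zeta> k \<omega>)"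
      using ae by eventually_elim (intro tendsto_intros summable_LIMSEQ)
  qed auto
  moreover have "(\<lambda>n. complex_of_real (exp (- (\<Sum>k<n. v k) / 2))) \<longlonglongrightarrow> complex_of_real (exp (- s / 2))"
    using sum unfolding sums_def by (intro tendsto_intros) auto
  ultimately show "(CLINT \<omega>|M. iexp (\<Sum>k. \<zeta> k \<omega>)) = complex_of_real (exp (- s / 2))"
    using LIMSEQ_unique by simp
qed

section \<open>The complete Hamiltonian in a fixed volume\<close>

text \<open>One formula covers both the degenerate and the absolutely continuous case, so the case
  distinction in \<open>centered_gaussian\<close> disappears from here on.\<close>

lemma (in prob_space) centered_gaussian_char:
  assumes "centered_gaussian M v Y"
  shows "(CLINT \<omega>|M. iexp (t * Y \<omega>)) = exp (- (v * t\<^sup>2) / 2)"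
proof (cases "v = 0")
  case True
  then have "AE \<omega> in M. Y \<omega> = 0" using assms by (simp add: centered_gaussian_def)
  then have "AE \<omega> in M. iexp (t * Y \<omega>) = 1" by eventually_elim simp
  then have "(CLINT \<omega>|M. iexp (t * Y \<omega>)) = (CLINT \<omega>|M. 1)"
    using assms by (intro integral_cong_AE) (auto simp: centered_gaussian_def)
  then show ?thesis using True by (simp add: prob_space)
next
  case False
  have Ym[measurable]: "Y \<in> borel_measurable M" and v: "v > 0" and "distributed M lborel Y (normal_density 0 (sqrt v))"
    using assms False by (auto simp: centered_gaussian_def)
  then have d: "distributed M lborel (\<lambda>x. Y x / sqrt v) std_normal_density"
    using normal_standard_normal_convert[of "sqrt v" Y 0] by simp
  have "char std_normal_distribution (t * sqrt v) = (CLINT x|distr M lborel (\<lambda>x. Y x / sqrt v). iexp (t * sqrt v * x))"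
    using distributed_distr_eq_density[OF d] by (simp add: char_def)
  also have "\<dots> = (CLINT \<omega>|M. iexp (t * sqrt v * (Y \<omega> / sqrt v)))"
    by (subst integral_distr) auto
  also have "(\<lambda>\<omega>. iexp (t * sqrt v * (Y \<omega> / sqrt v))) = (\<lambda>\<omega>. iexp (t * Y \<omega>))" using v by simp
  finally show ?thesis
    using v unfolding char_std_normal_distribution by (simp add: power_mult_distrib mult.commute flip: exp_of_real)
qed

section \<open>Spin configurations and the overlap covariance\<close>

lemma finite_configs: "finite L \<Longrightarrow> finite (configs L)"
  by (simp add: configs_def finite_PiE)

lemma configs_nonempty: "configs L \<noteq> {}"
  by (simp add: configs_def PiE_eq_empty_iff)

lemma spin_prod_square: "\<sigma> \<in> configs L \<Longrightarrow> X \<subseteq> L \<Longrightarrow> (spin_prod \<sigma> X)\<^sup>2 = 1"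
  unfolding spin_prod_def prod_power_distrib
  by (rule prod.neutral) (auto simp: configs_def PiE_iff subset_eq power2_eq_1_iff)

lemma covariance_sym: "covariance \<Delta> L \<sigma> \<tau> = covariance \<Delta> L \<tau> \<sigma>"
  by (simp add: covariance_def mult_ac)

text \<open>Spin products square to 1, so all configurations have the same self-overlap. This
  constancy is what lets self-overlaps cancel in the covariance of an observable with the
  energy.\<close>

lemma covariance_self:
  assumes "\<sigma> \<in> configs L"
  shows "covariance \<Delta> L \<sigma> \<sigma> = (\<Sum>X\<in>Pow L. (\<Delta> L X)\<^sup>2) / real (card L)"
proof -
  have "(\<Sum>X\<in>Pow L. (\<Delta> L X)\<^sup>2 * spin_prod \<sigma> X * spin_prod \<sigma> X) = (\<Sum>X\<in>Pow L. (\<Delta> L X)\<^sup>2)"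
    by (rule sum.cong) (use spin_prod_square[OF assms] in \<open>auto simp: power2_eq_square mult.assoc\<close>)
  then show ?thesis by (simp add: covariance_def)
qed

lemma abs_covariance_le:
  assumes "\<sigma> \<in> configs L" "\<tau> \<in> configs L"
  shows "\<bar>covariance \<Delta> L \<sigma> \<tau>\<bar> \<le> (\<Sum>X\<in>Pow L. (\<Delta> L X)\<^sup>2) / real (card L)"
proof -
  have s: "\<bar>spin_prod \<rho> X\<bar> = 1" if "\<rho> \<in> configs L" "X \<subseteq> L" for \<rho> X
    using spin_prod_square[OF that] by (auto simp: power2_eq_1_iff)
  have "\<bar>\<Sum>X\<in>Pow L. (\<Delta> L X)\<^sup>2 * spin_prod \<sigma> X * spin_prod \<tau> X\<bar> \<le> (\<Sum>X\<in>Pow L. (\<Delta> L X)\<^sup>2)"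
    by (rule order_trans[OF sum_abs sum_mono]) (use assms s in \<open>auto simp: abs_mult\<close>)
  then show ?thesis by (simp add: covariance_def divide_right_mono)
qed

text \<open>The covariance per site of \<open>scaled_field\<close>. Dividing by the stability
  constant keeps all powers bounded by 1 on configurations, so that square-summability of \<beta>
  controls the whole series.\<close>

definition overlap_kernel ::
  "('d::finite site set \<Rightarrow> 'd site set \<Rightarrow> real) \<Rightarrow> real \<Rightarrow> 'd site set \<Rightarrow> nat \<Rightarrow> 'd config \<Rightarrow> 'd config \<Rightarrow> real" where
  "overlap_kernel \<Delta> c L p \<sigma> \<tau> = (covariance \<Delta> L \<sigma> \<tau> / c) ^ p"

definition scaled_field ::
  "real \<Rightarrow> ('d::finite site set \<Rightarrow> nat \<Rightarrow> 'd config \<Rightarrow> 'w \<Rightarrow> real) \<Rightarrow> 'd site set \<Rightarrow> nat \<Rightarrow> 'd config \<Rightarrow> 'w \<Rightarrow> real" where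
  "scaled_field c H L p \<sigma> \<omega> = H L p \<sigma> \<omega> / sqrt c ^ p"

lemma overlap_kernel_sym: "overlap_kernel \<Delta> c L p \<sigma> \<tau> = overlap_kernel \<Delta> c L p \<tau> \<sigma>"
  by (simp add: overlap_kernel_def covariance_sym)

locale spin_glass_volume = complete_spin_glass M \<Delta> c J H
  for M :: "'w measure" and \<Delta> :: "'d::finite site set \<Rightarrow> 'd site set \<Rightarrow> real" and c J H +
  fixes L :: "'d site set"
  assumes L: "finite L" "L \<noteq> {}"
begin

abbreviation "S \<equiv> configs L"
abbreviation "K \<equiv> overlap_kernel \<Delta> c L"
abbreviation "\<N> \<equiv> real (card L)"
abbreviation "hbar \<equiv> complete_hamiltonian c H L"
abbreviation "field \<equiv> scaled_field c H L"

lemma S: "finite S" "S \<noteq> {}" using L finite_configs configs_nonempty by auto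

lemma card_pos: "\<N> > 0" using L by (simp add: card_gt_0_iff)

lemma abs_covariance_le_c: "\<sigma> \<in> S \<Longrightarrow> \<tau> \<in> S \<Longrightarrow> \<bar>covariance \<Delta> L \<sigma> \<tau>\<bar> \<le> c"
  using abs_covariance_le[of \<sigma> L \<tau> \<Delta>] thermodynamic_stability[OF L] by linarith

lemma K_diag_eq: "\<sigma> \<in> S \<Longrightarrow> \<tau> \<in> S \<Longrightarrow> K p \<sigma> \<sigma> = K p \<tau> \<tau>"
  by (simp add: overlap_kernel_def covariance_self)

lemma abs_K_le: "\<sigma> \<in> S \<Longrightarrow> \<tau> \<in> S \<Longrightarrow> \<bar>K p \<sigma> \<tau>\<bar> \<le> K p \<sigma> \<sigma>"
  unfolding overlap_kernel_def power_abs
proof (rule power_mono)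
  assume "\<sigma> \<in> S" "\<tau> \<in> S"
  then have "\<bar>covariance \<Delta> L \<sigma> \<tau>\<bar> \<le> covariance \<Delta> L \<sigma> \<sigma>" by (simp add: covariance_self abs_covariance_le)
  then show "\<bar>covariance \<Delta> L \<sigma> \<tau> / c\<bar> \<le> covariance \<Delta> L \<sigma> \<sigma> / c" using c_pos by (simp add: divide_right_mono)
qed simp

lemma K_le_1: "\<sigma> \<in> S \<Longrightarrow> K p \<sigma> \<sigma> \<le> 1"
  unfolding overlap_kernel_def
proof (rule power_le_one)
  assume \<sigma>: "\<sigma> \<in> S"
  then show "0 \<le> covariance \<Delta> L \<sigma> \<sigma> / c" using c_pos by (simp add: covariance_self sum_nonneg)
  show "covariance \<Delta> L \<sigma> \<sigma> / c \<le> 1" using abs_covariance_le_c[OF \<sigma> \<sigma>] c_pos by simp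
qed

lemma abs_K_le_1: "\<sigma> \<in> S \<Longrightarrow> \<tau> \<in> S \<Longrightarrow> \<bar>K p \<sigma> \<tau>\<bar> \<le> 1"
  using abs_K_le[of \<sigma> \<tau> p] K_le_1[of \<sigma> p] by linarith

lemma K_diag_nonneg: "\<sigma> \<in> S \<Longrightarrow> 0 \<le> K p \<sigma> \<sigma>"
  using abs_K_le[of \<sigma> \<sigma> p] by linarith

lemma H_square_integrable:
  assumes "p \<ge> 1" "\<sigma> \<in> S" shows "H L p \<sigma> \<in> borel_measurable M"
    and "integrable M (\<lambda>\<omega>. (H L p \<sigma> \<omega>)\<^sup>2)"
proof -
  have e: "(\<lambda>\<omega>. \<Sum>\<tau>\<in>S. (if \<tau> = \<sigma> then 1 else 0) * H L p \<tau> \<omega>) = H L p \<sigma>"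
    using S assms by (simp add: if_distrib[of "\<lambda>x. x * _"] cong: if_cong)
  obtain v where "centered_gaussian M v (H L p \<sigma>)"
    using H_gaussian[OF L assms(1), unfolded centered_gaussian_family_def, rule_format, of "\<lambda>\<tau>. if \<tau> = \<sigma> then 1 else 0"]
    unfolding e by blast
  moreover from this show m: "H L p \<sigma> \<in> borel_measurable M" by (simp add: centered_gaussian_def)
  ultimately show "integrable M (\<lambda>\<omega>. (H L p \<sigma> \<omega>)\<^sup>2)"
    using char_gaussian_moments(2)[OF m, of v] centered_gaussian_char by (auto simp: centered_gaussian_def)
qed

lemma field_measurable: "p \<ge> 1 \<Longrightarrow> \<sigma> \<in> S \<Longrightarrow> field p \<sigma> \<in> borel_measurable M"
  unfolding scaled_field_def using H_square_integrable(1)[of p \<sigma>] by measurable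

text \<open>\<open>H_gaussian\<close> leaves the variance of a linear combination unspecified; it is
  recovered from the second moments in \<open>H_covariance\<close>. Two factors
  \<open>sqrt c ^ p\<close> make the \<open>c ^ p\<close> of the kernel.\<close>

lemma linear_char:
  assumes p: "p \<ge> 1"
  shows "(CLINT \<omega>|M. iexp (t * (\<Sum>\<tau>\<in>S. e \<tau> * field p \<tau> \<omega>))) =
     exp (- ((\<N> * (\<Sum>\<sigma>\<in>S. e \<sigma> * (\<Sum>\<tau>\<in>S. K p \<sigma> \<tau> * e \<tau>))) * t\<^sup>2) / 2)"
    and "0 \<le> \<N> * (\<Sum>\<sigma>\<in>S. e \<sigma> * (\<Sum>\<tau>\<in>S. K p \<sigma> \<tau> * e \<tau>))"
proof -
  define a where "a \<tau> = e \<tau> / sqrt c ^ p" for \<tau>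
  define Y where "Y \<omega> = (\<Sum>\<tau>\<in>S. a \<tau> * H L p \<tau> \<omega>)" for \<omega>
  obtain v where v: "centered_gaussian M v Y"
    using H_gaussian[OF L p] unfolding centered_gaussian_family_def Y_def by blast
  then have [measurable]: "Y \<in> borel_measurable M" and v0: "v \<ge> 0" by (auto simp: centered_gaussian_def)
  have iHH: "integrable M (\<lambda>\<omega>. H L p \<sigma> \<omega> * H L p \<tau> \<omega>)" if "\<sigma> \<in> S" "\<tau> \<in> S" for \<sigma> \<tau>
  proof (rule Bochner_Integration.integrable_bound)
    show "integrable M (\<lambda>\<omega>. (H L p \<sigma> \<omega>)\<^sup>2 + (H L p \<tau> \<omega>)\<^sup>2)" using H_square_integrable(2)[OF p] that by simp
    show "AE \<omega> in M. norm (H L p \<sigma> \<omega> * H L p \<tau> \<omega>) \<le> norm ((H L p \<sigma> \<omega>)\<^sup>2 + (H L p \<tau> \<omega>)\<^sup>2)"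
    proof (rule AE_I2)
      fix \<omega>
      define x y where "x = \<bar>H L p \<sigma> \<omega>\<bar>" and "y = \<bar>H L p \<tau> \<omega>\<bar>"
      have "2 * x * y \<le> x\<^sup>2 + y\<^sup>2" by (rule sum_squares_bound)
      moreover have "0 \<le> x * y" by (simp add: x_def y_def)
      ultimately have "x * y \<le> x\<^sup>2 + y\<^sup>2" by argo
      then show "norm (H L p \<sigma> \<omega> * H L p \<tau> \<omega>) \<le> norm ((H L p \<sigma> \<omega>)\<^sup>2 + (H L p \<tau> \<omega>)\<^sup>2)"
        by (simp add: x_def y_def abs_mult)
    qed
  qed (use H_square_integrable(1)[OF p] that in measurable)
  have EHH: "expectation (\<lambda>\<omega>. H L p \<sigma> \<omega> * H L p \<tau> \<omega>) = \<N> * covariance \<Delta> L \<sigma> \<tau> ^ p" if "\<sigma> \<in> S" "\<tau> \<in> S" for \<sigma> \<tau>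
    using H_covariance[OF L p that] card_pos by (simp add: field_simps)
  have "v = expectation (\<lambda>\<omega>. (Y \<omega>)\<^sup>2)"
    using char_gaussian_moments(4)[OF _ v0 centered_gaussian_char[OF v]] by simp
  also have "\<dots> = expectation (\<lambda>\<omega>. \<Sum>\<sigma>\<in>S. \<Sum>\<tau>\<in>S. a \<sigma> * a \<tau> * (H L p \<sigma> \<omega> * H L p \<tau> \<omega>))"
    by (simp add: Y_def power2_eq_square sum_product mult_ac)
  also have "\<dots> = (\<Sum>\<sigma>\<in>S. \<Sum>\<tau>\<in>S. a \<sigma> * a \<tau> * (\<N> * covariance \<Delta> L \<sigma> \<tau> ^ p))"
    using iHH EHH by simp
  also have "\<dots> = \<N> * (\<Sum>\<sigma>\<in>S. e \<sigma> * (\<Sum>\<tau>\<in>S. K p \<sigma> \<tau> * e \<tau>))"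
    unfolding sum_distrib_left
  proof (intro sum.cong refl)
    fix \<sigma> \<tau>
    have "sqrt c ^ p * sqrt c ^ p = c ^ p" using c_pos by (simp flip: power_mult_distrib)
    then have "a \<sigma> * a \<tau> = e \<sigma> * e \<tau> / c ^ p" by (simp add: a_def)
    then show "a \<sigma> * a \<tau> * (\<N> * covariance \<Delta> L \<sigma> \<tau> ^ p) = \<N> * (e \<sigma> * (K p \<sigma> \<tau> * e \<tau>))"
      by (simp add: overlap_kernel_def power_divide)
  qed
  finally have v_eq: "v = \<N> * (\<Sum>\<sigma>\<in>S. e \<sigma> * (\<Sum>\<tau>\<in>S. K p \<sigma> \<tau> * e \<tau>))" .
  have "(\<Sum>\<tau>\<in>S. e \<tau> * field p \<tau> \<omega>) = Y \<omega>" for \<omega>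
    by (simp add: Y_def a_def scaled_field_def)
  then show "(CLINT \<omega>|M. iexp (t * (\<Sum>\<tau>\<in>S. e \<tau> * field p \<tau> \<omega>))) =
     exp (- ((\<N> * (\<Sum>\<sigma>\<in>S. e \<sigma> * (\<Sum>\<tau>\<in>S. K p \<sigma> \<tau> * e \<tau>))) * t\<^sup>2) / 2)"
    using centered_gaussian_char[OF v, of t] unfolding v_eq[symmetric] by simp
  show "0 \<le> \<N> * (\<Sum>\<sigma>\<in>S. e \<sigma> * (\<Sum>\<tau>\<in>S. K p \<sigma> \<tau> * e \<tau>))" using v0 unfolding v_eq .
qed

text \<open>The coefficients may vary with both the index and the configuration, so that every joint
  characteristic function of the Hamiltonian and a single field is an instance of one
  series.\<close>

lemma field_series:
  assumes s: "(\<lambda>k. \<N> * (\<Sum>\<sigma>\<in>S. e k \<sigma> * (\<Sum>\<tau>\<in>S. K (Suc k) \<sigma> \<tau> * e k \<tau>))) sums s"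
  shows "AE \<omega> in M. summable (\<lambda>k. \<Sum>\<tau>\<in>S. e k \<tau> * field (Suc k) \<tau> \<omega>)"
    and "(CLINT \<omega>|M. iexp (\<Sum>k. \<Sum>\<tau>\<in>S. e k \<tau> * field (Suc k) \<tau> \<omega>)) = complex_of_real (exp (- s / 2))"
proof -
  have "{1..} = range Suc"
  proof safe
    fix x :: nat assume "x \<ge> 1" then show "x \<in> range Suc" by (cases x) auto
  qed auto
  then have "indep_vars (\<lambda>_. PiM S (\<lambda>_. borel)) (\<lambda>p \<omega>. \<lambda>\<sigma>\<in>S. H L p \<sigma> \<omega>) (range Suc)"
    using H_indep[OF L] by simp
  from indep_vars_reindex[OF this]
  have "indep_vars (\<lambda>_. PiM S (\<lambda>_. borel)) (\<lambda>k \<omega>. \<lambda>\<sigma>\<in>S. H L (Suc k) \<sigma> \<omega>) UNIV" by simp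
  then have "indep_vars (\<lambda>_. borel) (\<lambda>k \<omega>. (\<lambda>f. \<Sum>\<tau>\<in>S. e k \<tau> * (f \<tau> / sqrt c ^ Suc k)) (\<lambda>\<sigma>\<in>S. H L (Suc k) \<sigma> \<omega>)) UNIV"
    by (rule indep_vars_compose2) (intro borel_measurable_sum borel_measurable_times borel_measurable_divide measurable_component_singleton; simp)
  then have ind: "indep_vars (\<lambda>_. borel) (\<lambda>k \<omega>. \<Sum>\<tau>\<in>S. e k \<tau> * field (Suc k) \<tau> \<omega>) UNIV"
    by (simp add: scaled_field_def cong: sum.cong)
  note * = gaussian_series[OF ind linear_char(2) linear_char(1) s]
  show "AE \<omega> in M. summable (\<lambda>k. \<Sum>\<tau>\<in>S. e k \<tau> * field (Suc k) \<tau> \<omega>)"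
    "(CLINT \<omega>|M. iexp (\<Sum>k. \<Sum>\<tau>\<in>S. e k \<tau> * field (Suc k) \<tau> \<omega>)) = complex_of_real (exp (- s / 2))"
    by (rule *; simp)+
qed

section \<open>Joint law of the complete Hamiltonian and one field\<close>

definition hcov :: "(nat \<Rightarrow> real) \<Rightarrow> 'd config \<Rightarrow> 'd config \<Rightarrow> real" where
  "hcov \<beta> \<sigma> \<tau> = (\<Sum>k. \<N> * ((\<beta> (Suc k))\<^sup>2 * K (Suc k) \<sigma> \<tau>))"

context
  fixes \<beta> :: "nat \<Rightarrow> real"
  assumes \<beta>: "summable (\<lambda>k. (\<beta> (Suc k))\<^sup>2)"
begin

lemma hcov_sums:
  assumes "\<sigma> \<in> S" "\<tau> \<in> S"
  shows "(\<lambda>k. \<N> * ((\<beta> (Suc k))\<^sup>2 * K (Suc k) \<sigma> \<tau>)) sums hcov \<beta> \<sigma> \<tau>"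
proof -
  have "summable (\<lambda>k. (\<beta> (Suc k))\<^sup>2 * K (Suc k) \<sigma> \<tau>)"
  proof (rule summable_comparison_test'[OF \<beta>])
    show "norm ((\<beta> (Suc k))\<^sup>2 * K (Suc k) \<sigma> \<tau>) \<le> (\<beta> (Suc k))\<^sup>2" for k
      using mult_left_mono[OF abs_K_le_1[OF assms, of "Suc k"], of "(\<beta> (Suc k))\<^sup>2"] by (simp add: abs_mult)
  qed
  then show ?thesis unfolding hcov_def by (intro summable_sums summable_mult)
qed

lemma hcov_sym: "hcov \<beta> \<sigma> \<tau> = hcov \<beta> \<tau> \<sigma>"
  by (simp add: hcov_def overlap_kernel_sym)

lemma abs_hcov_le:
  assumes "\<sigma> \<in> S" "\<tau> \<in> S"
  shows "\<bar>hcov \<beta> \<sigma> \<tau>\<bar> \<le> hcov \<beta> \<sigma> \<sigma>"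
proof -
  have le: "\<bar>\<N> * ((\<beta> (Suc k))\<^sup>2 * K (Suc k) \<sigma> \<tau>)\<bar> \<le> \<N> * ((\<beta> (Suc k))\<^sup>2 * K (Suc k) \<sigma> \<sigma>)" for k
    using abs_K_le[OF assms, of "Suc k"] by (simp add: abs_mult mult_left_mono)
  then have "hcov \<beta> \<sigma> \<tau> \<le> hcov \<beta> \<sigma> \<sigma>" "- hcov \<beta> \<sigma> \<tau> \<le> hcov \<beta> \<sigma> \<sigma>"
    by (auto intro!: sums_le[OF _ hcov_sums[OF assms] hcov_sums[OF assms(1) assms(1)]]
        sums_le[OF _ sums_minus[OF hcov_sums[OF assms]] hcov_sums[OF assms(1) assms(1)]] simp: abs_le_iff)
  then show ?thesis by (rule abs_leI)
qed

lemma hcov_diag_le: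
  assumes "\<sigma> \<in> S"
  shows "hcov \<beta> \<sigma> \<sigma> \<le> \<N> * (\<Sum>k. (\<beta> (Suc k))\<^sup>2)"
proof (rule sums_le[OF _ hcov_sums[OF assms assms] sums_mult[OF summable_sums[OF \<beta>]]])
  show "\<N> * ((\<beta> (Suc k))\<^sup>2 * K (Suc k) \<sigma> \<sigma>) \<le> \<N> * (\<beta> (Suc k))\<^sup>2" for k
    using mult_left_mono[OF K_le_1[OF assms, of "Suc k"], of "(\<beta> (Suc k))\<^sup>2"] by (simp add: mult_left_mono)
qed

lemma hamiltonian_term: "\<beta> (Suc k) / sqrt c ^ Suc k * H L (Suc k) \<sigma> \<omega> = \<beta> (Suc k) * field (Suc k) \<sigma> \<omega>"
  by (simp add: scaled_field_def)

lemma AE_hamiltonian_summable: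
  "AE \<omega> in M. \<forall>\<sigma>\<in>S. summable (\<lambda>k. \<beta> (Suc k) * field (Suc k) \<sigma> \<omega>)"
proof (rule AE_finite_allI[OF S(1)])
  fix \<sigma> assume \<sigma>: "\<sigma> \<in> S"
  define e where "e k \<tau> = (if \<tau> = \<sigma> then \<beta> (Suc k) else 0)" for k \<tau>
  have d: "(\<Sum>\<tau>\<in>S. e k \<tau> * x \<tau>) = \<beta> (Suc k) * x \<sigma>" for k and x :: "_ \<Rightarrow> real"
    using S \<sigma> by (simp add: e_def if_distrib[of "\<lambda>x. x * _"] cong: if_cong)
  have d': "(\<Sum>\<tau>\<in>S. x \<tau> * e k \<tau>) = x \<sigma> * \<beta> (Suc k)" for k and x :: "_ \<Rightarrow> real"
    using d[of k x] by (simp add: mult.commute)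
  have "(\<lambda>k. \<N> * (\<Sum>\<sigma>\<in>S. e k \<sigma> * (\<Sum>\<tau>\<in>S. K (Suc k) \<sigma> \<tau> * e k \<tau>))) sums hcov \<beta> \<sigma> \<sigma>"
    using hcov_sums[OF \<sigma> \<sigma>] unfolding d d' by (simp add: power2_eq_square mult_ac)
  from field_series(1)[OF this] show "AE \<omega> in M. summable (\<lambda>k. \<beta> (Suc k) * field (Suc k) \<sigma> \<omega>)"
    by (simp add: d)
qed

lemma hamiltonian_measurable[measurable]:
  assumes "\<sigma> \<in> S" shows "hbar \<beta> \<sigma> \<in> borel_measurable M"
proof -
  have [measurable]: "H L (Suc k) \<sigma> \<in> borel_measurable M" for k by (rule H_square_integrable) (use assms in auto)
  show ?thesis unfolding complete_hamiltonian_def by measurable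
qed

text \<open>The field of index \<open>p\<close> occurs in the series itself, so adding
  \<open>t\<close> times it at \<sigma> only changes coefficients in one term. The mixed term
  exhibits the covariance \<open>\<beta> p * \<N> * K p \<sigma> \<tau>\<close> of
  \<open>field p \<sigma>\<close> with \<open>hbar \<beta> \<tau>\<close>.\<close>

lemma hamiltonian_char:
  assumes p: "p \<ge> 1" and \<sigma>: "\<sigma> \<in> S"
  shows "(CLINT \<omega>|M. iexp (t * field p \<sigma> \<omega> + (\<Sum>\<tau>\<in>S. a \<tau> * hbar \<beta> \<tau> \<omega>))) =
    complex_of_real (exp (- (\<N> * (t\<^sup>2 * K p \<sigma> \<sigma> + 2 * t * (\<beta> p * (\<Sum>\<tau>\<in>S. K p \<sigma> \<tau> * a \<tau>))) +
       (\<Sum>\<tau>\<in>S. a \<tau> * (\<Sum>\<rho>\<in>S. hcov \<beta> \<tau> \<rho> * a \<rho>))) / 2))"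
proof -
  obtain q where q: "p = Suc q" using p by (cases p) auto
  \<comment> \<open>Term \<open>k\<close> of the series carries the field of index
    \<open>Suc k\<close>, so the extra coefficient sits at \<open>q\<close>, the predecessor of
    \<open>p\<close>.\<close>
  define u where "u k = (if k = q then t else 0)" for k
  define e where "e k \<tau> = (if \<tau> = \<sigma> then u k else 0) + \<beta> (Suc k) * a \<tau>" for k \<tau>
  define D where "D = \<N> * (t\<^sup>2 * K p \<sigma> \<sigma> + 2 * t * (\<beta> p * (\<Sum>\<tau>\<in>S. K p \<sigma> \<tau> * a \<tau>)))"
  have "\<N> * (\<Sum>\<sigma>\<in>S. e k \<sigma> * (\<Sum>\<tau>\<in>S. K (Suc k) \<sigma> \<tau> * e k \<tau>)) =
     (if k = q then D else 0) + (\<Sum>\<tau>\<in>S. \<Sum>\<rho>\<in>S. a \<tau> * a \<rho> * (\<N> * ((\<beta> (Suc k))\<^sup>2 * K (Suc k) \<tau> \<rho>)))" for k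
  proof -
    have "(\<Sum>\<sigma>\<in>S. e k \<sigma> * (\<Sum>\<tau>\<in>S. K (Suc k) \<sigma> \<tau> * e k \<tau>)) =
       (u k)\<^sup>2 * K (Suc k) \<sigma> \<sigma> + 2 * u k * (\<Sum>i\<in>S. K (Suc k) \<sigma> i * (\<beta> (Suc k) * a i)) +
       (\<Sum>i\<in>S. \<beta> (Suc k) * a i * (\<Sum>j\<in>S. K (Suc k) i j * (\<beta> (Suc k) * a j)))"
      unfolding e_def by (rule quadratic_form_shift[OF S(1) overlap_kernel_sym \<sigma>])
    moreover have "\<N> * (\<Sum>i\<in>S. \<beta> (Suc k) * a i * (\<Sum>j\<in>S. K (Suc k) i j * (\<beta> (Suc k) * a j))) =
       (\<Sum>\<tau>\<in>S. \<Sum>\<rho>\<in>S. a \<tau> * a \<rho> * (\<N> * ((\<beta> (Suc k))\<^sup>2 * K (Suc k) \<tau> \<rho>)))"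
      unfolding sum_distrib_left by (intro sum.cong refl) (simp add: power2_eq_square mult_ac)
    moreover have "\<N> * ((u k)\<^sup>2 * K (Suc k) \<sigma> \<sigma> + 2 * u k * (\<Sum>i\<in>S. K (Suc k) \<sigma> i * (\<beta> (Suc k) * a i))) = (if k = q then D else 0)"
      by (simp add: u_def D_def q sum_distrib_left mult_ac)
    ultimately show ?thesis by (simp add: distrib_left)
  qed
  moreover have "(\<lambda>k. (if k = q then D else 0) + (\<Sum>\<tau>\<in>S. \<Sum>\<rho>\<in>S. a \<tau> * a \<rho> * (\<N> * ((\<beta> (Suc k))\<^sup>2 * K (Suc k) \<tau> \<rho>)))) sums
     (D + (\<Sum>\<tau>\<in>S. \<Sum>\<rho>\<in>S. a \<tau> * a \<rho> * hcov \<beta> \<tau> \<rho>))"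
    by (intro sums_add sums_single sums_sum sums_mult hcov_sums)
  ultimately have s: "(\<lambda>k. \<N> * (\<Sum>\<sigma>\<in>S. e k \<sigma> * (\<Sum>\<tau>\<in>S. K (Suc k) \<sigma> \<tau> * e k \<tau>))) sums
     (D + (\<Sum>\<tau>\<in>S. \<Sum>\<rho>\<in>S. a \<tau> * a \<rho> * hcov \<beta> \<tau> \<rho>))" by simp
  have m[measurable]: "field (Suc k) \<tau> \<in> borel_measurable M" if "\<tau> \<in> S" for k \<tau>
    by (rule field_measurable) (use that in auto)
  \<comment> \<open>The infinite sum splits only where the series of the Hamiltonian converge, hence
    merely almost everywhere.\<close>
  have "AE \<omega> in M. (\<Sum>k. \<Sum>\<tau>\<in>S. e k \<tau> * field (Suc k) \<tau> \<omega>) = t * field p \<sigma> \<omega> + (\<Sum>\<tau>\<in>S. a \<tau> * hbar \<beta> \<tau> \<omega>)"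
    using AE_hamiltonian_summable
  proof eventually_elim
    case (elim \<omega>)
    have "(\<Sum>\<tau>\<in>S. e k \<tau> * field (Suc k) \<tau> \<omega>) = (if k = q then t * field p \<sigma> \<omega> else 0) + (\<Sum>\<tau>\<in>S. a \<tau> * (\<beta> (Suc k) * field (Suc k) \<tau> \<omega>))" for k
    proof -
      have "(\<Sum>\<tau>\<in>S. (if \<tau> = \<sigma> then u k else 0) * field (Suc k) \<tau> \<omega>) = (if k = q then t * field p \<sigma> \<omega> else 0)"
        using S \<sigma> by (simp add: if_distrib[of "\<lambda>x. x * _"] u_def q cong: if_cong)
      then show ?thesis unfolding e_def distrib_right sum.distrib by (simp add: mult_ac)
    qed
    moreover have "(\<lambda>k. (if k = q then t * field p \<sigma> \<omega> else 0) + (\<Sum>\<tau>\<in>S. a \<tau> * (\<beta> (Suc k) * field (Suc k) \<tau> \<omega>))) sums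
       (t * field p \<sigma> \<omega> + (\<Sum>\<tau>\<in>S. a \<tau> * hbar \<beta> \<tau> \<omega>))"
      unfolding complete_hamiltonian_def hamiltonian_term
      using elim by (intro sums_add sums_single sums_sum sums_mult summable_sums) auto
    ultimately show ?case by (simp add: sums_iff)
  qed
  then have "AE \<omega> in M. iexp (t * field p \<sigma> \<omega> + (\<Sum>\<tau>\<in>S. a \<tau> * hbar \<beta> \<tau> \<omega>)) = iexp (\<Sum>k. \<Sum>\<tau>\<in>S. e k \<tau> * field (Suc k) \<tau> \<omega>)"
    by eventually_elim simp
  then have "(CLINT \<omega>|M. iexp (t * field p \<sigma> \<omega> + (\<Sum>\<tau>\<in>S. a \<tau> * hbar \<beta> \<tau> \<omega>))) = (CLINT \<omega>|M. iexp (\<Sum>k. \<Sum>\<tau>\<in>S. e k \<tau> * field (Suc k) \<tau> \<omega>))"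
  proof (rule integral_cong_AE[rotated 2])
    have [measurable]: "field p \<sigma> \<in> borel_measurable M" by (rule field_measurable[OF p \<sigma>])
    have [measurable]: "(\<lambda>\<omega>. \<Sum>\<tau>\<in>S. a \<tau> * hbar \<beta> \<tau> \<omega>) \<in> borel_measurable M"
      by (intro borel_measurable_sum borel_measurable_times hamiltonian_measurable) auto
    show "(\<lambda>\<omega>. iexp (t * field p \<sigma> \<omega> + (\<Sum>\<tau>\<in>S. a \<tau> * hbar \<beta> \<tau> \<omega>))) \<in> borel_measurable M" by measurable
    have [measurable]: "(\<lambda>\<omega>. \<Sum>\<tau>\<in>S. e k \<tau> * field (Suc k) \<tau> \<omega>) \<in> borel_measurable M" for k
      by (intro borel_measurable_sum borel_measurable_times m) auto
    show "(\<lambda>\<omega>. iexp (\<Sum>k. \<Sum>\<tau>\<in>S. e k \<tau> * field (Suc k) \<tau> \<omega>)) \<in> borel_measurable M" by measurable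
  qed
  also have "\<dots> = complex_of_real (exp (- (D + (\<Sum>\<tau>\<in>S. \<Sum>\<rho>\<in>S. a \<tau> * a \<rho> * hcov \<beta> \<tau> \<rho>)) / 2))"
    by (rule field_series(2)[OF s])
  also have "(\<Sum>\<tau>\<in>S. \<Sum>\<rho>\<in>S. a \<tau> * a \<rho> * hcov \<beta> \<tau> \<rho>) = (\<Sum>\<tau>\<in>S. a \<tau> * (\<Sum>\<rho>\<in>S. hcov \<beta> \<tau> \<rho> * a \<rho>))"
    by (simp add: sum_distrib_left mult_ac)
  finally show ?thesis by (simp only: D_def)
qed

lemma hamiltonian_only_char:
  "(CLINT \<omega>|M. iexp (\<Sum>\<tau>\<in>S. a \<tau> * hbar \<beta> \<tau> \<omega>)) =
    complex_of_real (exp (- (\<Sum>\<tau>\<in>S. a \<tau> * (\<Sum>\<rho>\<in>S. hcov \<beta> \<tau> \<rho> * a \<rho>)) / 2))"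
proof -
  obtain \<sigma> where "\<sigma> \<in> S" using S by auto
  from hamiltonian_char[of 1 \<sigma> 0 a, OF _ this] show ?thesis
    by (simp only: mult_zero_left mult_zero_right zero_power2 add_0_left add_0_right le_refl simp_thms)
qed

text \<open>The diagonal of \<open>hcov\<close> is at most \<open>\<N>\<close> times the sum of the
  squares of \<beta>, so the fluctuation is of order \<open>sqrt \<N>\<close>, negligible after
  division by the volume.\<close>

lemma log_partition_fluctuation:
  defines "F \<equiv> \<lambda>\<omega>. ln (partition_function c H L \<beta> \<omega>)"
  shows "integrable M F" "expectation (\<lambda>\<omega>. \<bar>F \<omega> - expectation F\<bar>) \<le> sqrt (\<N> * (\<Sum>k. (\<beta> (Suc k))\<^sup>2))"
proof -
  have F: "F = (\<lambda>\<omega>. log_partition S (\<lambda>\<sigma>. hbar \<beta> \<sigma> \<omega>))"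
    by (simp add: F_def partition_function_def log_partition_def)
  note * = log_partition_concentration[OF S hamiltonian_measurable hamiltonian_only_char hcov_sym abs_hcov_le hcov_diag_le]
  show "integrable M F" "expectation (\<lambda>\<omega>. \<bar>F \<omega> - expectation F\<bar>) \<le> sqrt (\<N> * (\<Sum>k. (\<beta> (Suc k))\<^sup>2))"
    unfolding F by (rule *; assumption)+
qed

end

end

section \<open>Replica averages\<close>

context spin_glass_volume
begin

lemma field_moments:
  assumes "p \<ge> 1" "\<sigma> \<in> S"
  shows "integrable M (\<lambda>\<omega>. (field p \<sigma> \<omega>)\<^sup>2)" "integrable M (field p \<sigma>)"
proof -
  show "integrable M (\<lambda>\<omega>. (field p \<sigma> \<omega>)\<^sup>2)"
    using H_square_integrable(2)[OF assms] by (simp add: scaled_field_def power_divide)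
  then show "integrable M (field p \<sigma>)"
    by (rule square_integrable_imp_integrable[OF field_measurable[OF assms]])
qed

lemma gibbs_eq_weight: "gibbs c H L \<beta> \<sigma> \<omega> = gibbs_weight S (\<lambda>\<sigma>. hbar \<beta> \<sigma> \<omega>) \<sigma>"
  by (simp add: gibbs_def gibbs_weight_def partition_function_def)

lemma gibbs_nonneg: "0 \<le> gibbs c H L \<beta> \<sigma> \<omega>"
  by (simp add: gibbs_eq_weight gibbs_weight_nonneg[OF S])

lemma gibbs_le_1: "\<sigma> \<in> S \<Longrightarrow> gibbs c H L \<beta> \<sigma> \<omega> \<le> 1"
  by (simp add: gibbs_eq_weight gibbs_weight_le_1[OF S])

lemma sum_gibbs: "(\<Sum>\<sigma>\<in>S. gibbs c H L \<beta> \<sigma> \<omega>) = 1"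
  by (simp add: gibbs_eq_weight sum_gibbs_weight[OF S])

lemma replica_in: "s \<in> {1..m} \<rightarrow>\<^sub>E S \<Longrightarrow> i \<in> {1..m} \<Longrightarrow> s i \<in> S"
  by auto

lemma prod_gibbs_le_1: "s \<in> {1..m} \<rightarrow>\<^sub>E S \<Longrightarrow> (\<Prod>i\<in>{1..m}. gibbs c H L \<beta> (s i) \<omega>) \<le> 1"
  by (intro prod_le_1 conjI gibbs_nonneg gibbs_le_1) auto

lemma prod_gibbs_nonneg: "0 \<le> (\<Prod>i\<in>{1..m}. gibbs c H L \<beta> (s i) \<omega>)"
  by (intro prod_nonneg gibbs_nonneg)

section \<open>Sums over replicas and quenched averages\<close>

lemma sum_replicas_Suc:
  fixes G :: "(nat \<Rightarrow> 'd config) \<Rightarrow> real"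
  shows "(\<Sum>s\<in>{1..Suc m} \<rightarrow>\<^sub>E S. G s) = (\<Sum>s\<in>{1..m} \<rightarrow>\<^sub>E S. \<Sum>\<tau>\<in>S. G (s(Suc m := \<tau>)))"
proof -
  have eq: "{1..Suc m} = insert (Suc m) {1..m}" by auto
  have "(\<Sum>s\<in>{1..Suc m} \<rightarrow>\<^sub>E S. G s) = (\<Sum>(\<tau>, s)\<in>S \<times> ({1..m} \<rightarrow>\<^sub>E S). G (s(Suc m := \<tau>)))"
    unfolding eq PiE_insert_eq
    by (subst sum.reindex[OF inj_combinator[of "Suc m" "{1..m}" "\<lambda>_. S"]]) (auto simp: case_prod_beta')
  also have "\<dots> = (\<Sum>s\<in>{1..m} \<rightarrow>\<^sub>E S. \<Sum>\<tau>\<in>S. G (s(Suc m := \<tau>)))"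
    by (subst sum.swap) (simp add: sum.cartesian_product)
  finally show ?thesis .
qed

lemma prod_replicas_Suc: "(\<Prod>i\<in>{1..Suc m}. h ((s(Suc m := \<tau>)) i)) = (\<Prod>i\<in>{1..m}. h (s i)) * (h \<tau> :: real)"
proof -
  have "(\<Prod>i\<in>{1..Suc m}. h ((s(Suc m := \<tau>)) i)) = h \<tau> * (\<Prod>i\<in>{1..m}. h ((s(Suc m := \<tau>)) i))"
    by (simp add: prod.atLeast1_atMost_eq atMost_Suc)
  also have "(\<Prod>i\<in>{1..m}. h ((s(Suc m := \<tau>)) i)) = (\<Prod>i\<in>{1..m}. h (s i))" by (rule prod.cong) auto
  finally show ?thesis by simp
qed

text \<open>The sum factorises over the replicas, and every factor other than that of
  \<open>j\<close> is the total mass 1 of the Gibbs measure.\<close>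

lemma sum_replicas_coordinate:
  fixes m :: nat
  assumes j: "j \<in> {1..m}"
  shows "(\<Sum>s\<in>{1..m} \<rightarrow>\<^sub>E S. \<phi> (s j) * (\<Prod>i\<in>{1..m}. gibbs c H L \<beta> (s i) \<omega>)) = (\<Sum>\<sigma>\<in>S. \<phi> \<sigma> * gibbs c H L \<beta> \<sigma> \<omega>)"
proof -
  have f: "\<phi> (s j) * (\<Prod>i\<in>{1..m}. gibbs c H L \<beta> (s i) \<omega>) = (\<Prod>i\<in>{1..m}. (if i = j then \<phi> (s i) else 1) * gibbs c H L \<beta> (s i) \<omega>)" for s
    unfolding prod.distrib using j by (subst prod.delta) auto
  have "(\<Sum>s\<in>{1..m} \<rightarrow>\<^sub>E S. \<phi> (s j) * (\<Prod>i\<in>{1..m}. gibbs c H L \<beta> (s i) \<omega>)) =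
      (\<Prod>i\<in>{1..m}. \<Sum>\<sigma>\<in>S. (if i = j then \<phi> \<sigma> else 1) * gibbs c H L \<beta> \<sigma> \<omega>)"
    unfolding f using S by (subst prod_sum_PiE) auto
  also have "\<dots> = (\<Prod>i\<in>{1..m}. if i = j then (\<Sum>\<sigma>\<in>S. \<phi> \<sigma> * gibbs c H L \<beta> \<sigma> \<omega>) else 1)"
    by (rule prod.cong) (auto simp: sum_gibbs)
  also have "\<dots> = (\<Sum>\<sigma>\<in>S. \<phi> \<sigma> * gibbs c H L \<beta> \<sigma> \<omega>)" using j by (simp add: prod.delta)
  finally show ?thesis .
qed

context
  fixes \<beta> :: "nat \<Rightarrow> real"
  assumes \<beta>: "summable (\<lambda>k. (\<beta> (Suc k))\<^sup>2)"
begin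

abbreviation "Q \<equiv> quenched M c H L \<beta>"
abbreviation "g \<equiv> gibbs c H L \<beta>"

lemma gibbs_measurable[measurable]: "\<sigma> \<in> S \<Longrightarrow> g \<sigma> \<in> borel_measurable M"
  unfolding gibbs_eq_weight[abs_def]
  by (rule measurable_gibbs_weight[OF S]) (use hamiltonian_measurable[OF \<beta>] in auto)

lemma prod_gibbs_measurable:
  assumes "s \<in> {1..m} \<rightarrow>\<^sub>E S" shows "(\<lambda>\<omega>. \<Prod>i\<in>{1..m}. g (s i) \<omega>) \<in> borel_measurable M"
  by (intro borel_measurable_prod gibbs_measurable) (use assms in auto)

lemma integrable_gibbs_prod:
  assumes "s \<in> {1..m} \<rightarrow>\<^sub>E S" and "integrable M h"
  shows "integrable M (\<lambda>\<omega>. h \<omega> * (\<Prod>i\<in>{1..m}. g (s i) \<omega>))"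
proof (rule Bochner_Integration.integrable_bound[OF assms(2)])
  show "AE \<omega> in M. norm (h \<omega> * (\<Prod>i\<in>{1..m}. g (s i) \<omega>)) \<le> norm (h \<omega>)"
    using prod_gibbs_le_1[OF assms(1)]
    by (intro AE_I2) (simp add: abs_mult mult_left_le abs_of_nonneg[OF prod_gibbs_nonneg])
qed (intro borel_measurable_times prod_gibbs_measurable borel_measurable_integrable assms)

lemma quenched_eq: "Q m F = (\<Sum>s\<in>{1..m} \<rightarrow>\<^sub>E S. F s * expectation (\<lambda>\<omega>. \<Prod>i\<in>{1..m}. g (s i) \<omega>))"
proof -
  have "integrable M (\<lambda>\<omega>. \<Prod>i\<in>{1..m}. g (s i) \<omega>)" if "s \<in> {1..m} \<rightarrow>\<^sub>E S" for s
    using integrable_gibbs_prod[OF that, of "\<lambda>_. 1"] by simp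
  then show ?thesis unfolding quenched_def random_gibbs_state_def by simp
qed

lemma quenched_Suc:
  "Q (Suc m) G = (\<Sum>s\<in>{1..m} \<rightarrow>\<^sub>E S. \<Sum>\<tau>\<in>S. G (s(Suc m := \<tau>)) * expectation (\<lambda>\<omega>. (\<Prod>i\<in>{1..m}. g (s i) \<omega>) * g \<tau> \<omega>))"
  unfolding quenched_eq sum_replicas_Suc prod_replicas_Suc[of "\<lambda>\<sigma>. g \<sigma> _"] ..

lemma quenched_cong: "(\<And>s. s \<in> {1..m} \<rightarrow>\<^sub>E S \<Longrightarrow> F s = G s) \<Longrightarrow> Q m F = Q m G"
  unfolding quenched_eq by (rule sum.cong) auto

lemma quenched_add: "Q m (\<lambda>s. F s + G s) = Q m F + Q m G"
  by (simp add: quenched_eq distrib_right sum.distrib)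

lemma quenched_cmult: "Q m (\<lambda>s. a * F s) = a * Q m F"
  by (simp add: quenched_eq sum_distrib_left mult.assoc)

lemma quenched_diff: "Q m (\<lambda>s. F s - G s) = Q m F - Q m G"
  by (simp add: quenched_eq left_diff_distrib sum_subtractf)

lemma quenched_sum: "Q m (\<lambda>s. \<Sum>i\<in>A. F i s) = (\<Sum>i\<in>A. Q m (F i))"
  unfolding quenched_eq sum_distrib_right by (rule sum.swap)

text \<open>A replica on which \<open>F\<close> does not depend sums out. This brings averages over
  different numbers of replicas to a common form.\<close>

lemma quenched_marginal:
  assumes "\<And>s \<tau>. F (s(Suc m := \<tau>)) = F s"
  shows "Q (Suc m) F = Q m F"
proof -
  have "(\<Sum>\<tau>\<in>S. F s * expectation (\<lambda>\<omega>. (\<Prod>i\<in>{1..m}. g (s i) \<omega>) * g \<tau> \<omega>)) = F s * expectation (\<lambda>\<omega>. \<Prod>i\<in>{1..m}. g (s i) \<omega>)"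
    if s: "s \<in> {1..m} \<rightarrow>\<^sub>E S" for s
  proof -
    have i: "integrable M (\<lambda>\<omega>. (\<Prod>i\<in>{1..m}. g (s i) \<omega>) * g \<tau> \<omega>)" if "\<tau> \<in> S" for \<tau>
    proof -
      have "integrable M (g \<tau>)"
        by (rule integrable_const_bound[where B=1]) (use that gibbs_nonneg gibbs_le_1 in auto)
      from integrable_gibbs_prod[OF s this] show ?thesis by (simp add: mult.commute)
    qed
    have "(\<Sum>\<tau>\<in>S. F s * expectation (\<lambda>\<omega>. (\<Prod>i\<in>{1..m}. g (s i) \<omega>) * g \<tau> \<omega>)) =
      F s * expectation (\<lambda>\<omega>. \<Sum>\<tau>\<in>S. (\<Prod>i\<in>{1..m}. g (s i) \<omega>) * g \<tau> \<omega>)"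
      using i by (simp add: sum_distrib_left)
    then show ?thesis by (simp add: sum_gibbs flip: sum_distrib_left)
  qed
  then show ?thesis unfolding quenched_Suc quenched_eq[of m] assms by simp
qed

text \<open>In coordinate \<tau> of the energy vector, a product of \<open>m\<close> Gibbs weights
  has as derivative itself times \<open>m\<close> times the weight of \<tau> minus the number of
  replicas equal to \<tau>. The count reproduces overlaps with the given replicas; the extra weight
  is the law of a new one.\<close>

lemma gibbs_integration_by_parts:
  assumes p: "p \<ge> 1" and \<sigma>: "\<sigma> \<in> S" and s: "s \<in> {1..m} \<rightarrow>\<^sub>E S"
  shows "expectation (\<lambda>\<omega>. field p \<sigma> \<omega> * (\<Prod>i\<in>{1..m}. g (s i) \<omega>)) =
    - (\<beta> p * \<N>) * ((\<Sum>i\<in>{1..m}. K p \<sigma> (s i) * expectation (\<lambda>\<omega>. \<Prod>i\<in>{1..m}. g (s i) \<omega>))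
      - real m * (\<Sum>\<tau>\<in>S. K p \<sigma> \<tau> * expectation (\<lambda>\<omega>. (\<Prod>i\<in>{1..m}. g (s i) \<omega>) * g \<tau> \<omega>)))"
proof -
  define v where "v = \<N> * K p \<sigma> \<sigma>"
  \<comment> \<open>Covariances with the energies divided by the variance of the field, up to the
    common factor \<open>\<N>\<close>. When \<open>K p \<sigma> \<sigma> = 0\<close> the whole row
    of \<open>K\<close> vanishes, and division by zero gives 0.\<close>
  define b where "b \<tau> = \<beta> p * K p \<sigma> \<tau> / K p \<sigma> \<sigma>" for \<tau>
  \<comment> \<open>In exponential form the product of weights is differentiated without a product
    rule.\<close>
  define G where "G x = exp (- (\<Sum>i\<in>{1..m}. x (s i)) - real m * log_partition S x)" for x
  define G' where "G' \<tau> x = G x * (real m * gibbs_weight S x \<tau> - (\<Sum>i\<in>{1..m}. if s i = \<tau> then 1 else 0))" for \<tau> x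
  have sS: "s i \<in> S" if "i \<in> {1..m}" for i using s that by auto
  have vb: "v * b \<tau> = \<beta> p * \<N> * K p \<sigma> \<tau>" if "\<tau> \<in> S" for \<tau>
    using abs_K_le[OF \<sigma> that, of p] by (cases "K p \<sigma> \<sigma> = 0") (auto simp: v_def b_def)
  have G_prod: "G x = (\<Prod>i\<in>{1..m}. gibbs_weight S x (s i))" for x
  proof -
    have "gibbs_weight S x \<tau> = exp (- x \<tau> - log_partition S x)" for \<tau>
      using partition_pos[OF S, of x] by (simp add: gibbs_weight_def log_partition_def exp_diff)
    then show ?thesis by (simp add: G_def exp_sum[symmetric] sum_subtractf sum_negf)
  qed
  have G01: "0 \<le> G x" "G x \<le> 1" for x
    unfolding G_prod by (intro prod_nonneg prod_le_1 conjI gibbs_weight_nonneg[OF S] gibbs_weight_le_1[OF S] sS; assumption)+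
  have G'_le: "\<bar>G' \<tau> x\<bar> \<le> real m" if \<tau>: "\<tau> \<in> S" for \<tau> x
  proof -
    define w where "w = gibbs_weight S x \<tau>"
    have w: "0 \<le> w" "w \<le> 1" using gibbs_weight_nonneg[OF S] gibbs_weight_le_1[OF S \<tau>] by (auto simp: w_def)
    have "real m * w - (\<Sum>i\<in>{1..m}. if s i = \<tau> then 1 else 0) = (\<Sum>i\<in>{1..m}. w - (if s i = \<tau> then 1 else 0))"
      by (simp add: sum_subtractf)
    also have "\<bar>\<dots>\<bar> \<le> (\<Sum>i\<in>{1..m}. \<bar>w - (if s i = \<tau> then 1 else 0)\<bar>)" by (rule sum_abs)
    also have "\<dots> \<le> (\<Sum>i\<in>{1..m}. 1)" by (rule sum_mono) (use w in \<open>auto simp: abs_le_iff\<close>)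
    finally have "\<bar>real m * w - (\<Sum>i\<in>{1..m}. if s i = \<tau> then 1 else 0)\<bar> \<le> real m" by simp
    then show ?thesis
      using mult_mono[OF G01(2)[of x]] G01(1)[of x] unfolding G'_def abs_mult w_def[symmetric] by fastforce
  qed
  have cm: "(\<lambda>x. x \<tau>) \<in> borel_measurable (PiM S (\<lambda>_. borel :: real measure))" if "\<tau> \<in> S" for \<tau>
    using that by (rule measurable_component_singleton)
  have lm[measurable]: "log_partition S \<in> borel_measurable (PiM S (\<lambda>_. borel))"
    by (rule measurable_log_partition[OF S cm])
  have gm[measurable]: "(\<lambda>x. gibbs_weight S x \<tau>) \<in> borel_measurable (PiM S (\<lambda>_. borel))" if "\<tau> \<in> S" for \<tau>
    by (rule measurable_gibbs_weight[OF S cm that])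
  have Gm[measurable]: "G \<in> borel_measurable (PiM S (\<lambda>_. borel))"
  proof -
    have [measurable]: "(\<lambda>x. \<Sum>i\<in>{1..m}. x (s i)) \<in> borel_measurable (PiM S (\<lambda>_. borel :: real measure))"
      by (intro borel_measurable_sum cm sS)
    show ?thesis unfolding G_def by measurable
  qed
  have ibp: "expectation (\<lambda>\<omega>. field p \<sigma> \<omega> * G (\<lambda>\<tau>\<in>S. hbar \<beta> \<tau> \<omega>)) = v * (\<Sum>\<tau>\<in>S. b \<tau> * expectation (\<lambda>\<omega>. G' \<tau> (\<lambda>\<tau>\<in>S. hbar \<beta> \<tau> \<omega>)))"
  \<comment> \<open>\<open>G\<close> is bounded by 1 and its derivatives by \<open>m\<close>, which
    accounts for the growth constants \<open>1 + real m\<close> and 0.\<close>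
  proof (rule gaussian_integration_by_parts[where A="1 + real m" and B=0, OF S(1)])
    show "0 \<le> v" using K_diag_nonneg[OF \<sigma>] by (simp add: v_def)
    show "hbar \<beta> \<tau> \<in> borel_measurable M" if "\<tau> \<in> S" for \<tau> by (rule hamiltonian_measurable[OF \<beta> that])
    show "field p \<sigma> \<in> borel_measurable M" by (rule field_measurable[OF p \<sigma>])
    show "integrable M (\<lambda>\<omega>. (field p \<sigma> \<omega>)\<^sup>2)" by (rule field_moments[OF p \<sigma>])
    show "integrable M (\<lambda>\<omega>. (hbar \<beta> \<tau> \<omega>)\<^sup>2)" if \<tau>: "\<tau> \<in> S" for \<tau>
    proof (rule char_gaussian_moments(2)[OF hamiltonian_measurable[OF \<beta> \<tau>], of "hcov \<beta> \<tau> \<tau>"])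
      show "0 \<le> hcov \<beta> \<tau> \<tau>" using abs_hcov_le[OF \<beta> \<tau> \<tau>] by linarith
      fix t
      have 1: "(\<Sum>\<rho>\<in>S. (if \<rho> = \<tau> then t else 0) * x \<rho>) = t * x \<tau>" for x :: "'d config \<Rightarrow> real"
        using S \<tau> by (simp add: if_distrib[of "\<lambda>x. x * _"] cong: if_cong)
      have 2: "(\<Sum>\<rho>\<in>S. x \<rho> * (if \<rho> = \<tau> then t else 0)) = x \<tau> * t" for x :: "'d config \<Rightarrow> real"
        using 1[of x] by (simp add: mult.commute)
      show "(CLINT \<omega>|M. iexp (t * hbar \<beta> \<tau> \<omega>)) = exp (- (hcov \<beta> \<tau> \<tau> * t\<^sup>2) / 2)"
        using hamiltonian_only_char[OF \<beta>, of "\<lambda>\<rho>. if \<rho> = \<tau> then t else 0"]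
        unfolding 1 2 by (simp add: power2_eq_square mult_ac)
    qed
    fix t and a :: "'d config \<Rightarrow> real"
    have "v * (\<Sum>\<tau>\<in>S. a \<tau> * b \<tau>) = (\<Sum>\<tau>\<in>S. a \<tau> * (v * b \<tau>))"
      by (simp add: sum_distrib_left mult_ac)
    also have "\<dots> = \<N> * (\<beta> p * (\<Sum>\<tau>\<in>S. K p \<sigma> \<tau> * a \<tau>))"
      unfolding sum_distrib_left by (intro sum.cong refl) (simp add: vb)
    finally have "v * (t\<^sup>2 + 2 * t * (\<Sum>\<tau>\<in>S. a \<tau> * b \<tau>)) = \<N> * (t\<^sup>2 * K p \<sigma> \<sigma> + 2 * t * (\<beta> p * (\<Sum>\<tau>\<in>S. K p \<sigma> \<tau> * a \<tau>)))"
      by (simp add: distrib_left v_def mult_ac)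
    then have v_eq: "- v * (t\<^sup>2 + 2 * t * (\<Sum>\<tau>\<in>S. a \<tau> * b \<tau>)) = - (\<N> * (t\<^sup>2 * K p \<sigma> \<sigma> + 2 * t * (\<beta> p * (\<Sum>\<tau>\<in>S. K p \<sigma> \<tau> * a \<tau>))))"
      by simp
    show "(CLINT \<omega>|M. iexp (t * field p \<sigma> \<omega> + (\<Sum>\<tau>\<in>S. a \<tau> * hbar \<beta> \<tau> \<omega>))) =
        complex_of_real (exp (- v * (t\<^sup>2 + 2 * t * (\<Sum>\<tau>\<in>S. a \<tau> * b \<tau>)) / 2)) * (CLINT \<omega>|M. iexp (\<Sum>\<tau>\<in>S. a \<tau> * hbar \<beta> \<tau> \<omega>))"
      unfolding hamiltonian_char[OF \<beta> p \<sigma>] hamiltonian_only_char[OF \<beta>] v_eq of_real_mult[symmetric] exp_add[symmetric]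
      by (simp add: diff_divide_distrib add_divide_distrib)
  next
    fix y d :: "'d config \<Rightarrow> real" and r :: real
    let ?z = "\<lambda>r. \<lambda>\<tau>\<in>S. y \<tau> + r * d \<tau>"
    have dz: "((\<lambda>r. ?z r \<tau>) has_real_derivative d \<tau>) (at r)" if "\<tau> \<in> S" for \<tau>
      using that by (auto intro!: derivative_eq_intros)
    have "((\<lambda>r. G (?z r)) has_real_derivative G (?z r) *
       (- (\<Sum>i\<in>{1..m}. d (s i)) - real m * (- (\<Sum>\<tau>\<in>S. gibbs_weight S (?z r) \<tau> * d \<tau>)))) (at r)"
      unfolding G_def
      by (intro DERIV_fun_exp DERIV_diff DERIV_minus DERIV_sum DERIV_cmult log_partition_has_derivative[OF S] dz sS)
    moreover have "(\<Sum>\<tau>\<in>S. d \<tau> * G' \<tau> x) = G x *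
       (- (\<Sum>i\<in>{1..m}. d (s i)) - real m * (- (\<Sum>\<tau>\<in>S. gibbs_weight S x \<tau> * d \<tau>)))" for x
    proof -
      \<comment> \<open>A configuration taken by several replicas is counted with its
        multiplicity.\<close>
      have "(\<Sum>\<tau>\<in>S. d \<tau> * (\<Sum>i\<in>{1..m}. if s i = \<tau> then 1 else 0)) = (\<Sum>i\<in>{1..m}. \<Sum>\<tau>\<in>S. if s i = \<tau> then d \<tau> else 0)"
        unfolding sum_distrib_left by (subst sum.swap) (intro sum.cong refl; simp)
      also have "\<dots> = (\<Sum>i\<in>{1..m}. d (s i))"
        using S sS by (intro sum.cong refl) (simp add: sum.delta')
      finally have 1: "(\<Sum>\<tau>\<in>S. d \<tau> * (\<Sum>i\<in>{1..m}. if s i = \<tau> then 1 else 0)) = (\<Sum>i\<in>{1..m}. d (s i))" .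
      have "(\<Sum>\<tau>\<in>S. d \<tau> * G' \<tau> x) = G x * (real m * (\<Sum>\<tau>\<in>S. gibbs_weight S x \<tau> * d \<tau>) - (\<Sum>\<tau>\<in>S. d \<tau> * (\<Sum>i\<in>{1..m}. if s i = \<tau> then 1 else 0)))"
        unfolding sum_distrib_left[of "real m"] sum_subtractf[symmetric] sum_distrib_left[of "G x"] G'_def
        by (intro sum.cong refl) (simp add: right_diff_distrib mult_ac)
      then show ?thesis unfolding 1 by (simp add: algebra_simps)
    qed
    ultimately show "((\<lambda>r. G (?z r)) has_real_derivative (\<Sum>\<tau>\<in>S. d \<tau> * G' \<tau> (?z r))) (at r)" by simp
  next
    fix \<tau> and y d :: "'d config \<Rightarrow> real"
    assume \<tau>: "\<tau> \<in> S"
    have cz: "continuous_on UNIV (\<lambda>r. (\<lambda>\<tau>\<in>S. y \<tau> + r * d \<tau>) \<tau>)" if "\<tau> \<in> S" for \<tau>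
      using that by (auto intro!: continuous_intros)
    show "continuous_on UNIV (\<lambda>r. G' \<tau> (\<lambda>\<tau>\<in>S. y \<tau> + r * d \<tau>))"
      unfolding G'_def G_def
      by (intro continuous_intros continuous_on_gibbs_weight[OF S] continuous_on_log_partition[OF S] cz \<tau> sS)
  next
    show "G \<in> borel_measurable (PiM S (\<lambda>_. borel))" by (rule Gm)
    show "G' \<tau> \<in> borel_measurable (PiM S (\<lambda>_. borel))" if "\<tau> \<in> S" for \<tau>
      unfolding G'_def using that by measurable
    show "\<bar>G x\<bar> \<le> 1 + real m + 0 * (\<Sum>i\<in>S. \<bar>x i\<bar>)" for x using G01[of x] by simp
    show "\<bar>G' \<tau> x\<bar> \<le> 1 + real m + 0 * (\<Sum>i\<in>S. \<bar>x i\<bar>)" if "\<tau> \<in> S" for \<tau> x using G'_le[OF that, of x] by simp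
  qed auto
  have G_gibbs: "G (\<lambda>\<tau>\<in>S. hbar \<beta> \<tau> \<omega>) = (\<Prod>i\<in>{1..m}. g (s i) \<omega>)" for \<omega>
    unfolding G_prod gibbs_eq_weight by (intro prod.cong refl gibbs_weight_cong[OF S]) (use sS in auto)
  have G'_gibbs: "G' \<tau> (\<lambda>\<tau>\<in>S. hbar \<beta> \<tau> \<omega>) = (\<Prod>i\<in>{1..m}. g (s i) \<omega>) * (real m * g \<tau> \<omega> - (\<Sum>i\<in>{1..m}. if s i = \<tau> then 1 else 0))"
    if "\<tau> \<in> S" for \<tau> \<omega>
    unfolding G'_def using G_gibbs[of \<omega>] gibbs_weight_cong[OF S, of "\<lambda>\<tau>\<in>S. hbar \<beta> \<tau> \<omega>" "\<lambda>\<tau>. hbar \<beta> \<tau> \<omega>" \<tau>] that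
    by (simp add: gibbs_eq_weight)
  let ?E = "expectation (\<lambda>\<omega>. \<Prod>i\<in>{1..m}. g (s i) \<omega>)"
  let ?E' = "\<lambda>\<tau>. expectation (\<lambda>\<omega>. (\<Prod>i\<in>{1..m}. g (s i) \<omega>) * g \<tau> \<omega>)"
  have EG': "expectation (\<lambda>\<omega>. G' \<tau> (\<lambda>\<tau>\<in>S. hbar \<beta> \<tau> \<omega>)) = real m * ?E' \<tau> - (\<Sum>i\<in>{1..m}. if s i = \<tau> then ?E else 0)" if \<tau>: "\<tau> \<in> S" for \<tau>
  proof -
    have "integrable M (\<lambda>\<omega>. \<Prod>i\<in>{1..m}. g (s i) \<omega>)" using integrable_gibbs_prod[OF s, of "\<lambda>_. 1"] by simp
    moreover have "integrable M (\<lambda>\<omega>. (\<Prod>i\<in>{1..m}. g (s i) \<omega>) * g \<tau> \<omega>)"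
    proof -
      have "integrable M (g \<tau>)"
        by (rule integrable_const_bound[where B=1]) (use \<tau> gibbs_nonneg gibbs_le_1 in auto)
      from integrable_gibbs_prod[OF s this] show ?thesis by (simp add: mult.commute)
    qed
    moreover have "(\<Prod>i\<in>{1..m}. g (s i) \<omega>) * (real m * g \<tau> \<omega> - (\<Sum>i\<in>{1..m}. if s i = \<tau> then 1 else 0)) =
      real m * ((\<Prod>i\<in>{1..m}. g (s i) \<omega>) * g \<tau> \<omega>) - (\<Sum>i\<in>{1..m}. if s i = \<tau> then 1 else 0) * (\<Prod>i\<in>{1..m}. g (s i) \<omega>)" for \<omega>
      by (simp add: right_diff_distrib mult_ac)
    ultimately have "expectation (\<lambda>\<omega>. G' \<tau> (\<lambda>\<tau>\<in>S. hbar \<beta> \<tau> \<omega>)) = real m * ?E' \<tau> - (\<Sum>i\<in>{1..m}. if s i = \<tau> then 1 else 0) * ?E"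
      unfolding G'_gibbs[OF \<tau>] by simp
    then show ?thesis by (simp add: sum_distrib_right if_distrib[of "\<lambda>x. x * _"] cong: if_cong)
  qed
  have "v * (\<Sum>\<tau>\<in>S. b \<tau> * expectation (\<lambda>\<omega>. G' \<tau> (\<lambda>\<tau>\<in>S. hbar \<beta> \<tau> \<omega>))) =
     (\<Sum>\<tau>\<in>S. (v * b \<tau>) * expectation (\<lambda>\<omega>. G' \<tau> (\<lambda>\<tau>\<in>S. hbar \<beta> \<tau> \<omega>)))"
    by (simp add: sum_distrib_left mult.assoc)
  also have "\<dots> = (\<Sum>\<tau>\<in>S. (\<beta> p * \<N>) * (real m * (K p \<sigma> \<tau> * ?E' \<tau>) - (\<Sum>i\<in>{1..m}. if s i = \<tau> then K p \<sigma> \<tau> * ?E else 0)))"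
    by (intro sum.cong refl) (simp add: vb EG' right_diff_distrib sum_distrib_left if_distrib mult_ac cong: if_cong)
  also have "\<dots> = (\<beta> p * \<N>) * (real m * (\<Sum>\<tau>\<in>S. K p \<sigma> \<tau> * ?E' \<tau>) - (\<Sum>\<tau>\<in>S. \<Sum>i\<in>{1..m}. if s i = \<tau> then K p \<sigma> \<tau> * ?E else 0))"
    unfolding sum_distrib_left[symmetric] sum_subtractf ..
  also have "(\<Sum>\<tau>\<in>S. \<Sum>i\<in>{1..m}. if s i = \<tau> then K p \<sigma> \<tau> * ?E else 0) = (\<Sum>i\<in>{1..m}. K p \<sigma> (s i) * ?E)"
    using S sS by (subst sum.swap) (intro sum.cong refl, simp add: sum.delta')
  also have "(\<beta> p * \<N>) * (real m * (\<Sum>\<tau>\<in>S. K p \<sigma> \<tau> * ?E' \<tau>) - (\<Sum>i\<in>{1..m}. K p \<sigma> (s i) * ?E)) =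
    - (\<beta> p * \<N>) * ((\<Sum>i\<in>{1..m}. K p \<sigma> (s i) * ?E) - real m * (\<Sum>\<tau>\<in>S. K p \<sigma> \<tau> * ?E' \<tau>))"
    by (simp add: right_diff_distrib)
  finally have R: "v * (\<Sum>\<tau>\<in>S. b \<tau> * expectation (\<lambda>\<omega>. G' \<tau> (\<lambda>\<tau>\<in>S. hbar \<beta> \<tau> \<omega>))) =
    - (\<beta> p * \<N>) * ((\<Sum>i\<in>{1..m}. K p \<sigma> (s i) * ?E) - real m * (\<Sum>\<tau>\<in>S. K p \<sigma> \<tau> * ?E' \<tau>))" .
  show ?thesis using trans[OF ibp R] unfolding G_gibbs .
qed

end

end

section \<open>Energy covariances and dependence on one parameter\<close>

lemma summable_fun_upd:
  fixes \<beta> :: "nat \<Rightarrow> real"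
  assumes "summable (\<lambda>k. (\<beta> (Suc k))\<^sup>2)"
  shows "summable (\<lambda>k. ((\<beta>(p := x)) (Suc k))\<^sup>2)"
proof -
  have "eventually (\<lambda>k. ((\<beta>(p := x)) (Suc k))\<^sup>2 = (\<beta> (Suc k))\<^sup>2) sequentially"
    using eventually_ge_at_top[of p] by eventually_elim auto
  then show ?thesis using assms summable_cong by fast
qed

context spin_glass_volume
begin

lemma sum_replicas_one:
  assumes "m \<ge> (1::nat)" shows "(\<Sum>s\<in>{1..m} \<rightarrow>\<^sub>E S. \<Prod>i\<in>{1..m}. gibbs c H L \<beta> (s i) \<omega>) = 1"
  using sum_replicas_coordinate[of 1 m "\<lambda>_. 1" \<beta> \<omega>] assms by (simp add: sum_gibbs)

context
  fixes \<beta> :: "nat \<Rightarrow> real"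
  assumes \<beta>: "summable (\<lambda>k. (\<beta> (Suc k))\<^sup>2)"
begin

lemma integrable_gibbs_mult:
  assumes "\<sigma> \<in> S" "integrable M h" shows "integrable M (\<lambda>\<omega>. g \<beta> \<sigma> \<omega> * h \<omega>)"
proof (rule Bochner_Integration.integrable_bound[OF assms(2)])
  show "AE \<omega> in M. norm (g \<beta> \<sigma> \<omega> * h \<omega>) \<le> norm (h \<omega>)"
    using gibbs_le_1[OF assms(1)] gibbs_nonneg by (intro AE_I2) (simp add: abs_mult mult_left_le_one_le)
qed (intro borel_measurable_times gibbs_measurable[OF \<beta>] borel_measurable_integrable assms)

lemma quenched_const: "m \<ge> 1 \<Longrightarrow> Q \<beta> m (\<lambda>_. a) = a"
  using prob_space sum_replicas_one[of m \<beta>]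
  by (simp add: quenched_def random_gibbs_state_def flip: sum_distrib_left)

text \<open>Weighting the identity for a fixed list of configurations by \<open>F\<close> turns the
  sum over \<tau> into an average over replica \<open>Suc m\<close>. The term \<open>i = j\<close>
  is a self-overlap and still present.\<close>

lemma replica_energy:
  assumes p: "p \<ge> 1" and j: "j \<in> {1..m}" and F: "\<And>s \<tau>. F (s(Suc m := \<tau>)) = F s"
  shows "(\<Sum>s\<in>{1..m} \<rightarrow>\<^sub>E S. F s * expectation (\<lambda>\<omega>. field p (s j) \<omega> * (\<Prod>i\<in>{1..m}. g \<beta> (s i) \<omega>))) =
    - (\<beta> p * \<N>) * ((\<Sum>i\<in>{1..m}. Q \<beta> m (\<lambda>s. F s * K p (s j) (s i))) - real m * Q \<beta> (Suc m) (\<lambda>s. F s * K p (s j) (s (Suc m))))"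
proof -
  let ?E = "\<lambda>s. expectation (\<lambda>\<omega>. \<Prod>i\<in>{1..m}. g \<beta> (s i) \<omega>)"
  let ?E' = "\<lambda>s \<tau>. expectation (\<lambda>\<omega>. (\<Prod>i\<in>{1..m}. g \<beta> (s i) \<omega>) * g \<beta> \<tau> \<omega>)"
  have "(\<Sum>s\<in>{1..m} \<rightarrow>\<^sub>E S. F s * expectation (\<lambda>\<omega>. field p (s j) \<omega> * (\<Prod>i\<in>{1..m}. g \<beta> (s i) \<omega>))) =
    (\<Sum>s\<in>{1..m} \<rightarrow>\<^sub>E S. - (\<beta> p * \<N>) * ((\<Sum>i\<in>{1..m}. F s * K p (s j) (s i) * ?E s) - real m * (\<Sum>\<tau>\<in>S. F s * K p (s j) \<tau> * ?E' s \<tau>)))"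
  proof (rule sum.cong[OF refl])
    fix s assume s: "s \<in> {1..m} \<rightarrow>\<^sub>E S"
    show "F s * expectation (\<lambda>\<omega>. field p (s j) \<omega> * (\<Prod>i\<in>{1..m}. g \<beta> (s i) \<omega>)) =
      - (\<beta> p * \<N>) * ((\<Sum>i\<in>{1..m}. F s * K p (s j) (s i) * ?E s) - real m * (\<Sum>\<tau>\<in>S. F s * K p (s j) \<tau> * ?E' s \<tau>))"
      unfolding gibbs_integration_by_parts[OF \<beta> p replica_in[OF s j] s] mult.assoc[of "F s"] sum_distrib_left[symmetric]
      by (simp add: algebra_simps)
  qed
  also have "\<dots> = - (\<beta> p * \<N>) * ((\<Sum>s\<in>{1..m} \<rightarrow>\<^sub>E S. \<Sum>i\<in>{1..m}. F s * K p (s j) (s i) * ?E s) -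
      real m * (\<Sum>s\<in>{1..m} \<rightarrow>\<^sub>E S. \<Sum>\<tau>\<in>S. F s * K p (s j) \<tau> * ?E' s \<tau>))"
    unfolding sum_distrib_left[symmetric] sum_subtractf ..
  also have "(\<Sum>s\<in>{1..m} \<rightarrow>\<^sub>E S. \<Sum>i\<in>{1..m}. F s * K p (s j) (s i) * ?E s) = (\<Sum>i\<in>{1..m}. Q \<beta> m (\<lambda>s. F s * K p (s j) (s i)))"
    unfolding quenched_eq[OF \<beta>] by (rule sum.swap)
  also have "(\<Sum>s\<in>{1..m} \<rightarrow>\<^sub>E S. \<Sum>\<tau>\<in>S. F s * K p (s j) \<tau> * ?E' s \<tau>) = Q \<beta> (Suc m) (\<lambda>s. F s * K p (s j) (s (Suc m)))"
    unfolding quenched_Suc[OF \<beta>] F using j by (intro sum.cong refl) auto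
  finally show ?thesis .
qed

text \<open>Up to the factor \<open>- \<beta> p * \<N>\<close> the expression is the covariance of
  \<open>F\<close> with the field at replica \<open>j\<close>. Centering the field at \<mu> and
  bounding \<open>F\<close> by \<open>B\<close> leaves the mean absolute deviation.\<close>

lemma replica_covariance_bound:
  assumes p: "p \<ge> 1" and j: "j \<in> {1..m}" and F: "\<And>s \<tau>. F (s(Suc m := \<tau>)) = F s"
    and B: "\<And>s. s \<in> {1..m} \<rightarrow>\<^sub>E S \<Longrightarrow> \<bar>F s\<bar> \<le> B" and \<beta>p: "0 \<le> \<beta> p"
  defines "\<mu> \<equiv> expectation (\<lambda>\<omega>. \<Sum>\<sigma>\<in>S. g \<beta> \<sigma> \<omega> * field p \<sigma> \<omega>)"
  shows "\<beta> p * \<N> * \<bar>(\<Sum>i\<in>{1..m} - {j}. Q \<beta> m (\<lambda>s. F s * K p (s j) (s i))) - real m * Q \<beta> (Suc m) (\<lambda>s. F s * K p (s j) (s (Suc m)))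
     + Q \<beta> m F * Q \<beta> 2 (\<lambda>s. K p (s 1) (s 2))\<bar> \<le> B * expectation (\<lambda>\<omega>. \<Sum>\<sigma>\<in>S. g \<beta> \<sigma> \<omega> * \<bar>field p \<sigma> \<omega> - \<mu>\<bar>)"
proof -
  obtain \<sigma>0 where \<sigma>0: "\<sigma>0 \<in> S" using S by auto
  \<comment> \<open>The common value of all self-overlaps. It enters the covariance through the term
    \<open>i = j\<close> and through \<mu>, with opposite signs.\<close>
  define \<kappa> where "\<kappa> = K p \<sigma>0 \<sigma>0"
  have K_self: "K p \<sigma> \<sigma> = \<kappa>" if "\<sigma> \<in> S" for \<sigma> using K_diag_eq[OF that \<sigma>0] by (simp add: \<kappa>_def)
  have m: "m \<ge> 1" using j by auto
  have iX: "integrable M (field p \<sigma>)" if "\<sigma> \<in> S" for \<sigma> by (rule field_moments(2)[OF p that])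
  have iXP: "integrable M (\<lambda>\<omega>. field p (s i) \<omega> * (\<Prod>i\<in>{1..k}. g \<beta> (s i) \<omega>))" if "s \<in> {1..k} \<rightarrow>\<^sub>E S" "i \<in> {1..k}" for s k i
    by (rule integrable_gibbs_prod[OF \<beta> that(1) iX[OF replica_in[OF that]]])
  \<comment> \<open>The quenched mean is evaluated by \<open>replica_energy\<close> for a single
    replica and \<open>F = 1\<close>.\<close>
  have \<mu>: "\<mu> = - (\<beta> p * \<N>) * (\<kappa> - Q \<beta> 2 (\<lambda>s. K p (s 1) (s 2)))"
  proof -
    have "\<mu> = expectation (\<lambda>\<omega>. \<Sum>s\<in>{1..1::nat} \<rightarrow>\<^sub>E S. field p (s 1) \<omega> * (\<Prod>i\<in>{1..1::nat}. g \<beta> (s i) \<omega>))"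
      unfolding \<mu>_def by (subst sum_replicas_coordinate) (auto simp: mult.commute)
    also have "\<dots> = (\<Sum>s\<in>{1..1::nat} \<rightarrow>\<^sub>E S. 1 * expectation (\<lambda>\<omega>. field p (s 1) \<omega> * (\<Prod>i\<in>{1..1::nat}. g \<beta> (s i) \<omega>)))"
    proof (subst Bochner_Integration.integral_sum)
      show "integrable M (\<lambda>\<omega>. field p (s 1) \<omega> * (\<Prod>i\<in>{1..1::nat}. g \<beta> (s i) \<omega>))" if "s \<in> {1..1::nat} \<rightarrow>\<^sub>E S" for s
        by (rule iXP[OF that]) simp
    qed simp
    also have "\<dots> = - (\<beta> p * \<N>) * ((\<Sum>i\<in>{1..1::nat}. Q \<beta> 1 (\<lambda>s. 1 * K p (s 1) (s i))) - real 1 * Q \<beta> (Suc 1) (\<lambda>s. 1 * K p (s 1) (s (Suc 1))))"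
      by (rule replica_energy[OF p]) auto
    also have "(\<Sum>i\<in>{1..1::nat}. Q \<beta> 1 (\<lambda>s. 1 * K p (s 1) (s i))) = Q \<beta> 1 (\<lambda>s. \<kappa>)"
      by (simp, rule quenched_cong[OF \<beta>], rule K_self, auto)
    finally show ?thesis by (simp add: quenched_const numeral_2_eq_2)
  qed
  let ?T = "\<Sum>s\<in>{1..m} \<rightarrow>\<^sub>E S. F s * expectation (\<lambda>\<omega>. field p (s j) \<omega> * (\<Prod>i\<in>{1..m}. g \<beta> (s i) \<omega>))"
  let ?R = "(\<Sum>i\<in>{1..m} - {j}. Q \<beta> m (\<lambda>s. F s * K p (s j) (s i))) - real m * Q \<beta> (Suc m) (\<lambda>s. F s * K p (s j) (s (Suc m)))
     + Q \<beta> m F * Q \<beta> 2 (\<lambda>s. K p (s 1) (s 2))"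
  have Q_diag: "Q \<beta> m (\<lambda>s. F s * K p (s j) (s j)) = \<kappa> * Q \<beta> m F"
  proof -
    have "Q \<beta> m (\<lambda>s. F s * K p (s j) (s j)) = Q \<beta> m (\<lambda>s. \<kappa> * F s)"
    proof (rule quenched_cong[OF \<beta>])
      fix s assume "s \<in> {1..m} \<rightarrow>\<^sub>E S"
      from K_self[OF replica_in[OF this j]] show "F s * K p (s j) (s j) = \<kappa> * F s" by (simp only: mult.commute)
    qed
    then show ?thesis by (simp only: quenched_cmult[OF \<beta>])
  qed
  have "(\<Sum>i\<in>{1..m}. Q \<beta> m (\<lambda>s. F s * K p (s j) (s i))) = \<kappa> * Q \<beta> m F + (\<Sum>i\<in>{1..m} - {j}. Q \<beta> m (\<lambda>s. F s * K p (s j) (s i)))"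
    unfolding Q_diag[symmetric] by (rule sum.remove[OF finite_atLeastAtMost j])
  note sum_eq = this
  have alg: "- x * ((\<kappa> * q + r) - y) - (- x * (\<kappa> - k)) * q = - x * (r - y + q * k)" for x q r y k :: real
    by (simp add: algebra_simps)
  have T: "?T - \<mu> * Q \<beta> m F = - (\<beta> p * \<N>) * ?R"
    unfolding replica_energy[of p j m F, OF p j F] sum_eq \<mu> by (rule alg)
  have iP: "integrable M (\<lambda>\<omega>. \<Prod>i\<in>{1..m}. g \<beta> (s i) \<omega>)" if "s \<in> {1..m} \<rightarrow>\<^sub>E S" for s
    using integrable_gibbs_prod[OF \<beta> that, of "\<lambda>_. 1"] by simp
  have iAP: "integrable M (\<lambda>\<omega>. \<bar>field p (s j) \<omega> - \<mu>\<bar> * (\<Prod>i\<in>{1..m}. g \<beta> (s i) \<omega>))" if s: "s \<in> {1..m} \<rightarrow>\<^sub>E S" for s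
  proof (rule integrable_gibbs_prod[OF \<beta> s])
    show "integrable M (\<lambda>\<omega>. \<bar>field p (s j) \<omega> - \<mu>\<bar>)"
      by (intro integrable_abs Bochner_Integration.integrable_diff integrable_const iX[OF replica_in[OF s j]])
  qed
  have step1: "?T - \<mu> * Q \<beta> m F = (\<Sum>s\<in>{1..m} \<rightarrow>\<^sub>E S. F s * expectation (\<lambda>\<omega>. (field p (s j) \<omega> - \<mu>) * (\<Prod>i\<in>{1..m}. g \<beta> (s i) \<omega>)))"
    unfolding quenched_eq[OF \<beta>] sum_distrib_left sum_subtractf[symmetric]
  proof (rule sum.cong[OF refl])
    fix s assume s: "s \<in> {1..m} \<rightarrow>\<^sub>E S"
    have aux: "f * x - \<mu> * (f * y) = f * (x - \<mu> * y)" for f x y :: real by (simp add: algebra_simps)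
    have "expectation (\<lambda>\<omega>. (field p (s j) \<omega> - \<mu>) * (\<Prod>i\<in>{1..m}. g \<beta> (s i) \<omega>)) =
      expectation (\<lambda>\<omega>. field p (s j) \<omega> * (\<Prod>i\<in>{1..m}. g \<beta> (s i) \<omega>)) - \<mu> * expectation (\<lambda>\<omega>. \<Prod>i\<in>{1..m}. g \<beta> (s i) \<omega>)"
      unfolding left_diff_distrib
      by (subst Bochner_Integration.integral_diff[OF iXP[OF s j]]) (use iP[OF s] in auto)
    then show "F s * expectation (\<lambda>\<omega>. field p (s j) \<omega> * (\<Prod>i\<in>{1..m}. g \<beta> (s i) \<omega>)) - \<mu> * (F s * expectation (\<lambda>\<omega>. \<Prod>i\<in>{1..m}. g \<beta> (s i) \<omega>)) =
      F s * expectation (\<lambda>\<omega>. (field p (s j) \<omega> - \<mu>) * (\<Prod>i\<in>{1..m}. g \<beta> (s i) \<omega>))"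
      using aux by (simp only:)
  qed
  have step2: "\<bar>\<Sum>s\<in>{1..m} \<rightarrow>\<^sub>E S. F s * expectation (\<lambda>\<omega>. (field p (s j) \<omega> - \<mu>) * (\<Prod>i\<in>{1..m}. g \<beta> (s i) \<omega>))\<bar> \<le>
     (\<Sum>s\<in>{1..m} \<rightarrow>\<^sub>E S. B * expectation (\<lambda>\<omega>. \<bar>field p (s j) \<omega> - \<mu>\<bar> * (\<Prod>i\<in>{1..m}. g \<beta> (s i) \<omega>)))"
  proof (rule order_trans[OF sum_abs sum_mono])
    fix s assume s: "s \<in> {1..m} \<rightarrow>\<^sub>E S"
    have "\<bar>expectation (\<lambda>\<omega>. (field p (s j) \<omega> - \<mu>) * (\<Prod>i\<in>{1..m}. g \<beta> (s i) \<omega>))\<bar> \<le>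
      expectation (\<lambda>\<omega>. \<bar>(field p (s j) \<omega> - \<mu>) * (\<Prod>i\<in>{1..m}. g \<beta> (s i) \<omega>)\<bar>)" by (rule integral_abs_bound)
    also have "\<dots> = expectation (\<lambda>\<omega>. \<bar>field p (s j) \<omega> - \<mu>\<bar> * (\<Prod>i\<in>{1..m}. g \<beta> (s i) \<omega>))"
      unfolding abs_mult abs_of_nonneg[OF prod_gibbs_nonneg] ..
    finally show "\<bar>F s * expectation (\<lambda>\<omega>. (field p (s j) \<omega> - \<mu>) * (\<Prod>i\<in>{1..m}. g \<beta> (s i) \<omega>))\<bar> \<le>
       B * expectation (\<lambda>\<omega>. \<bar>field p (s j) \<omega> - \<mu>\<bar> * (\<Prod>i\<in>{1..m}. g \<beta> (s i) \<omega>))"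
      unfolding abs_mult[of "F s"] using B[OF s] by (intro mult_mono) auto
  qed
  have step3: "(\<Sum>s\<in>{1..m} \<rightarrow>\<^sub>E S. expectation (\<lambda>\<omega>. \<bar>field p (s j) \<omega> - \<mu>\<bar> * (\<Prod>i\<in>{1..m}. g \<beta> (s i) \<omega>))) =
      expectation (\<lambda>\<omega>. \<Sum>s\<in>{1..m} \<rightarrow>\<^sub>E S. \<bar>field p (s j) \<omega> - \<mu>\<bar> * (\<Prod>i\<in>{1..m}. g \<beta> (s i) \<omega>))"
    by (rule Bochner_Integration.integral_sum[symmetric]) (rule iAP)
  \<comment> \<open>The deviation involves replica \<open>j\<close> alone, so the average over
    \<open>m\<close> replicas reduces to a one-replica Gibbs average.\<close>
  have step4: "(\<Sum>s\<in>{1..m} \<rightarrow>\<^sub>E S. \<bar>field p (s j) \<omega> - \<mu>\<bar> * (\<Prod>i\<in>{1..m}. g \<beta> (s i) \<omega>)) =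
      (\<Sum>\<sigma>\<in>S. \<bar>field p \<sigma> \<omega> - \<mu>\<bar> * g \<beta> \<sigma> \<omega>)" for \<omega>
    by (rule sum_replicas_coordinate[OF j, of "\<lambda>\<sigma>. \<bar>field p \<sigma> \<omega> - \<mu>\<bar>" \<beta> \<omega>])
  have "\<bar>- (\<beta> p * \<N>) * ?R\<bar> \<le> B * expectation (\<lambda>\<omega>. \<Sum>\<sigma>\<in>S. g \<beta> \<sigma> \<omega> * \<bar>field p \<sigma> \<omega> - \<mu>\<bar>)"
    using step2 unfolding T[symmetric] step1 sum_distrib_left[of B, symmetric] step3 step4
      mult.commute[of "g \<beta> _ _"] .
  moreover have "0 \<le> \<beta> p * \<N>" using \<beta>p by simp
  ultimately show ?thesis by (simp only: abs_mult abs_minus_cancel abs_of_nonneg abs_of_nonneg[OF \<beta>p])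
qed

text \<open>The exceptional null set is that of divergence for \<open>\<beta>(p := 0)\<close> and so
  is the same for all \<open>x\<close>; elsewhere changing the parameter alters a single term of a
  convergent series. This permits calculus in \<open>x\<close> at fixed disorder.\<close>

lemma AE_hamiltonian_affine:
  assumes p: "p \<ge> 1"
  shows "AE \<omega> in M. \<forall>\<sigma>\<in>S. \<forall>x. hbar (\<beta>(p := x)) \<sigma> \<omega> = hbar (\<beta>(p := 0)) \<sigma> \<omega> + x * field p \<sigma> \<omega>"
proof -
  obtain q where q: "p = Suc q" using p by (cases p) auto
  let ?b = "\<beta>(p := 0)"
  note b0 = summable_fun_upd[OF \<beta>, of p 0]
  have eq: "hbar b \<sigma> \<omega> = (\<Sum>k. b (Suc k) * field (Suc k) \<sigma> \<omega>)" for b \<sigma> \<omega>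
    by (simp add: complete_hamiltonian_def scaled_field_def)
  show ?thesis
    using AE_hamiltonian_summable[OF b0]
  proof eventually_elim
    case (elim \<omega>)
    show ?case
    proof (intro ballI allI)
      fix \<sigma> x assume \<sigma>: "\<sigma> \<in> S"
      have "(\<lambda>k. ?b (Suc k) * field (Suc k) \<sigma> \<omega>) sums hbar ?b \<sigma> \<omega>"
        unfolding eq using elim \<sigma> by (intro summable_sums) auto
      from sums_add[OF this sums_single[of q "\<lambda>_. x * field p \<sigma> \<omega>"]]
      have "(\<lambda>k. ?b (Suc k) * field (Suc k) \<sigma> \<omega> + (if k = q then x * field p \<sigma> \<omega> else 0)) sums (hbar ?b \<sigma> \<omega> + x * field p \<sigma> \<omega>)"
        by simp
      moreover have "(\<lambda>k. ?b (Suc k) * field (Suc k) \<sigma> \<omega> + (if k = q then x * field p \<sigma> \<omega> else 0)) = (\<lambda>k. (\<beta>(p := x)) (Suc k) * field (Suc k) \<sigma> \<omega>)"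
        by (auto simp: q)
      ultimately show "hbar (\<beta>(p := x)) \<sigma> \<omega> = hbar ?b \<sigma> \<omega> + x * field p \<sigma> \<omega>"
        unfolding eq[of "\<beta>(p := x)"] by (simp only: sums_iff)
    qed
  qed
qed

end

text \<open>The pathwise bound is integrated, and the Gibbs mean of the field is replaced by \<mu>.
  The 5 is the 4 of the pathwise bound plus 1 for this replacement; the 4 before the square root
  counts the log partition functions in the two difference quotients.\<close>

lemma fluctuation_bound:
  fixes a h \<epsilon> :: real
  assumes \<beta>: "summable (\<lambda>k. (\<beta> (Suc k))\<^sup>2)" and p: "p \<ge> 1" and h: "0 < h" "h < a" and \<epsilon>: "\<epsilon> > 0"
  defines "P \<equiv> \<lambda>x. pressure M c H L (\<beta>(p := x))"
    and "gs \<equiv> gibbs c H L (\<beta>(p := a))"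
    and "V \<equiv> \<Sum>k. ((\<beta>(p := a + 2 * h)) (Suc k))\<^sup>2"
  defines "\<mu> \<equiv> expectation (\<lambda>\<omega>. \<Sum>\<sigma>\<in>S. gs \<sigma> \<omega> * field p \<sigma> \<omega>)"
  shows "expectation (\<lambda>\<omega>. \<Sum>\<sigma>\<in>S. gs \<sigma> \<omega> * \<bar>field p \<sigma> \<omega> - \<mu>\<bar>) \<le>
    \<epsilon> + (1 / (\<epsilon> * h) + 5) * (\<N> * ((P (a + 2 * h) - P (a + h) - P a + P (a - h)) / h)) + 4 * sqrt (\<N> * V) / h"
proof -
  note b = summable_fun_upd[OF \<beta>, of p]
  define F where "F x \<omega> = ln (partition_function c H L (\<beta>(p := x)) \<omega>)" for x \<omega>
  have iF: "integrable M (F x)" for x unfolding F_def by (rule log_partition_fluctuation(1)[OF b])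
  have EF: "expectation (F x) = \<N> * P x" for x
    using card_pos by (simp add: P_def pressure_def F_def[abs_def])
  \<comment> \<open>\<open>V\<close> belongs to the largest parameter \<open>a + 2 * h\<close>, so
    one bound covers the four parameters involved.\<close>
  have fl: "expectation (\<lambda>\<omega>. \<bar>F x \<omega> - expectation (F x)\<bar>) \<le> sqrt (\<N> * V)" if x: "\<bar>x\<bar> \<le> a + 2 * h" for x
  proof -
    have "expectation (\<lambda>\<omega>. \<bar>F x \<omega> - expectation (F x)\<bar>) \<le> sqrt (\<N> * (\<Sum>k. ((\<beta>(p := x)) (Suc k))\<^sup>2))"
      unfolding F_def by (rule log_partition_fluctuation(2)[OF b])
    also have "\<dots> \<le> sqrt (\<N> * V)"
      unfolding V_def
    proof (intro real_sqrt_le_mono mult_left_mono suminf_le b)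
      have "x\<^sup>2 \<le> (a + 2 * h)\<^sup>2" using x h by (simp add: abs_le_square_iff[symmetric])
      then show "((\<beta>(p := x)) (Suc k))\<^sup>2 \<le> ((\<beta>(p := a + 2 * h)) (Suc k))\<^sup>2" for k by simp
    qed simp
    finally show ?thesis .
  qed
  define A where "A \<omega> = (F (a + 2 * h) \<omega> - F (a + h) \<omega>) / h" for \<omega>
  define B where "B \<omega> = (F a \<omega> - F (a - h) \<omega>) / h" for \<omega>
  define m where "m \<omega> = (\<Sum>\<sigma>\<in>S. gs \<sigma> \<omega> * field p \<sigma> \<omega>)" for \<omega>
  have iX: "integrable M (field p \<sigma>)" if "\<sigma> \<in> S" for \<sigma> by (rule field_moments(2)[OF p that])
  have ig: "integrable M (\<lambda>\<omega>. gs \<sigma> \<omega> * f \<omega>)" if "\<sigma> \<in> S" "integrable M f" for \<sigma> f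
    unfolding gs_def by (rule integrable_gibbs_mult[OF b that])
  have im: "integrable M m" unfolding m_def using ig iX by auto
  have iA: "integrable M A" "integrable M B" unfolding A_def B_def using iF by auto
  have \<mu>: "\<mu> = expectation m" by (simp add: \<mu>_def m_def[abs_def])
  have main: "AE \<omega> in M. B \<omega> \<le> - m \<omega> \<and> - m \<omega> \<le> A \<omega> \<and>
     (\<Sum>\<sigma>\<in>S. gs \<sigma> \<omega> * \<bar>field p \<sigma> \<omega> - m \<omega>\<bar>) \<le> \<epsilon> + (1 / (\<epsilon> * h) + 4) * (A \<omega> - B \<omega>)"
    using AE_hamiltonian_affine[OF \<beta> p]
  proof eventually_elim
    case (elim \<omega>)
    let ?R = "\<lambda>\<sigma>. hbar (\<beta>(p := 0)) \<sigma> \<omega>" and ?X = "\<lambda>\<sigma>. field p \<sigma> \<omega>"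
    have e: "hbar (\<beta>(p := x)) \<sigma> \<omega> = ?R \<sigma> + x * ?X \<sigma>" if "\<sigma> \<in> S" for \<sigma> x
      using elim that by blast
    have F: "F x \<omega> = log_partition S (\<lambda>\<sigma>. ?R \<sigma> + x * ?X \<sigma>)" for x
      unfolding F_def partition_function_def log_partition_def
      by (intro arg_cong[where f=ln] sum.cong refl arg_cong[where f="\<lambda>u. exp (- u)"] e)
    have gw: "gs \<sigma> \<omega> = gibbs_weight S (\<lambda>\<sigma>. ?R \<sigma> + a * ?X \<sigma>) \<sigma>" if "\<sigma> \<in> S" for \<sigma>
      unfolding gs_def gibbs_eq_weight by (rule gibbs_weight_cong[OF S e that])
    note * = gibbs_fluctuation_le[OF S h(1) \<epsilon>, of ?R a ?X]
    have sg: "(\<Sum>\<sigma>\<in>S. gs \<sigma> \<omega> * f \<sigma>) = (\<Sum>\<sigma>\<in>S. gibbs_weight S (\<lambda>\<sigma>. ?R \<sigma> + a * ?X \<sigma>) \<sigma> * f \<sigma>)" for f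
      by (rule sum.cong) (simp_all add: gw)
    show ?case unfolding A_def B_def F m_def sg by (intro conjI *)
  qed
  have EB: "expectation B \<le> - \<mu>" and EA: "- \<mu> \<le> expectation A"
    using integral_mono_AE[of M B "\<lambda>\<omega>. - m \<omega>"] integral_mono_AE[of M "\<lambda>\<omega>. - m \<omega>" A] main iA im by (auto simp: \<mu>)
  define D where "D = expectation A - expectation B"
  define C where "C = 1 / (\<epsilon> * h) + 4"
  have "expectation (\<lambda>\<omega>. \<Sum>\<sigma>\<in>S. gs \<sigma> \<omega> * \<bar>field p \<sigma> \<omega> - \<mu>\<bar>) \<le>
    expectation (\<lambda>\<omega>. (\<epsilon> + C * (A \<omega> - B \<omega>)) + (\<bar>A \<omega> - expectation A\<bar> + \<bar>B \<omega> - expectation B\<bar> + D))"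
  proof (rule integral_mono_AE)
    show "integrable M (\<lambda>\<omega>. \<Sum>\<sigma>\<in>S. gs \<sigma> \<omega> * \<bar>field p \<sigma> \<omega> - \<mu>\<bar>)"
      using ig iX by (intro Bochner_Integration.integrable_sum) auto
    show "integrable M (\<lambda>\<omega>. (\<epsilon> + C * (A \<omega> - B \<omega>)) + (\<bar>A \<omega> - expectation A\<bar> + \<bar>B \<omega> - expectation B\<bar> + D))"
      using iA by auto
    show "AE \<omega> in M. (\<Sum>\<sigma>\<in>S. gs \<sigma> \<omega> * \<bar>field p \<sigma> \<omega> - \<mu>\<bar>) \<le> (\<epsilon> + C * (A \<omega> - B \<omega>)) + (\<bar>A \<omega> - expectation A\<bar> + \<bar>B \<omega> - expectation B\<bar> + D)"
      using main
    proof eventually_elim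
      case (elim \<omega>)
      have "(\<Sum>\<sigma>\<in>S. gs \<sigma> \<omega> * \<bar>field p \<sigma> \<omega> - \<mu>\<bar>) \<le> (\<Sum>\<sigma>\<in>S. gs \<sigma> \<omega> * \<bar>field p \<sigma> \<omega> - m \<omega>\<bar> + gs \<sigma> \<omega> * \<bar>m \<omega> - \<mu>\<bar>)"
      proof (rule sum_mono)
        fix \<sigma>
        have "\<bar>field p \<sigma> \<omega> - \<mu>\<bar> \<le> \<bar>field p \<sigma> \<omega> - m \<omega>\<bar> + \<bar>m \<omega> - \<mu>\<bar>" 
          using abs_triangle_ineq[of "field p \<sigma> \<omega> - m \<omega>" "m \<omega> - \<mu>"] by simp
        then show "gs \<sigma> \<omega> * \<bar>field p \<sigma> \<omega> - \<mu>\<bar> \<le> gs \<sigma> \<omega> * \<bar>field p \<sigma> \<omega> - m \<omega>\<bar> + gs \<sigma> \<omega> * \<bar>m \<omega> - \<mu>\<bar>"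
          unfolding distrib_left[symmetric] by (rule mult_left_mono) (simp add: gs_def gibbs_nonneg)
      qed
      also have "\<dots> = (\<Sum>\<sigma>\<in>S. gs \<sigma> \<omega> * \<bar>field p \<sigma> \<omega> - m \<omega>\<bar>) + \<bar>m \<omega> - \<mu>\<bar>"
        by (simp add: sum.distrib gs_def sum_gibbs flip: sum_distrib_right)
      also have "\<dots> \<le> (\<epsilon> + C * (A \<omega> - B \<omega>)) + (\<bar>A \<omega> - expectation A\<bar> + \<bar>B \<omega> - expectation B\<bar> + D)"
      proof (rule add_mono)
        show "(\<Sum>\<sigma>\<in>S. gs \<sigma> \<omega> * \<bar>field p \<sigma> \<omega> - m \<omega>\<bar>) \<le> \<epsilon> + C * (A \<omega> - B \<omega>)" using elim by (simp add: C_def)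
        have e: "B \<omega> \<le> - m \<omega>" "- m \<omega> \<le> A \<omega>" using elim by auto
        \<comment> \<open>\<open>- m \<omega>\<close> lies between \<open>B \<omega>\<close> and
          \<open>A \<omega>\<close>, and \<open>- \<mu>\<close> between their expectations. Hence
          the two differ by at most \<open>D\<close> plus the deviations of the quotients from their
          means.\<close>
        have "m \<omega> - \<mu> \<le> - (B \<omega> - expectation B) + D"
          using e EA unfolding D_def by argo
        also have "\<dots> \<le> \<bar>A \<omega> - expectation A\<bar> + \<bar>B \<omega> - expectation B\<bar> + D"
          by (rule add_right_mono) (rule add_increasing[OF abs_ge_zero abs_ge_minus_self])
        finally have "m \<omega> - \<mu> \<le> \<bar>A \<omega> - expectation A\<bar> + \<bar>B \<omega> - expectation B\<bar> + D" .
        moreover have "- (m \<omega> - \<mu>) \<le> (A \<omega> - expectation A) + D"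
          using e EB unfolding D_def by argo
        then have "- (m \<omega> - \<mu>) \<le> \<bar>A \<omega> - expectation A\<bar> + \<bar>B \<omega> - expectation B\<bar> + D"
          by (rule order_trans) (rule add_right_mono, rule add_increasing2[OF abs_ge_zero abs_ge_self])
        ultimately show "\<bar>m \<omega> - \<mu>\<bar> \<le> \<bar>A \<omega> - expectation A\<bar> + \<bar>B \<omega> - expectation B\<bar> + D" by (rule abs_leI)
      qed
      finally show ?case .
    qed
  qed
  also have "\<dots> = (\<epsilon> + C * D) + (expectation (\<lambda>\<omega>. \<bar>A \<omega> - expectation A\<bar>) + expectation (\<lambda>\<omega>. \<bar>B \<omega> - expectation B\<bar>) + D)"
    using iA by (simp add: D_def prob_space)
  also have "\<dots> \<le> (\<epsilon> + C * D) + (2 * sqrt (\<N> * V) / h + 2 * sqrt (\<N> * V) / h + D)"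
  proof -
    have d: "expectation (\<lambda>\<omega>. \<bar>(F x \<omega> - F y \<omega>) / h - expectation (\<lambda>\<omega>. (F x \<omega> - F y \<omega>) / h)\<bar>) \<le> 2 * sqrt (\<N> * V) / h"
      if "\<bar>x\<bar> \<le> a + 2 * h" "\<bar>y\<bar> \<le> a + 2 * h" for x y
    proof -
      have "expectation (\<lambda>\<omega>. \<bar>(F x \<omega> - F y \<omega>) / h - expectation (\<lambda>\<omega>. (F x \<omega> - F y \<omega>) / h)\<bar>) \<le>
        expectation (\<lambda>\<omega>. (\<bar>F x \<omega> - expectation (F x)\<bar> + \<bar>F y \<omega> - expectation (F y)\<bar>) / h)"
      proof (rule integral_mono)
        fix \<omega>
        have "(F x \<omega> - F y \<omega>) / h - expectation (\<lambda>\<omega>. (F x \<omega> - F y \<omega>) / h) = ((F x \<omega> - expectation (F x)) - (F y \<omega> - expectation (F y))) / h"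
          using iF by (simp add: diff_divide_distrib)
        also have "\<bar>\<dots>\<bar> \<le> (\<bar>F x \<omega> - expectation (F x)\<bar> + \<bar>F y \<omega> - expectation (F y)\<bar>) / h"
          unfolding abs_divide abs_of_pos[OF h(1)] by (rule divide_right_mono[OF abs_triangle_ineq4]) (use h in simp)
        finally show "\<bar>(F x \<omega> - F y \<omega>) / h - expectation (\<lambda>\<omega>. (F x \<omega> - F y \<omega>) / h)\<bar> \<le>
          (\<bar>F x \<omega> - expectation (F x)\<bar> + \<bar>F y \<omega> - expectation (F y)\<bar>) / h" .
      qed (use iF in auto)
      also have "\<dots> = (expectation (\<lambda>\<omega>. \<bar>F x \<omega> - expectation (F x)\<bar>) + expectation (\<lambda>\<omega>. \<bar>F y \<omega> - expectation (F y)\<bar>)) / h"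
        using iF by simp
      also have "\<dots> \<le> (sqrt (\<N> * V) + sqrt (\<N> * V)) / h"
        using h by (intro divide_right_mono add_mono fl that) auto
      finally show ?thesis by simp
    qed
    show ?thesis unfolding A_def B_def
      by (intro add_mono d order_refl) (use h in auto)
  qed
  also have "\<dots> = \<epsilon> + (1 / (\<epsilon> * h) + 5) * D + 4 * sqrt (\<N> * V) / h"
    by (simp add: C_def algebra_simps)
  also have "D = \<N> * ((P (a + 2 * h) - P (a + h) - P a + P (a - h)) / h)"
    using iF by (simp add: D_def A_def[abs_def] B_def[abs_def] EF diff_divide_distrib add_divide_distrib algebra_simps)
  finally show ?thesis .
qed

end

section \<open>The thermodynamic limit\<close>

text \<open>This is the covariance of \<open>F\<close> with the energy of replica \<open>j\<close>, up to a factor. The term \<open>i = j\<close> is left out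
  because \<open>covariance \<Delta> L \<sigma> \<sigma>\<close> does not depend on \<open>\<sigma>\<close>, so that it cancels against the self-overlap
  in the product of the two averages.\<close>

definition replica_defect ::
  "'w measure \<Rightarrow> real \<Rightarrow> ('d::finite site set \<Rightarrow> 'd site set \<Rightarrow> real) \<Rightarrow>
   ('d site set \<Rightarrow> nat \<Rightarrow> 'd config \<Rightarrow> 'w \<Rightarrow> real) \<Rightarrow> 'd site set \<Rightarrow> (nat \<Rightarrow> real) \<Rightarrow>
   nat \<Rightarrow> ((nat \<Rightarrow> 'd config) \<Rightarrow> real) \<Rightarrow> nat \<Rightarrow> nat \<Rightarrow> real" where
  "replica_defect M c \<Delta> H L \<beta> p F m j =
     (\<Sum>i\<in>{1..m} - {j}. quenched M c H L \<beta> m (\<lambda>s. F s * covariance \<Delta> L (s j) (s i) ^ p))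
     - real m * quenched M c H L \<beta> (Suc m) (\<lambda>s. F s * covariance \<Delta> L (s j) (s (Suc m)) ^ p)
     + quenched M c H L \<beta> m F * quenched M c H L \<beta> 2 (\<lambda>s. covariance \<Delta> L (s 1) (s 2) ^ p)"

lemma overlap_array_upd: "n < k \<Longrightarrow> overlap_array \<Delta> L n (s(k := \<tau>)) = overlap_array \<Delta> L n s"
  by (auto simp: overlap_array_def replica_pairs_def restrict_def fun_eq_iff)

context spin_glass_volume
begin

context
  fixes \<beta> :: "nat \<Rightarrow> real"
  assumes \<beta>: "summable (\<lambda>k. (\<beta> (Suc k))\<^sup>2)"
begin

lemma replica_defect_le:
  assumes p: "p \<ge> 1" and j: "j \<in> {1..m}" and F: "\<And>s \<tau>. F (s(Suc m := \<tau>)) = F s"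
    and B: "\<And>s. s \<in> {1..m} \<rightarrow>\<^sub>E S \<Longrightarrow> \<bar>F s\<bar> \<le> B" and \<beta>p: "0 \<le> \<beta> p"
  defines "\<mu> \<equiv> expectation (\<lambda>\<omega>. \<Sum>\<sigma>\<in>S. g \<beta> \<sigma> \<omega> * field p \<sigma> \<omega>)"
  shows "\<beta> p * \<N> * \<bar>replica_defect M c \<Delta> H L \<beta> p F m j\<bar> \<le>
    c ^ p * (B * expectation (\<lambda>\<omega>. \<Sum>\<sigma>\<in>S. g \<beta> \<sigma> \<omega> * \<bar>field p \<sigma> \<omega> - \<mu>\<bar>))"
proof -
  let ?R = "(\<Sum>i\<in>{1..m} - {j}. Q \<beta> m (\<lambda>s. F s * K p (s j) (s i))) - real m * Q \<beta> (Suc m) (\<lambda>s. F s * K p (s j) (s (Suc m)))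
     + Q \<beta> m F * Q \<beta> 2 (\<lambda>s. K p (s 1) (s 2))"
  have cK: "covariance \<Delta> L \<sigma> \<tau> ^ p = c ^ p * K p \<sigma> \<tau>" for \<sigma> \<tau>
    using c_pos by (simp add: overlap_kernel_def power_divide)
  have "replica_defect M c \<Delta> H L \<beta> p F m j = c ^ p * ?R"
    unfolding replica_defect_def cK mult.left_commute[of "F _" "c ^ p"] quenched_cmult[OF \<beta>] sum_distrib_left[symmetric]
    by (simp only: distrib_left right_diff_distrib mult.left_commute)
  then have "\<beta> p * \<N> * \<bar>replica_defect M c \<Delta> H L \<beta> p F m j\<bar> = c ^ p * (\<beta> p * \<N> * \<bar>?R\<bar>)"
    using c_pos by (simp only: abs_mult power_abs abs_of_pos mult.left_commute)
  also have "\<dots> \<le> c ^ p * (B * expectation (\<lambda>\<omega>. \<Sum>\<sigma>\<in>S. g \<beta> \<sigma> \<omega> * \<bar>field p \<sigma> \<omega> - \<mu>\<bar>))"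
    unfolding \<mu>_def
    by (rule mult_left_mono[OF replica_covariance_bound[of \<beta> p j m F, OF \<beta> p j F B \<beta>p]]) (use c_pos in simp_all)
  finally show ?thesis .
qed

text \<open>In the abbreviations of the proof, the defects of \<open>n\<close> replicas sum over
  \<open>j\<close> to \<open>A - n * B + n * D\<close>, and the defect at the last of
  \<open>n + 1\<close> replicas is \<open>B - (n + 1) * C + D\<close>. Subtracting \<open>n\<close>
  times the latter removes the product \<open>D\<close> of averages, which does not occur in the
  stability average.\<close>

lemma stochastic_stability_average_eq:
  defines "F \<equiv> \<lambda>n f s. f (overlap_array \<Delta> L n s)"
  shows "stochastic_stability_average M c \<Delta> H L \<beta> p n f =
    (\<Sum>j\<in>{1..n}. replica_defect M c \<Delta> H L \<beta> p (F n f) n j) - real n * replica_defect M c \<Delta> H L \<beta> p (F n f) (Suc n) (Suc n)"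
    and "ghirlanda_guerra_difference M c \<Delta> H L \<beta> p n f = - (1 / (real n + 1)) * replica_defect M c \<Delta> H L \<beta> p (F n f) (Suc n) (Suc n)"
proof -
  let ?F = "F n f" and ?c = "\<lambda>s i k. covariance \<Delta> L (s i) (s k) ^ p"
  define A where "A = (\<Sum>j\<in>{1..n}. \<Sum>k\<in>{1..n} - {j}. Q \<beta> n (\<lambda>s. ?F s * ?c s j k))"
  define B where "B = (\<Sum>k\<in>{1..n}. Q \<beta> (Suc n) (\<lambda>s. ?F s * ?c s k (Suc n)))"
  define C where "C = Q \<beta> (Suc (Suc n)) (\<lambda>s. ?F s * ?c s (Suc n) (Suc (Suc n)))"
  define D where "D = Q \<beta> n ?F * Q \<beta> 2 (\<lambda>s. ?c s 1 2)"
  have Fu: "?F (s(Suc n := \<tau>)) = ?F s" "?F (s(Suc (Suc n) := \<tau>)) = ?F s" for s \<tau>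
    by (simp_all add: F_def overlap_array_upd)
  have mF: "Q \<beta> (Suc n) ?F = Q \<beta> n ?F" by (rule quenched_marginal[OF \<beta>]) (rule Fu)
  have mA: "Q \<beta> (Suc (Suc n)) (\<lambda>s. ?F s * ?c s j k) = Q \<beta> n (\<lambda>s. ?F s * ?c s j k)" if "j \<in> {1..n}" "k \<in> {1..n} - {j}" for j k
  proof -
    have "Q \<beta> (Suc (Suc n)) (\<lambda>s. ?F s * ?c s j k) = Q \<beta> (Suc n) (\<lambda>s. ?F s * ?c s j k)"
      by (rule quenched_marginal[OF \<beta>]) (use that in \<open>auto simp: Fu\<close>)
    also have "\<dots> = Q \<beta> n (\<lambda>s. ?F s * ?c s j k)"
      by (rule quenched_marginal[OF \<beta>]) (use that in \<open>auto simp: Fu\<close>)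
    finally show ?thesis .
  qed
  have mB: "Q \<beta> (Suc (Suc n)) (\<lambda>s. ?F s * ?c s k (Suc n)) = Q \<beta> (Suc n) (\<lambda>s. ?F s * ?c s k (Suc n))" if "k \<in> {1..n}" for k
    by (rule quenched_marginal[OF \<beta>]) (use that in \<open>auto simp: Fu\<close>)
  have d1: "(\<Sum>j\<in>{1..n}. replica_defect M c \<Delta> H L \<beta> p ?F n j) = A - real n * B + real n * D"
    unfolding replica_defect_def A_def B_def D_def by (simp add: sum.distrib sum_subtractf sum_distrib_left)
  have "{1..Suc n} - {Suc n} = {1..n}" by auto
  moreover have "?c s (Suc n) k = ?c s k (Suc n)" for s k by (subst covariance_sym) (rule refl)
  ultimately have d2: "replica_defect M c \<Delta> H L \<beta> p ?F (Suc n) (Suc n) = B - (real n + 1) * C + D"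
    unfolding replica_defect_def B_def C_def D_def mF by (simp add: add.commute)
  have "stochastic_stability_average M c \<Delta> H L \<beta> p n f =
     Q \<beta> (Suc (Suc n)) (\<lambda>s. (\<Sum>j\<in>{1..n}. \<Sum>k\<in>{1..n} - {j}. ?F s * ?c s j k)
       - 2 * real n * (\<Sum>k\<in>{1..n}. ?F s * ?c s k (Suc n)) + real n * (real n + 1) * (?F s * ?c s (Suc n) (Suc (Suc n))))"
    unfolding stochastic_stability_average_def F_def
    by (simp add: sum_distrib_left mult.assoc)
  also have "\<dots> = A - 2 * real n * B + real n * (real n + 1) * C"
    unfolding quenched_add[OF \<beta>] quenched_diff[OF \<beta>] quenched_cmult[OF \<beta>] quenched_sum[OF \<beta>] A_def B_def C_def
    using mA mB by simp
  also have "\<dots> = (A - real n * B + real n * D) - real n * (B - (real n + 1) * C + D)"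
    by (simp add: algebra_simps)
  finally show "stochastic_stability_average M c \<Delta> H L \<beta> p n f =
    (\<Sum>j\<in>{1..n}. replica_defect M c \<Delta> H L \<beta> p ?F n j) - real n * replica_defect M c \<Delta> H L \<beta> p ?F (Suc n) (Suc n)"
    unfolding d1 d2 .
  have "ghirlanda_guerra_difference M c \<Delta> H L \<beta> p n f = C - 1 / (real n + 1) * B - 1 / (real n + 1) * D"
    unfolding ghirlanda_guerra_difference_def B_def C_def D_def F_def by (simp add: mult.assoc)
  also have "\<dots> = - (1 / (real n + 1)) * (B - (real n + 1) * C + D)"
  proof -
    have "C - 1 / x * B - 1 / x * D = - (1 / x) * (B - x * C + D)" if "x > 0" for x
      using that by (simp add: field_simps)
    from this[of "real n + 1"] show ?thesis by simp
  qed
  finally show "ghirlanda_guerra_difference M c \<Delta> H L \<beta> p n f = - (1 / (real n + 1)) * replica_defect M c \<Delta> H L \<beta> p ?F (Suc n) (Suc n)"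
    unfolding d2 .
qed

text \<open>Convexity holds at fixed disorder, outside a null set common to all parameters, and
  survives taking expectations.\<close>

lemma pressure_convex:
  assumes p: "p \<ge> 1" and uv: "0 \<le> u" "0 \<le> v" "u + v = 1"
  shows "pressure M c H L (\<beta>(p := u * x + v * y)) \<le> u * pressure M c H L (\<beta>(p := x)) + v * pressure M c H L (\<beta>(p := y))"
proof -
  define F where "F x \<omega> = ln (partition_function c H L (\<beta>(p := x)) \<omega>)" for x \<omega>
  have iF: "integrable M (F x)" for x
    unfolding F_def by (rule log_partition_fluctuation(1)[OF summable_fun_upd[OF \<beta>]])
  have "expectation (F (u * x + v * y)) \<le> expectation (\<lambda>\<omega>. u * F x \<omega> + v * F y \<omega>)"
  proof (rule integral_mono_AE)
    show "AE \<omega> in M. F (u * x + v * y) \<omega> \<le> u * F x \<omega> + v * F y \<omega>"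
      using AE_hamiltonian_affine[OF \<beta> p]
    proof eventually_elim
      case (elim \<omega>)
      let ?f = "\<lambda>x. log_partition S (\<lambda>\<sigma>. hbar (\<beta>(p := 0)) \<sigma> \<omega> + x * field p \<sigma> \<omega>)"
      have e: "hbar (\<beta>(p := x)) \<sigma> \<omega> = hbar (\<beta>(p := 0)) \<sigma> \<omega> + x * field p \<sigma> \<omega>" if "\<sigma> \<in> S" for \<sigma> x
        using elim that by blast
      have F: "F x \<omega> = ?f x" for x
        unfolding F_def partition_function_def log_partition_def
        by (intro arg_cong[where f=ln] sum.cong refl arg_cong[where f="\<lambda>u. exp (- u)"] e)
      have "convex_on UNIV ?f" by (rule log_partition_convex[OF S]) simp
      then have "?f (u *\<^sub>R x + v *\<^sub>R y) \<le> u * ?f x + v * ?f y"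
        unfolding convex_on_def using uv by blast
      then show ?case unfolding F by simp
    qed
  qed (use iF in auto)
  then have "expectation (F (u * x + v * y)) \<le> u * expectation (F x) + v * expectation (F y)"
    using iF by simp
  then have "expectation (F (u * x + v * y)) / \<N> \<le> (u * expectation (F x) + v * expectation (F y)) / \<N>"
    by (rule divide_right_mono) simp
  then show ?thesis unfolding pressure_def F_def by (simp add: add_divide_distrib)
qed

end

end

section \<open>Exhausting volumes and bounded overlap functions\<close>

lemma infinite_sites: "infinite (UNIV :: 'd::finite site set)"
proof
  assume "finite (UNIV :: 'd site set)"
  then have "finite (range (\<lambda>k. \<chi> i. k :: 'd site))" by (rule finite_subset[OF subset_UNIV])
  moreover have "inj (\<lambda>k::int. \<chi> i. k :: 'd site)" by (auto simp: inj_def vec_eq_iff)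
  ultimately show False using finite_imageD infinite_UNIV_int by blast
qed

text \<open>Any finite set of sites lies in some volume, hence in all later ones. The first volumes
  may be empty, where the model imposes no conditions; the second claim lets these be
  skipped.\<close>

lemma exhausting_card:
  fixes \<Lambda> :: "nat \<Rightarrow> 'd::finite site set"
  assumes \<Lambda>: "exhausting \<Lambda>"
  shows "filterlim (\<lambda>N. real (card (\<Lambda> N))) at_top sequentially" and "eventually (\<lambda>N. \<Lambda> N \<noteq> {}) sequentially"
proof -
  have fin: "finite (\<Lambda> N)" and inc: "incseq \<Lambda>" and un: "(\<Union>N. \<Lambda> N) = UNIV" for N
    using \<Lambda> by (auto simp: exhausting_def)
  have ev: "eventually (\<lambda>N. n \<le> card (\<Lambda> N)) sequentially" for n
  proof -
    obtain A :: "'d site set" where A: "finite A" "card A = n"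
      using infinite_arbitrarily_large[OF infinite_sites] by blast
    have "\<forall>x. \<exists>N. x \<in> \<Lambda> N" using un by blast
    then obtain k where k: "\<And>x. x \<in> \<Lambda> (k x)" by metis
    have "n \<le> card (\<Lambda> N)" if N: "(\<Sum>x\<in>A. k x) \<le> N" for N
    proof -
      have "A \<subseteq> \<Lambda> N"
      proof
        fix x assume "x \<in> A"
        then have "k x \<le> N" using member_le_sum[of x A k] A N by auto
        then show "x \<in> \<Lambda> N" using k[of x] inc by (auto simp: incseq_def)
      qed
      from card_mono[OF fin this] show ?thesis using A by simp
    qed
    then show ?thesis unfolding eventually_sequentially by blast
  qed
  have "filterlim (\<lambda>N. card (\<Lambda> N)) at_top sequentially"
    unfolding filterlim_at_top using ev by blast
  then show "filterlim (\<lambda>N. real (card (\<Lambda> N))) at_top sequentially"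
    by (rule filterlim_compose[OF filterlim_real_sequentially])
  show "eventually (\<lambda>N. \<Lambda> N \<noteq> {}) sequentially" using ev[of 1] by eventually_elim auto
qed

text \<open>The cube is compact by Tychonoff's theorem. Since stability places the overlaps in it,
  the bound is uniform in the volume.\<close>

lemma overlap_function_bounded:
  assumes f: "overlap_function c n f"
  shows "\<exists>B. \<forall>x \<in> replica_pairs n \<rightarrow>\<^sub>E {-c..c}. \<bar>f x\<bar> \<le> B"
proof -
  let ?T = "product_topology (\<lambda>_. top_of_set {-c..c}) (replica_pairs n)"
  have "compact_space ?T"
    by (auto simp: compact_space_product_topology compact_space_subtopology)
  then have "compactin euclideanreal (f ` topspace ?T)"
    using f unfolding overlap_function_def compact_space_def by (rule image_compactin)
  then have "bounded (f ` (replica_pairs n \<rightarrow>\<^sub>E {-c..c}))"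
    by (simp add: compact_imp_bounded)
  then show ?thesis by (auto simp: bounded_iff)
qed

lemma (in spin_glass_volume) overlap_array_in:
  assumes "n \<le> m" "s \<in> {1..m} \<rightarrow>\<^sub>E S"
  shows "overlap_array \<Delta> L n s \<in> replica_pairs n \<rightarrow>\<^sub>E {-c..c}"
proof -
  have "covariance \<Delta> L (s j) (s k) \<in> {-c..c}" if "(j, k) \<in> replica_pairs n" for j k
  proof -
    have "s j \<in> S" "s k \<in> S" using that assms by (auto simp: replica_pairs_def)
    from abs_covariance_le_c[OF this] show ?thesis by (auto simp: abs_le_iff)
  qed
  then show ?thesis by (auto simp: overlap_array_def)
qed

section \<open>Limits along an exhausting sequence\<close>

context complete_spin_glass
begin

lemma spin_glass_volumeI: "exhausting \<Lambda> \<Longrightarrow> \<Lambda> N \<noteq> {} \<Longrightarrow> spin_glass_volume M \<Delta> c J H (\<Lambda> N)"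
  by unfold_locales (simp_all add: exhausting_def)

context
  fixes \<Lambda> :: "nat \<Rightarrow> 'd site set" and \<beta> :: "nat \<Rightarrow> real" and p :: nat and q :: "real \<Rightarrow> real"
  assumes \<Lambda>: "exhausting \<Lambda>" and \<beta>: "summable (\<lambda>k. (\<beta> (Suc k))\<^sup>2)" and p: "p \<ge> 1"
    and q: "\<And>x. x > 0 \<Longrightarrow> (\<lambda>N. pressure M c H (\<Lambda> N) (\<beta>(p := x))) \<longlonglongrightarrow> q x"
begin

lemma limit_pressure_convex: "convex_on {0<..} q"
  unfolding convex_on_def
proof (intro conjI ballI allI impI)
  fix x y u v :: real
  assume xy: "x \<in> {0<..}" "y \<in> {0<..}" and uv: "0 \<le> u" "0 \<le> v" "u + v = 1"
  have pos: "0 < u * x + v * y"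
    using xy uv by (cases "u = 0") (auto intro!: add_pos_nonneg)
  have "q (u * x + v * y) \<le> u * q x + v * q y"
  proof (rule tendsto_le[OF sequentially_bot _ q[OF pos]])
    show "(\<lambda>N. u * pressure M c H (\<Lambda> N) (\<beta>(p := x)) + v * pressure M c H (\<Lambda> N) (\<beta>(p := y))) \<longlonglongrightarrow> u * q x + v * q y"
      using xy by (intro tendsto_intros q) auto
    show "eventually (\<lambda>N. pressure M c H (\<Lambda> N) (\<beta>(p := u * x + v * y)) \<le>
        u * pressure M c H (\<Lambda> N) (\<beta>(p := x)) + v * pressure M c H (\<Lambda> N) (\<beta>(p := y))) sequentially"
      using exhausting_card(2)[OF \<Lambda>]
      by eventually_elim (rule spin_glass_volume.pressure_convex[OF spin_glass_volumeI[OF \<Lambda>] \<beta> p uv])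
  qed
  then show "q (u *\<^sub>R x + v *\<^sub>R y) \<le> u * q x + v * q y" by simp
qed (rule convex_real_interval)

context
  fixes a :: real
  assumes a: "a > 0"
    and sd: "\<And>e. e > 0 \<Longrightarrow> \<exists>h>0. h < a \<and> (q (a + 2 * h) - q (a + h) - q a + q (a - h)) / h \<le> e"
begin

definition mean_fluctuation :: "nat \<Rightarrow> real" where
  "mean_fluctuation N = (let g = gibbs c H (\<Lambda> N) (\<beta>(p := a)); X = scaled_field c H (\<Lambda> N) p; S = configs (\<Lambda> N);
      \<mu> = expectation (\<lambda>\<omega>. \<Sum>\<sigma>\<in>S. g \<sigma> \<omega> * X \<sigma> \<omega>)
    in expectation (\<lambda>\<omega>. \<Sum>\<sigma>\<in>S. g \<sigma> \<omega> * \<bar>X \<sigma> \<omega> - \<mu>\<bar>) / real (card (\<Lambda> N)))"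

lemma mean_fluctuation_tendsto_0: "mean_fluctuation \<longlonglongrightarrow> 0"
proof (rule LIMSEQ_I)
  fix e :: real assume e: "e > 0"
  obtain h where h: "0 < h" "h < a" and "(q (a + 2 * h) - q (a + h) - q a + q (a - h)) / h \<le> e / 20"
    \<comment> \<open>The second difference enters with factor 5, so the limiting bound is at most
      \<open>e / 4 + 5 * (e / 20)\<close>, which is below \<open>e\<close>.\<close>
    using sd[of "e / 20"] e by auto
  define \<delta> where "\<delta> = (q (a + 2 * h) - q (a + h) - q a + q (a - h)) / h"
  have \<delta>: "\<delta> \<le> e / 20" unfolding \<delta>_def by fact
  define n where "n N = real (card (\<Lambda> N))" for N
  define P where "P N x = pressure M c H (\<Lambda> N) (\<beta>(p := x))" for N x
  define D where "D N = (P N (a + 2 * h) - P N (a + h) - P N a + P N (a - h)) / h" for N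
  define V where "V = (\<Sum>k. ((\<beta>(p := a + 2 * h)) (Suc k))\<^sup>2)"
  \<comment> \<open>\<open>fluctuation_bound\<close> divided by the volume, with its \<epsilon>
    chosen as \<open>e / 4\<close> times the volume. As \<open>h\<close> is fixed, the terms with an
    inverse power of the volume vanish in the limit.\<close>
  define U where "U N = e / 4 + (1 / (e / 4 * h) * inverse (n N) + 5) * D N + 4 * sqrt V / h * inverse (sqrt (n N))" for N
  have n: "filterlim n at_top sequentially" unfolding n_def by (rule exhausting_card(1)[OF \<Lambda>])
  have D: "D \<longlonglongrightarrow> \<delta>"
    unfolding \<delta>_def D_def P_def using h a by (intro tendsto_intros q) auto
  have "U \<longlonglongrightarrow> e / 4 + (1 / (e / 4 * h) * 0 + 5) * \<delta> + 4 * sqrt V / h * 0"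
    unfolding U_def
    by (intro tendsto_intros D tendsto_inverse_0_at_top n filterlim_compose[OF sqrt_at_top n])
  moreover have "e / 4 + (1 / (e / 4 * h) * 0 + 5) * \<delta> + 4 * sqrt V / h * 0 < e"
    using \<delta> e by simp
  ultimately have "eventually (\<lambda>N. U N < e) sequentially" by (rule order_tendstoD)
  then have "eventually (\<lambda>N. norm (mean_fluctuation N - 0) < e) sequentially"
    using exhausting_card(2)[OF \<Lambda>]
  proof eventually_elim
    case (elim N)
    interpret spin_glass_volume M \<Delta> c J H "\<Lambda> N" by (rule spin_glass_volumeI[OF \<Lambda> elim(2)])
    have n0: "n N > 0" unfolding n_def by (rule card_pos)
    let ?g = "gibbs c H (\<Lambda> N) (\<beta>(p := a))" and ?X = "scaled_field c H (\<Lambda> N) p" and ?S = "configs (\<Lambda> N)"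
    define \<mu> where "\<mu> = expectation (\<lambda>\<omega>. \<Sum>\<sigma>\<in>?S. ?g \<sigma> \<omega> * ?X \<sigma> \<omega>)"
    define E where "E = expectation (\<lambda>\<omega>. \<Sum>\<sigma>\<in>?S. ?g \<sigma> \<omega> * \<bar>?X \<sigma> \<omega> - \<mu>\<bar>)"
    have m: "mean_fluctuation N = E / n N"
      by (simp add: mean_fluctuation_def Let_def E_def \<mu>_def n_def)
    have "0 \<le> E" unfolding E_def
      by (rule Bochner_Integration.integral_nonneg) (intro sum_nonneg mult_nonneg_nonneg gibbs_nonneg abs_ge_zero)
    moreover have "E \<le> e / 4 * n N + (1 / (e / 4 * n N * h) + 5) * (n N * D N) + 4 * sqrt (n N * V) / h"
    proof -
      have "e / 4 * n N > 0" using e n0 by simp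
      from fluctuation_bound[OF \<beta> p h this] show ?thesis
        unfolding E_def \<mu>_def D_def P_def V_def n_def .
    qed
    moreover have "(e / 4 * n N + (1 / (e / 4 * n N * h) + 5) * (n N * D N) + 4 * sqrt (n N * V) / h) / n N = U N"
    proof -
      have "sqrt (n N * V) / n N = sqrt V * inverse (sqrt (n N))"
        using n0 by (simp add: real_sqrt_mult field_simps)
      then show ?thesis using n0 e h by (simp add: U_def field_simps)
    qed
    ultimately have "0 \<le> E / n N" "E / n N \<le> U N" using n0 by (auto simp: divide_right_mono[of E _ "n N"] dest: divide_right_mono[of E _ "n N"])
    then show ?case using elim(1) m by simp
  qed
  then show "\<exists>no. \<forall>N\<ge>no. norm (mean_fluctuation N - 0) < e" unfolding eventually_sequentially .
qed

text \<open>Integration by parts yields the defect multiplied by the parameter \<open>a\<close> and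
  the volume, so it is recovered by dividing by \<open>a > 0\<close>; a bound of \<open>f\<close>
  uniform in the volume does the rest.\<close>

lemma replica_defect_tendsto_0:
  assumes f: "overlap_function c n f" and j: "j \<in> {1..m}" and nm: "n \<le> m"
  shows "(\<lambda>N. replica_defect M c \<Delta> H (\<Lambda> N) (\<beta>(p := a)) p (\<lambda>s. f (overlap_array \<Delta> (\<Lambda> N) n s)) m j) \<longlonglongrightarrow> 0"
proof -
  obtain B where B: "\<And>x. x \<in> replica_pairs n \<rightarrow>\<^sub>E {-c..c} \<Longrightarrow> \<bar>f x\<bar> \<le> B"
    using overlap_function_bounded[OF f] by blast
  show ?thesis
  proof (rule Lim_null_comparison)
    show "eventually (\<lambda>N. norm (replica_defect M c \<Delta> H (\<Lambda> N) (\<beta>(p := a)) p (\<lambda>s. f (overlap_array \<Delta> (\<Lambda> N) n s)) m j)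
       \<le> c ^ p * B / a * mean_fluctuation N) sequentially"
      using exhausting_card(2)[OF \<Lambda>]
    proof eventually_elim
      case (elim N)
      interpret spin_glass_volume M \<Delta> c J H "\<Lambda> N" by (rule spin_glass_volumeI[OF \<Lambda> elim])
      define R where "R = \<bar>replica_defect M c \<Delta> H (\<Lambda> N) (\<beta>(p := a)) p (\<lambda>s. f (overlap_array \<Delta> (\<Lambda> N) n s)) m j\<bar>"
      define E where "E = mean_fluctuation N * real (card (\<Lambda> N))"
      have "(\<beta>(p := a)) p * real (card (\<Lambda> N)) * R \<le> c ^ p * (B * E)"
      proof -
        have E: "E = expectation (\<lambda>\<omega>. \<Sum>\<sigma>\<in>configs (\<Lambda> N). gibbs c H (\<Lambda> N) (\<beta>(p := a)) \<sigma> \<omega> *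
             \<bar>scaled_field c H (\<Lambda> N) p \<sigma> \<omega> - expectation (\<lambda>\<omega>. \<Sum>\<sigma>\<in>configs (\<Lambda> N). gibbs c H (\<Lambda> N) (\<beta>(p := a)) \<sigma> \<omega> * scaled_field c H (\<Lambda> N) p \<sigma> \<omega>)\<bar>)"
          using card_pos by (simp add: E_def mean_fluctuation_def Let_def)
        have Bf: "\<bar>f (overlap_array \<Delta> (\<Lambda> N) n s)\<bar> \<le> B" if "s \<in> {1..m} \<rightarrow>\<^sub>E configs (\<Lambda> N)" for s
          by (rule B[OF overlap_array_in[OF nm that]])
        have Ff: "f (overlap_array \<Delta> (\<Lambda> N) n (s(Suc m := \<tau>))) = f (overlap_array \<Delta> (\<Lambda> N) n s)" for s \<tau>
          using nm by (simp add: overlap_array_upd)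
        have "0 \<le> (\<beta>(p := a)) p" using a by simp
        from replica_defect_le[OF summable_fun_upd[OF \<beta>, of p a] p j, of "\<lambda>s. f (overlap_array \<Delta> (\<Lambda> N) n s)" B, OF Ff Bf this]
        show ?thesis unfolding R_def E .
      qed
      then have "(a * R) * real (card (\<Lambda> N)) \<le> (c ^ p * B * mean_fluctuation N) * real (card (\<Lambda> N))"
        by (simp add: E_def mult_ac)
      then have "a * R \<le> c ^ p * B * mean_fluctuation N"
        using card_pos by (simp only: mult_le_cancel_right_pos)
      then show ?case using a by (simp add: R_def[symmetric] pos_le_divide_eq mult.commute)
    qed
    have "(\<lambda>N. c ^ p * B / a * mean_fluctuation N) \<longlonglongrightarrow> c ^ p * B / a * 0"
      by (intro tendsto_intros mean_fluctuation_tendsto_0)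
    then show "(\<lambda>N. c ^ p * B / a * mean_fluctuation N) \<longlonglongrightarrow> 0" by simp
  qed
qed

lemma stochastic_stability_ghirlanda_guerra:
  assumes f: "overlap_function c n f"
  shows "(\<lambda>N. stochastic_stability_average M c \<Delta> H (\<Lambda> N) (\<beta>(p := a)) p n f) \<longlonglongrightarrow> 0"
    and "(\<lambda>N. ghirlanda_guerra_difference M c \<Delta> H (\<Lambda> N) (\<beta>(p := a)) p n f) \<longlonglongrightarrow> 0"
proof -
  note b = summable_fun_upd[OF \<beta>, of p a]
  let ?d = "\<lambda>N. replica_defect M c \<Delta> H (\<Lambda> N) (\<beta>(p := a)) p (\<lambda>s. f (overlap_array \<Delta> (\<Lambda> N) n s))"
  have d: "(\<lambda>N. ?d N m j) \<longlonglongrightarrow> 0" if "j \<in> {1..m}" "n \<le> m" for m j by (rule replica_defect_tendsto_0[OF f that])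
  have "(\<lambda>N. (\<Sum>j\<in>{1..n}. ?d N n j) - real n * ?d N (Suc n) (Suc n)) \<longlonglongrightarrow> (\<Sum>j\<in>{1..n}. 0) - real n * 0"
    by (intro tendsto_diff tendsto_sum tendsto_mult tendsto_const d) auto
  moreover have "eventually (\<lambda>N. stochastic_stability_average M c \<Delta> H (\<Lambda> N) (\<beta>(p := a)) p n f =
      (\<Sum>j\<in>{1..n}. ?d N n j) - real n * ?d N (Suc n) (Suc n)) sequentially"
    using exhausting_card(2)[OF \<Lambda>]
    by eventually_elim (rule spin_glass_volume.stochastic_stability_average_eq(1)[OF spin_glass_volumeI[OF \<Lambda>] b])
  ultimately show "(\<lambda>N. stochastic_stability_average M c \<Delta> H (\<Lambda> N) (\<beta>(p := a)) p n f) \<longlonglongrightarrow> 0"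
    by (simp add: tendsto_cong)
  have "(\<lambda>N. - (1 / (real n + 1)) * ?d N (Suc n) (Suc n)) \<longlonglongrightarrow> - (1 / (real n + 1)) * 0"
    by (intro tendsto_mult tendsto_const d) auto
  moreover have "eventually (\<lambda>N. ghirlanda_guerra_difference M c \<Delta> H (\<Lambda> N) (\<beta>(p := a)) p n f =
      - (1 / (real n + 1)) * ?d N (Suc n) (Suc n)) sequentially"
    using exhausting_card(2)[OF \<Lambda>]
    by eventually_elim (rule spin_glass_volume.stochastic_stability_average_eq(2)[OF spin_glass_volumeI[OF \<Lambda>] b])
  ultimately show "(\<lambda>N. ghirlanda_guerra_difference M c \<Delta> H (\<Lambda> N) (\<beta>(p := a)) p n f) \<longlonglongrightarrow> 0"
    by (simp add: tendsto_cong)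
qed

end

end

end

theorem theorem3p1:
  fixes M :: "'w measure"
    and \<Delta> :: "'d::finite site set \<Rightarrow> 'd site set \<Rightarrow> real"
    and c :: real
    and J :: "'d site set \<Rightarrow> 'd site set \<Rightarrow> 'w \<Rightarrow> real"
    and H :: "'d site set \<Rightarrow> nat \<Rightarrow> 'd config \<Rightarrow> 'w \<Rightarrow> real"
    and \<Lambda> :: "nat \<Rightarrow> 'd site set"
  assumes model: "complete_spin_glass M \<Delta> c J H"
    and volumes: "exhausting \<Lambda>"
    and pressure_limit_exists:
      "\<And>\<beta>. admissible \<beta> \<Longrightarrow> convergent (\<lambda>N. pressure M c H (\<Lambda> N) \<beta>)"
  shows
    "(\<forall>\<beta>. admissible \<beta> \<longrightarrow> (\<forall>p\<ge>1. AE x in lborel. 0 < x \<longrightarrow>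
        (\<forall>n\<ge>1. \<forall>f. overlap_function c n f \<longrightarrow>
          (\<lambda>N. stochastic_stability_average M c \<Delta> H (\<Lambda> N) (\<beta>(p := x)) p n f) \<longlonglongrightarrow> 0)))
     \<and>
     (\<forall>\<beta>. admissible \<beta> \<longrightarrow> (\<forall>n\<ge>2. \<forall>f. overlap_function c n f \<longrightarrow>
        (\<forall>p\<ge>1. AE x in lborel. 0 < x \<longrightarrow>
          (\<lambda>N. ghirlanda_guerra_difference M c \<Delta> H (\<Lambda> N) (\<beta>(p := x)) p n f) \<longlonglongrightarrow> 0)))
     \<and>
     (\<forall>\<beta>. admissible \<beta> \<longrightarrow> (\<forall>p\<ge>1. \<forall>a>0.
        (\<lambda>x. limit_pressure M c H \<Lambda> (\<beta>(p := x))) differentiable (at a) \<longrightarrow>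
        (\<forall>n\<ge>1. \<forall>f. overlap_function c n f \<longrightarrow>
          (\<lambda>N. stochastic_stability_average M c \<Delta> H (\<Lambda> N) (\<beta>(p := a)) p n f) \<longlonglongrightarrow> 0)))
     \<and>
     (\<forall>\<beta>. admissible \<beta> \<longrightarrow> (\<forall>p\<ge>1. \<forall>a>0.
        (\<lambda>x. limit_pressure M c H \<Lambda> (\<beta>(p := x))) differentiable (at a) \<longrightarrow>
        (\<forall>n\<ge>2. \<forall>f. overlap_function c n f \<longrightarrow>
          (\<lambda>N. ghirlanda_guerra_difference M c \<Delta> H (\<Lambda> N) (\<beta>(p := a)) p n f) \<longlonglongrightarrow> 0)))"
proof -
  interpret complete_spin_glass M \<Delta> c J H by (rule model)
  let ?q = "\<lambda>\<beta> p x. limit_pressure M c H \<Lambda> (\<beta>(p := x))"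
  have sq: "summable (\<lambda>k. (\<beta> (Suc k))\<^sup>2)" if "admissible \<beta>" for \<beta> using that by (simp add: admissible_def)
  have lim: "(\<lambda>N. pressure M c H (\<Lambda> N) (\<beta>(p := x))) \<longlonglongrightarrow> ?q \<beta> p x" if "admissible \<beta>" "x > 0" for \<beta> p x
  proof -
    \<comment> \<open>Positivity of \<open>x\<close> keeps the modified sequence admissible, so the
      assumed convergence of the pressure covers it.\<close>
    have "admissible (\<beta>(p := x))"
      using that summable_fun_upd[OF sq[OF that(1)], of p x] unfolding admissible_def by auto
    from pressure_limit_exists[OF this] show ?thesis
      unfolding limit_pressure_def by (simp add: convergent_LIMSEQ_iff)
  qed
  \<comment> \<open>The property shared by both kinds of points: it follows from differentiability
    at \<open>a\<close>, and for almost every positive parameter from convexity of the limiting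
    pressure.\<close>
  define good where "good \<beta> p a \<longleftrightarrow> (\<forall>e>0. \<exists>h>0. h < a \<and>
    (?q \<beta> p (a + 2 * h) - ?q \<beta> p (a + h) - ?q \<beta> p a + ?q \<beta> p (a - h)) / h \<le> e)" for \<beta> p a
  have main: "(\<lambda>N. stochastic_stability_average M c \<Delta> H (\<Lambda> N) (\<beta>(p := a)) p n f) \<longlonglongrightarrow> 0"
    "(\<lambda>N. ghirlanda_guerra_difference M c \<Delta> H (\<Lambda> N) (\<beta>(p := a)) p n f) \<longlonglongrightarrow> 0"
    if "admissible \<beta>" "p \<ge> 1" "a > 0" "good \<beta> p a" "overlap_function c n f" for \<beta> p a n f
    using stochastic_stability_ghirlanda_guerra[OF volumes sq[OF that(1)] that(2) lim[OF that(1)] that(3) _ that(5)]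
      that(4) unfolding good_def by blast+
  have diff: "good \<beta> p a" if "a > 0" "?q \<beta> p differentiable (at a)" for \<beta> p a
    unfolding good_def using differentiable_second_difference[OF that(2,1)] by blast
  \<comment> \<open>\<open>good\<close> involves neither \<open>n\<close> nor \<open>f\<close>, so
    one null set serves all of them.\<close>
  have AE_good: "AE x in lborel. 0 < x \<longrightarrow> good \<beta> p x" if "admissible \<beta>" "p \<ge> 1" for \<beta> p
    unfolding good_def
    by (rule convex_second_difference_AE[OF limit_pressure_convex[OF volumes sq[OF that(1)] that(2) lim[OF that(1)]]])
  show ?thesis
  proof (intro conjI allI impI)
    fix \<beta> :: "nat \<Rightarrow> real" and p :: nat assume \<beta>: "admissible \<beta>" and p: "1 \<le> p"
    show "AE x in lborel. 0 < x \<longrightarrow> (\<forall>n\<ge>1. \<forall>f. overlap_function c n f \<longrightarrow>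
          (\<lambda>N. stochastic_stability_average M c \<Delta> H (\<Lambda> N) (\<beta>(p := x)) p n f) \<longlonglongrightarrow> 0)"
      using AE_good[OF \<beta> p] by eventually_elim (use main(1)[OF \<beta> p] in blast)
    fix n f assume f: "overlap_function c n f"
    show "AE x in lborel. 0 < x \<longrightarrow> (\<lambda>N. ghirlanda_guerra_difference M c \<Delta> H (\<Lambda> N) (\<beta>(p := x)) p n f) \<longlonglongrightarrow> 0"
      using AE_good[OF \<beta> p] by eventually_elim (use main(2)[OF \<beta> p _ _ f] in blast)
    fix a :: real assume a: "0 < a" and d: "?q \<beta> p differentiable (at a)"
    show "(\<lambda>N. stochastic_stability_average M c \<Delta> H (\<Lambda> N) (\<beta>(p := a)) p n f) \<longlonglongrightarrow> 0"
      "(\<lambda>N. ghirlanda_guerra_difference M c \<Delta> H (\<Lambda> N) (\<beta>(p := a)) p n f) \<longlonglongrightarrow> 0"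
      by (rule main[OF \<beta> p a diff[OF a d] f])+
  qed
qed

end
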